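(* Let $n\ge3$ and let $s\in(1,\infty)$ be real; consider $\mathcal{L}_s:C^1(\Delta)\to C^1(\Delta)$. Then: (1) there is $\lambda_s>0$ which is an eigenvalue of $\mathcal{L}_s$ of multiplicity one, and the rest of the spectrum of $\mathcal{L}_s$ is contained in a ball of radius $R(s)<\lambda_s$; moreover for every compact interval $I\subset(1,\infty)$ there is $\epsilon(I)>0$ with $\lambda_s-R(s)\ge\epsilon(I)$ for all $s\in I$; (2) there is a unique probability measure $\nu_s$ on $\Delta$ with $\mathcal{L}_s^*\nu_s=\lambda_s\nu_s$; (3) the unique eigenfunction $h_s\in C^1(\Delta)$ for the eigenvalue $\lambda_s$ with $\nu_s(h_s)=1$ is positive.
   Context: $\gamma_j(y)=(y_1,\dots,\widehat{y_j},\dots,y_n,\sum_{i\ne j}y_i)$ for $1\le j\le n-1$; $\mathcal{H}=\{y\in\mathbf{R}_{\ge0}^n:y_1\le\cdots\le y_n,\ \sum_{j\le n-1}y_j=y_n\}$; $\Delta=\mathcal{H}/\mathbf{R}_+$, points represented as $w=(w_1,\dots,w_{n-1},1)$ with $w_1\le\cdots\le w_{n-1}$, $\sum_{j\le n-1}w_j=1$, with the Euclidean metric from these coordinates; the $\gamma_j$ act on $\Delta$. $T_\Gamma=\{\gamma_{n-1}^A\gamma_j:A\in\mathbf{Z}_{\ge0},1\le j\le n-2\}$. $\mathcal{L}_s[f](w)=\sum_{\gamma\in T_\Gamma}(w_n/(\gamma.w)_n)^sf(\gamma.w)=\sum_{j=1}^{n-2}\sum_{A\ge0}(1+(A+1)(1-w_j))^{-s}f(\gamma_{n-1}^A\gamma_j.w)$;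 $\mathcal{L}_s^*$ is its dual acting on measures. $C^1(\Delta)$ has norm $\|f\|_\infty+\|\nabla f\|_\infty$. *)

theory Defs
  imports "HOL-Probability.Probability" "HOL-Library.Function_Algebras"
begin

section \<open>The maps and the simplex\<close>

text \<open>
  The dimension \<open>n\<close> is \<open>CARD('n)\<close> for a finite linearly ordered index type \<open>'n\<close>; listing its
  elements in increasing order gives the coordinates \<open>1, ..., n\<close>.  Then \<open>n\<close> is \<open>last_ix\<close>,
  \<open>n - 1\<close> is \<open>penult_ix\<close>, and \<open>1 \<le> j \<le> n - 2\<close> is \<open>j < penult_ix\<close>.
\<close>

type_synonym 'n rvec = "(real, 'n) vec"
type_synonym 'n cvec = "(complex, 'n) vec"

definition last_ix :: "'n::{finite,linorder}" where
  "last_ix = Max UNIV"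

definition penult_ix :: "'n::{finite,linorder}" where
  "penult_ix = Max {i. i < last_ix}"

definition next_ix :: "'n::{finite,linorder} \<Rightarrow> 'n" where
  "next_ix k = Min {i. k < i}"

text \<open>Omit the \<open>j\<close>-th coordinate and append the sum of the remaining ones.\<close>

definition gamma :: "'n::{finite,linorder} \<Rightarrow> 'n rvec \<Rightarrow> 'n rvec" where
  "gamma j y = (\<chi> k. if k = last_ix then (\<Sum>i\<in>UNIV - {j}. y $ i)
                      else if k < j then y $ k
                      else y $ next_ix k)"

definition T_Gamma :: "('n::{finite,linorder} rvec \<Rightarrow> 'n rvec) set" where
  "T_Gamma = {(gamma penult_ix ^^ A) \<circ> gamma j | A j. j < penult_ix}"

definition H_cone :: "('n::{finite,linorder} rvec) set" where
  "H_cone = {y. (\<forall>i. 0 \<le> y $ i) \<and> (\<forall>i j. i \<le> j \<longrightarrow> y $ i \<le> y $ j) \<and>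
                (\<Sum>i\<in>UNIV - {last_ix}. y $ i) = y $ last_ix}"

text \<open>The quotient of \<open>H_cone\<close> by positive scalings, as the slice where the last coordinate is 1.\<close>

definition Delta :: "('n::{finite,linorder} rvec) set" where
  "Delta = {w \<in> H_cone. w $ last_ix = 1}"

definition proj_act :: "('n rvec \<Rightarrow> 'n rvec) \<Rightarrow> 'n::{finite,linorder} rvec \<Rightarrow> 'n rvec" where
  "proj_act g w = (1 / g w $ last_ix) *\<^sub>R g w"


section \<open>The space of continuously differentiable functions on the simplex\<close>

text \<open>
  A gradient of \<open>f\<close> at \<open>w\<close> relative to \<open>Delta\<close>, as a vector tangent to the affine hull of
  \<open>Delta\<close> (a translate of the space of \<open>v\<close> whose last coordinate and whose coordinate sum
  vanish).  Functions are complex valued, since their spectral theory is studied.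
\<close>

definition has_gradient :: "('n rvec \<Rightarrow> complex) \<Rightarrow> 'n cvec \<Rightarrow> 'n::{finite,linorder} rvec \<Rightarrow> bool" where
  "has_gradient f g w \<longleftrightarrow>
     (f has_derivative (\<lambda>v. \<Sum>i\<in>UNIV. g $ i * of_real (v $ i))) (at w within Delta) \<and>
     g $ last_ix = 0 \<and> (\<Sum>i\<in>UNIV. g $ i) = 0"

definition grad :: "('n rvec \<Rightarrow> complex) \<Rightarrow> 'n::{finite,linorder} rvec \<Rightarrow> 'n cvec" where
  "grad f w = (THE g. has_gradient f g w)"

text \<open>
  Functions on \<open>Delta\<close> are represented by functions on the ambient space that vanish off
  \<open>Delta\<close>, so that equality of functions is equality on \<open>Delta\<close>.
\<close>

definition C1 :: "('n::{finite,linorder} rvec \<Rightarrow> complex) set" where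
  "C1 = {f. (\<forall>w. w \<notin> Delta \<longrightarrow> f w = 0) \<and>
            (\<exists>G. continuous_on Delta G \<and> (\<forall>w\<in>Delta. has_gradient f (G w) w))}"

definition C1_norm :: "('n::{finite,linorder} rvec \<Rightarrow> complex) \<Rightarrow> real" where
  "C1_norm f = (SUP w\<in>Delta. norm (f w)) + (SUP w\<in>Delta. norm (grad f w))"


section \<open>Operators on a normed space of complex functions\<close>

definition cscale :: "complex \<Rightarrow> ('a \<Rightarrow> complex) \<Rightarrow> 'a \<Rightarrow> complex" where
  "cscale c f = (\<lambda>x. c * f x)"

text \<open>Here \<open>X\<close> is a complex linear space of functions and \<open>N\<close> a norm on it.\<close>

definition bounded_operator ::
    "('a \<Rightarrow> complex) set \<Rightarrow> (('a \<Rightarrow> complex) \<Rightarrow> real) \<Rightarrow> (('a \<Rightarrow> complex) \<Rightarrow> 'a \<Rightarrow> complex) \<Rightarrow> bool" where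
  "bounded_operator X N T \<longleftrightarrow>
     (\<forall>f\<in>X. T f \<in> X) \<and>
     (\<forall>f\<in>X. \<forall>g\<in>X. T (f + g) = T f + T g) \<and>
     (\<forall>c. \<forall>f\<in>X. T (cscale c f) = cscale c (T f)) \<and>
     (\<exists>K. \<forall>f\<in>X. N (T f) \<le> K * N f)"

definition op_spectrum ::
    "('a \<Rightarrow> complex) set \<Rightarrow> (('a \<Rightarrow> complex) \<Rightarrow> real) \<Rightarrow> (('a \<Rightarrow> complex) \<Rightarrow> 'a \<Rightarrow> complex) \<Rightarrow> complex set" where
  "op_spectrum X N T =
     {z. \<not> (\<exists>S. bounded_operator X N S \<and>
               (\<forall>f\<in>X. S (cscale z f - T f) = f \<and> cscale z (S f) - T (S f) = f))}"

definition op_eigenvalue ::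
    "('a \<Rightarrow> complex) set \<Rightarrow> (('a \<Rightarrow> complex) \<Rightarrow> 'a \<Rightarrow> complex) \<Rightarrow> complex \<Rightarrow> bool" where
  "op_eigenvalue X T z \<longleftrightarrow> (\<exists>f\<in>X. f \<noteq> 0 \<and> T f = cscale z f)"

text \<open>Algebraic multiplicity: the dimension of the generalised eigenspace.\<close>

definition gen_eigenspace ::
    "('a \<Rightarrow> complex) set \<Rightarrow> (('a \<Rightarrow> complex) \<Rightarrow> 'a \<Rightarrow> complex) \<Rightarrow> complex \<Rightarrow> ('a \<Rightarrow> complex) set" where
  "gen_eigenspace X T z = {f \<in> X. \<exists>k. ((\<lambda>g. T g - cscale z g) ^^ k) f = 0}"

definition multiplicity_of ::
    "('a \<Rightarrow> complex) set \<Rightarrow> (('a \<Rightarrow> complex) \<Rightarrow> 'a \<Rightarrow> complex) \<Rightarrow> complex \<Rightarrow> nat" where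
  "multiplicity_of X T z = vector_space.dim cscale (gen_eigenspace X T z)"


section \<open>The transfer operator and its dual\<close>

text \<open>In the weight the vectors \<open>w\<close> and \<open>g w\<close> are not normalised; \<open>f\<close> is evaluated at the
  normalised point.\<close>

definition transfer ::
    "real \<Rightarrow> ('n rvec \<Rightarrow> complex) \<Rightarrow> 'n::{finite,linorder} rvec \<Rightarrow> complex" where
  "transfer s f w =
     (if w \<in> Delta
      then (\<Sum>\<^sub>\<infinity>g\<in>T_Gamma. of_real ((w $ last_ix / g w $ last_ix) powr s) * f (proj_act g w))
      else 0)"

definition measure_on_Delta :: "('n::{finite,linorder} rvec) measure \<Rightarrow> bool" where
  "measure_on_Delta \<mu> \<longleftrightarrow> finite_measure \<mu> \<and> sets \<mu> = sets (restrict_space borel Delta)"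

text \<open>\<open>transfer_dual s \<nu> \<mu>\<close> states that the dual operator maps \<open>\<nu>\<close> to \<open>\<mu>\<close>, measures on \<open>Delta\<close>
  being identified with functionals on the continuous functions.\<close>

definition transfer_dual ::
    "real \<Rightarrow> ('n::{finite,linorder} rvec) measure \<Rightarrow> ('n rvec) measure \<Rightarrow> bool" where
  "transfer_dual s \<nu> \<mu> \<longleftrightarrow>
     measure_on_Delta \<nu> \<and> measure_on_Delta \<mu> \<and>
     (\<forall>f. continuous_on Delta f \<longrightarrow> integral\<^sup>L \<mu> f = integral\<^sup>L \<nu> (transfer s f))"

end

theory Submission
  imports Defs
begin

text \<open>
  In the \<open>\<ell>\<^sup>1\<close> metric on the coordinates, the branch \<open>\<gamma> = \<gamma>\<^bsub>n-1\<^esub>\<^sup>A \<gamma>\<^sub>j\<close> contracts distances by the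
  factor \<open>1 / (\<gamma>.w)\<^sub>n \<le> 2/3\<close>, and the logarithm of its weight is Lipschitz with constant \<open>2 s\<close>.  Hence
  \<open>\<L>\<^sub>s\<close> maps the cone of functions whose logarithm is \<open>M\<close>-Lipschitz strictly inside itself for
  \<open>M = 12 s\<close>.  If \<open>F\<close> lies between \<open>a G\<close> and \<open>b G\<close> in the order of this cone, one application of
  \<open>\<L>\<^sub>s\<close> shrinks \<open>b - a\<close> by the explicit factor \<open>\<rho> = 1 - exp (- 40 s) / 22\<close>.  This gives the eigenvalue,
  the eigenfunction and exponential convergence \<open>\<lambda>\<^sup>-\<^sup>n \<L>\<^sub>s\<^sup>n f \<rightarrow> \<nu> f h\<close> in the Lipschitz norm, which on
  \<open>C\<^sup>1\<close> is equivalent to the \<open>C\<^sup>1\<close> norm; the limit functional is integration against a measure by the Riesz theorem.  The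
  resolvent outside \<open>{\<lambda>}\<close> and the disc of radius \<open>R = \<lambda> \<rho>\<close> is a rank one operator plus a Neumann
  series, and \<open>\<lambda> - R \<ge> 2\<^sup>-\<^sup>s exp (- 40 s) / 22\<close> is bounded below on compact intervals.
\<close>

section \<open>Positive operators driven by contractions\<close>

text \<open>The sum defining the operator is never differentiated term by term. On the convex set
  \<open>Delta\<close> a gradient is bounded by the Lipschitz constant of its function, so
  \<open>C1\<close> is closed under limits in the Lipschitz norm; estimates are made for Lipschitz
  functions and then carried over. The l1 metric fits because deleting a coordinate and
  renormalising moves mass, which is what this metric measures, so the two effects combine into one
  factor.

  Uniformity on compact intervals requires explicit constants. Order intervals are therefore
  shortened by hand at a base point, with no compactness argument hiding the rate: first relative to
  the iterates of 1, which produces the eigenfunction, then relative to the eigenfunction, which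
  produces the convergence. With contraction 2/3, weight constant \<open>2 * s\<close> and diameter
  2, one application lowers the cone constant by the factor 5/6, to \<open>10 * s\<close>. Two
  Harnack inequalities over diameter 2 then cost \<open>exp (40 * s)\<close>, and 22 is twice the
  quotient of 1 + 5/6 and 1 - 5/6.\<close>

locale bounded_dissimilarity =
  fixes K :: "'a set" and d :: "'a \<Rightarrow> 'a \<Rightarrow> real" and D :: real
  assumes K_nonempty: "K \<noteq> {}"
    and d_nonneg: "\<And>x y. x \<in> K \<Longrightarrow> y \<in> K \<Longrightarrow> 0 \<le> d x y"
    and d_le: "\<And>x y. x \<in> K \<Longrightarrow> y \<in> K \<Longrightarrow> d x y \<le> D"
    and d_sym: "\<And>x y. x \<in> K \<Longrightarrow> y \<in> K \<Longrightarrow> d x y = d y x"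
begin

definition base :: 'a where "base = (SOME x. x \<in> K)"

lemma base_in: "base \<in> K"
  unfolding base_def using K_nonempty by (simp add: some_in_eq)

lemma D_nonneg: "0 \<le> D"
  using d_nonneg[OF base_in base_in] d_le[OF base_in base_in] by linarith

text \<open>Size and Lipschitz constant share one bound, so the least \<open>B\<close> is a norm
  equivalent to the usual Lipschitz norm. The relation avoids suprema of sets not yet known to be
  bounded.\<close>

definition lip_le :: "('a \<Rightarrow> 'b::real_normed_vector) \<Rightarrow> real \<Rightarrow> bool" where
  "lip_le f B \<longleftrightarrow> (\<forall>x\<in>K. norm (f x) \<le> B) \<and> (\<forall>x\<in>K. \<forall>y\<in>K. norm (f x - f y) \<le> B * d x y)"

lemma lip_leI:
  assumes "\<And>x. x \<in> K \<Longrightarrow> norm (f x) \<le> B" "\<And>x y. x \<in> K \<Longrightarrow> y \<in> K \<Longrightarrow> norm (f x - f y) \<le> B * d x y"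
  shows "lip_le f B"
  using assms by (simp add: lip_le_def)

lemma lip_leD:
  assumes "lip_le f B"
  shows "\<And>x. x \<in> K \<Longrightarrow> norm (f x) \<le> B" "\<And>x y. x \<in> K \<Longrightarrow> y \<in> K \<Longrightarrow> norm (f x - f y) \<le> B * d x y"
  using assms by (auto simp: lip_le_def)

lemma lip_le_nonneg: "lip_le f B \<Longrightarrow> 0 \<le> B"
  using lip_leD(1)[OF _ base_in] norm_ge_zero order_trans by blast

lemma lip_le_bounded: "lip_le f B \<Longrightarrow> bounded (f ` K)"
  using lip_leD(1) by (auto simp: bounded_iff)

lemma lip_le_mono: "lip_le f B \<Longrightarrow> B \<le> B' \<Longrightarrow> lip_le f B'"
  unfolding lip_le_def using d_nonneg by (smt (verit) mult_right_mono)

lemma lip_le_cong: "(\<And>x. x \<in> K \<Longrightarrow> f x = g x) \<Longrightarrow> lip_le f B \<longleftrightarrow> lip_le g B"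
  by (simp add: lip_le_def)

lemma lip_le_add: "lip_le f B \<Longrightarrow> lip_le g B' \<Longrightarrow> lip_le (\<lambda>x. f x + g x) (B + B')"
proof (rule lip_leI)
  assume f: "lip_le f B" and g: "lip_le g B'"
  show "norm (f x + g x) \<le> B + B'" if "x \<in> K" for x
    using lip_leD(1)[OF f that] lip_leD(1)[OF g that] by (rule norm_triangle_mono)
  show "norm (f x + g x - (f y + g y)) \<le> (B + B') * d x y" if "x \<in> K" "y \<in> K" for x y
    using norm_triangle_mono[OF lip_leD(2)[OF f that] lip_leD(2)[OF g that]] by (simp add: algebra_simps)
qed

lemma lip_le_scaleR: "lip_le f B \<Longrightarrow> lip_le (\<lambda>x. a *\<^sub>R f x) (\<bar>a\<bar> * B)"
proof (rule lip_leI)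
  assume f: "lip_le f B"
  show "norm (a *\<^sub>R f x) \<le> \<bar>a\<bar> * B" if "x \<in> K" for x
    using lip_leD(1)[OF f that] by (simp add: mult_left_mono)
  show "norm (a *\<^sub>R f x - a *\<^sub>R f y) \<le> \<bar>a\<bar> * B * d x y" if "x \<in> K" "y \<in> K" for x y
    using mult_left_mono[OF lip_leD(2)[OF f that], of "\<bar>a\<bar>"]
    by (simp add: scaleR_diff_right[symmetric] mult.assoc del: scaleR_diff_right)
qed

lemma lip_le_diff: "lip_le f B \<Longrightarrow> lip_le g B' \<Longrightarrow> lip_le (\<lambda>x. f x - g x) (B + B')"
  using lip_le_add[of f B "\<lambda>x. (-1) *\<^sub>R g x" B'] lip_le_scaleR[of g B' "-1"] by simp

lemma lip_le_bounded_linear: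
  assumes "bounded_linear T" "\<And>x. norm (T x) \<le> norm x" "lip_le f B"
  shows "lip_le (\<lambda>x. T (f x)) B"
proof -
  interpret T: bounded_linear T by fact
  show ?thesis
    using lip_leD[OF assms(3)] order_trans[OF assms(2)] by (auto simp: lip_le_def T.diff[symmetric])
qed

end

locale contracting_system = bounded_dissimilarity K d D
  for K :: "'a set" and d :: "'a \<Rightarrow> 'a \<Rightarrow> real" and D :: real +
  fixes I :: "'i set" and \<phi> :: "'i \<Rightarrow> 'a \<Rightarrow> 'a" and wt :: "'i \<Rightarrow> 'a \<Rightarrow> real" and \<theta> c :: real
  assumes I_nonempty: "I \<noteq> {}"
    and \<theta>_nonneg: "0 \<le> \<theta>" and \<theta>_less_1: "\<theta> < 1" and c_pos: "0 < c"
    and \<phi>_in: "\<And>i x. i \<in> I \<Longrightarrow> x \<in> K \<Longrightarrow> \<phi> i x \<in> K"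
    and \<phi>_contract: "\<And>i x y. i \<in> I \<Longrightarrow> x \<in> K \<Longrightarrow> y \<in> K \<Longrightarrow> d (\<phi> i x) (\<phi> i y) \<le> \<theta> * d x y"
    and wt_pos: "\<And>i x. i \<in> I \<Longrightarrow> x \<in> K \<Longrightarrow> 0 < wt i x"
    and wt_log_lip: "\<And>i x y. i \<in> I \<Longrightarrow> x \<in> K \<Longrightarrow> y \<in> K \<Longrightarrow> wt i x \<le> exp (c * d x y) * wt i y"
    and wt_summable: "\<And>x. x \<in> K \<Longrightarrow> (\<lambda>i. wt i x) summable_on I"
begin

section \<open>The weighted composition operator on bounded functions\<close>

definition L :: "('a \<Rightarrow> 'b::banach) \<Rightarrow> 'a \<Rightarrow> 'b" where
  "L f x = (if x \<in> K then \<Sum>\<^sub>\<infinity>i\<in>I. wt i x *\<^sub>R f (\<phi> i x) else 0)"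

text \<open>Nonnegative functions with \<open>M\<close>-Lipschitz logarithm. The multiplicative form
  admits the zero function; a member that vanishes at one point of \<open>K\<close> vanishes on all
  of \<open>K\<close>.\<close>

definition log_lip_cone :: "real \<Rightarrow> ('a \<Rightarrow> real) set" where
  "log_lip_cone M = {f. \<forall>x\<in>K. 0 \<le> f x \<and> (\<forall>y\<in>K. f x \<le> exp (M * d x y) * f y)}"

lemma abs_summable_terms:
  fixes f :: "'a \<Rightarrow> 'b::banach"
  assumes "x \<in> K" "bounded (f ` K)"
  shows "(\<lambda>i. norm (wt i x *\<^sub>R f (\<phi> i x))) summable_on I"
proof -
  obtain B where B: "\<And>y. y \<in> K \<Longrightarrow> norm (f y) \<le> B"
    using assms(2) by (auto simp: bounded_iff)
  have "(\<lambda>i. wt i x * B) summable_on I"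
    using wt_summable[OF assms(1)] by (rule summable_on_cmult_left)
  then show ?thesis
  proof (rule summable_on_comparison_test)
    fix i assume "i \<in> I"
    then show "norm (wt i x *\<^sub>R f (\<phi> i x)) \<le> wt i x * B"
      using B[OF \<phi>_in[OF _ assms(1)]] wt_pos[OF _ assms(1), of i] by (simp add: mult_left_mono)
  qed simp
qed

lemmas summable_terms = abs_summable_summable[OF abs_summable_terms]

text \<open>Infinite sums commute with bounded linear maps of the values. Used with
  \<open>Re\<close>, \<open>Im\<close> and \<open>of_real\<close>, this carries the real theory over
  to complex functions.\<close>

lemma L_bounded_linear:
  fixes f :: "'a \<Rightarrow> 'b::banach" and T :: "'b \<Rightarrow> 'c::banach"
  assumes "bounded_linear T" "bounded (f ` K)"
  shows "L (\<lambda>x. T (f x)) = (\<lambda>x. T (L f x))"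
proof
  fix x
  interpret bounded_linear T by fact
  show "L (\<lambda>x. T (f x)) x = T (L f x)"
  proof (cases "x \<in> K")
    case True
    have "(\<Sum>\<^sub>\<infinity>i\<in>I. T (wt i x *\<^sub>R f (\<phi> i x))) = T (\<Sum>\<^sub>\<infinity>i\<in>I. wt i x *\<^sub>R f (\<phi> i x))"
      by (rule infsum_bounded_linear_strong[OF _ assms(1)])
        (use summable_terms[OF True assms(2)] summable_on_bounded_linear[OF assms(1)] in blast)
    then show ?thesis using True by (simp add: L_def scaleR)
  qed (simp add: L_def zero)
qed

lemma L_add:
  fixes f g :: "'a \<Rightarrow> 'b::banach"
  assumes "bounded (f ` K)" "bounded (g ` K)"
  shows "L (\<lambda>x. f x + g x) = (\<lambda>x. L f x + L g x)"
  by (rule ext) (simp add: L_def scaleR_add_right infsum_add summable_terms assms)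

lemma L_scaleR:
  fixes f :: "'a \<Rightarrow> 'b::banach"
  shows "L (\<lambda>x. a *\<^sub>R f x) = (\<lambda>x. a *\<^sub>R L f x)"
proof -
  have "(\<Sum>\<^sub>\<infinity>i\<in>I. wt i x *\<^sub>R a *\<^sub>R f (\<phi> i x)) = (\<Sum>\<^sub>\<infinity>i\<in>I. a *\<^sub>R wt i x *\<^sub>R f (\<phi> i x))" for x
    by (simp add: mult.commute)
  then show ?thesis
    unfolding L_def infsum_scaleR_right by (intro ext) auto
qed

lemma L_cmult:
  fixes f :: "'a \<Rightarrow> real"
  shows "L (\<lambda>x. a * f x) = (\<lambda>x. a * L f x)"
  using L_scaleR[of a f] by simp

lemma bounded_scaleR_image:
  fixes f :: "'a \<Rightarrow> 'b::real_normed_vector"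
  shows "bounded (f ` K) \<Longrightarrow> bounded ((\<lambda>x. a *\<^sub>R f x) ` K)"
  using bounded_scaling[of "f ` K" a] by (simp add: image_image)

lemma L_diff:
  fixes f g :: "'a \<Rightarrow> 'b::banach"
  assumes "bounded (f ` K)" "bounded (g ` K)"
  shows "L (\<lambda>x. f x - g x) = (\<lambda>x. L f x - L g x)"
  using L_add[OF assms(1) bounded_scaleR_image[OF assms(2), of "-1"]] L_scaleR[of "-1" g] by simp

lemma L_cong: "(\<And>x. x \<in> K \<Longrightarrow> f x = g x) \<Longrightarrow> L f = L g"
  unfolding L_def by (rule ext) (auto intro!: infsum_cong simp: \<phi>_in)

lemma L_mono:
  fixes f g :: "'a \<Rightarrow> real"
  assumes "bounded (f ` K)" "bounded (g ` K)" "\<And>x. x \<in> K \<Longrightarrow> f x \<le> g x"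
  shows "L f x \<le> L g x"
  unfolding L_def
  by (auto intro!: infsum_mono summable_terms[where 'b = real, simplified] assms mult_left_mono \<phi>_in less_imp_le[OF wt_pos])

lemma L_const_real: "L (\<lambda>_. a) = (\<lambda>x. a * L (\<lambda>_. 1::real) x)"
  using L_cmult[of a "\<lambda>_. 1"] by simp

lemma norm_L_le:
  fixes f :: "'a \<Rightarrow> 'b::banach"
  assumes "\<And>x. x \<in> K \<Longrightarrow> norm (f x) \<le> B" and x: "x \<in> K"
  shows "norm (L f x) \<le> B * L (\<lambda>_. 1::real) x"
proof -
  have bf: "bounded (f ` K)" using assms(1) by (auto simp: bounded_iff)
  have "norm (L f x) \<le> L (\<lambda>_. B) x"
    unfolding L_def using x
    by (auto intro!: norm_infsum_le[OF has_sum_infsum has_sum_infsum] summable_terms bf assms(1) \<phi>_in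
      wt_summable summable_on_cmult_left simp: abs_of_pos wt_pos)
  then show ?thesis by (simp add: L_const_real[of B])
qed

lemma L_one_pos: "x \<in> K \<Longrightarrow> 0 < L (\<lambda>_. 1::real) x"
proof -
  assume x: "x \<in> K"
  obtain i where i: "i \<in> I" using I_nonempty by blast
  have "infsum (\<lambda>i. wt i x) {i} \<le> infsum (\<lambda>i. wt i x) I"
    by (rule infsum_mono2) (auto simp: i wt_summable x less_imp_le[OF wt_pos])
  then show ?thesis using wt_pos[OF i x] x by (simp add: L_def)
qed

section \<open>Cones of functions with Lipschitz logarithm\<close>

lemma cone_nonneg: "f \<in> log_lip_cone M \<Longrightarrow> x \<in> K \<Longrightarrow> 0 \<le> f x"
  by (simp add: log_lip_cone_def)

lemma cone_le: "f \<in> log_lip_cone M \<Longrightarrow> x \<in> K \<Longrightarrow> y \<in> K \<Longrightarrow> f x \<le> exp (M * d x y) * f y"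
  by (simp add: log_lip_cone_def)

text \<open>Harnack inequality: since \<open>d\<close> is bounded by \<open>D\<close>, all values of
  a cone function are comparable with one constant.\<close>

lemma cone_le_D:
  assumes "0 \<le> M" "f \<in> log_lip_cone M" "x \<in> K" "y \<in> K" shows "f x \<le> exp (M * D) * f y"
proof -
  have "M * d x y \<le> M * D" using assms d_le by (simp add: mult_left_mono)
  then have "exp (M * d x y) * f y \<le> exp (M * D) * f y"
    using cone_nonneg[OF assms(2,4)] by (simp add: mult_right_mono)
  then show ?thesis using cone_le[OF assms(2-4)] by linarith
qed

lemma cone_bounded: "0 \<le> M \<Longrightarrow> f \<in> log_lip_cone M \<Longrightarrow> bounded (f ` K)"
proof -
  assume a: "0 \<le> M" "f \<in> log_lip_cone M"
  have "norm (f x) \<le> exp (M * D) * f base" if "x \<in> K" for x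
    using cone_le_D[OF a that base_in] cone_nonneg[OF a(2) that] by simp
  then show ?thesis unfolding bounded_iff by blast
qed

lemma cone_mono: "M \<le> M' \<Longrightarrow> log_lip_cone M \<subseteq> log_lip_cone M'"
proof
  fix f assume a: "M \<le> M'" "f \<in> log_lip_cone M"
  have "f x \<le> exp (M' * d x y) * f y" if "x \<in> K" "y \<in> K" for x y
  proof -
    have "exp (M * d x y) * f y \<le> exp (M' * d x y) * f y"
      using a cone_nonneg[OF a(2)] d_nonneg that by (simp add: mult_right_mono)
    then show ?thesis using cone_le[OF a(2) that] by linarith
  qed
  then show "f \<in> log_lip_cone M'" using cone_nonneg[OF a(2)] by (auto simp: log_lip_cone_def)
qed

lemma cone_cmult: "0 \<le> a \<Longrightarrow> f \<in> log_lip_cone M \<Longrightarrow> (\<lambda>x. a * f x) \<in> log_lip_cone M"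
  unfolding log_lip_cone_def by (auto simp: mult.left_commute intro!: mult_left_mono)

lemma cone_one: "0 \<le> M \<Longrightarrow> (\<lambda>_. 1) \<in> log_lip_cone M"
  by (auto simp: log_lip_cone_def d_nonneg)

text \<open>In each term the weight contributes \<open>c\<close> to the exponent, and the
  contraction multiplies the contribution of \<open>f\<close> by \<open>\<theta>\<close>. A sum of
  terms with a common ratio bound keeps that bound.\<close>

lemma L_cone:
  assumes "0 \<le> M" "f \<in> log_lip_cone M"
  shows "L f \<in> log_lip_cone (c + \<theta> * M)"
proof -
  have bf: "bounded (f ` K)" using cone_bounded assms by blast
  have 1: "0 \<le> L f x" if "x \<in> K" for x
    using that unfolding L_def
    by (auto intro!: infsum_nonneg mult_nonneg_nonneg less_imp_le[OF wt_pos] cone_nonneg[OF assms(2)] \<phi>_in)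
  have 2: "L f x \<le> exp ((c + \<theta> * M) * d x y) * L f y" if x: "x \<in> K" and y: "y \<in> K" for x y
  proof -
    let ?e = "exp ((c + \<theta> * M) * d x y)"
    have "wt i x * f (\<phi> i x) \<le> ?e * (wt i y * f (\<phi> i y))" if i: "i \<in> I" for i
    proof -
      have "f (\<phi> i x) \<le> exp (M * d (\<phi> i x) (\<phi> i y)) * f (\<phi> i y)"
        using cone_le[OF assms(2)] \<phi>_in i x y by blast
      also have "\<dots> \<le> exp (M * (\<theta> * d x y)) * f (\<phi> i y)"
        using \<phi>_contract[OF i x y] cone_nonneg[OF assms(2)] \<phi>_in i y assms(1)
        by (intro mult_right_mono) (auto intro!: mult_left_mono)
      finally have "f (\<phi> i x) \<le> exp (M * (\<theta> * d x y)) * f (\<phi> i y)" .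
      then have "wt i x * f (\<phi> i x) \<le> (exp (c * d x y) * wt i y) * (exp (M * (\<theta> * d x y)) * f (\<phi> i y))"
        using wt_log_lip[OF i x y] wt_pos[OF i x] wt_pos[OF i y] cone_nonneg[OF assms(2)] \<phi>_in i x
        by (intro mult_mono) auto
      also have "\<dots> = ?e * (wt i y * f (\<phi> i y))"
        by (simp add: algebra_simps exp_add)
      finally show ?thesis .
    qed
    then have "(\<Sum>\<^sub>\<infinity>i\<in>I. wt i x * f (\<phi> i x)) \<le> (\<Sum>\<^sub>\<infinity>i\<in>I. ?e * (wt i y * f (\<phi> i y)))"
      using summable_terms[OF x bf] summable_on_cmult_right[OF summable_terms[OF y bf, simplified]]
      by (intro infsum_mono) auto
    then show ?thesis using x y by (simp add: L_def infsum_cmult_right')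
  qed
  show ?thesis using 1 2 by (auto simp: log_lip_cone_def)
qed

text \<open>\<open>\<tau>\<close> is the midpoint of \<open>\<theta>\<close> and 1, and
  \<open>big\<close> solves \<open>c + \<theta> * big = \<tau> * big\<close>. Thus \<open>L\<close>
  maps the cone with constant \<open>big\<close> into the one whose constant is smaller by the
  factor \<open>\<tau>\<close>.\<close>

definition \<tau> :: real where "\<tau> = (1 + \<theta>) / 2"
definition big :: real where "big = 2 * c / (1 - \<theta>)"
definition small :: real where "small = \<tau> * big"
definition \<kappa> :: real where "\<kappa> = (1 - \<tau>) / (1 + \<tau>)"
text \<open>The 1/2 comes from choosing the better half of an interval, the exponential from two
  Harnack inequalities in the smaller cone, and \<open>\<kappa>\<close> from the subtraction in
  \<open>cone_diff\<close>.\<close>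

definition \<rho> :: real where "\<rho> = 1 - \<kappa> * exp (- 2 * small * D) / 2"

lemma \<tau>_bounds: "0 < \<tau>" "\<tau> < 1"
  using \<theta>_nonneg \<theta>_less_1 by (auto simp: \<tau>_def)

lemma big_pos: "0 < big" using c_pos \<theta>_less_1 by (simp add: big_def)

lemma small_pos: "0 < small" using big_pos \<tau>_bounds by (simp add: small_def)

lemma small_le_big: "small \<le> big" using big_pos \<tau>_bounds by (simp add: small_def mult_left_le_one_le)

lemma small_eq: "c + \<theta> * big = small"
  using \<theta>_less_1 by (simp add: small_def big_def \<tau>_def field_simps)

lemma \<kappa>_bounds: "0 < \<kappa>" "\<kappa> < 1"
  using \<tau>_bounds by (auto simp: \<kappa>_def)

lemma \<rho>_bounds: "0 < \<rho>" "\<rho> < 1"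
proof -
  have "exp (- 2 * small * D) \<le> 1" using small_pos D_nonneg by (auto simp: mult_nonneg_nonneg)
  then have "\<kappa> * exp (- 2 * small * D) \<le> 1"
    using \<kappa>_bounds by (metis less_eq_real_def mult_le_one exp_ge_zero)
  then show "0 < \<rho>" by (simp add: \<rho>_def)
  show "\<rho> < 1" using \<kappa>_bounds by (simp add: \<rho>_def)
qed

lemma L_cone_small: "f \<in> log_lip_cone big \<Longrightarrow> L f \<in> log_lip_cone small"
  using L_cone[of big f] big_pos by (simp add: small_eq)

lemma small_in_big: "f \<in> log_lip_cone small \<Longrightarrow> f \<in> log_lip_cone big"
  using cone_mono[OF small_le_big] by blast

text \<open>The convex combination \<open>\<tau> t = (1 - \<kappa>) t + \<kappa> (- \<tau> t)\<close> is what fixes the value of \<open>\<kappa>\<close>.\<close>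

lemma cone_diff:
  assumes F: "F \<in> log_lip_cone small" and G: "G \<in> log_lip_cone small" and q: "0 \<le> q"
    and le: "\<And>x. x \<in> K \<Longrightarrow> q * G x \<le> F x"
  shows "(\<lambda>x. F x - \<kappa> * q * G x) \<in> log_lip_cone big"
proof -
  have 1: "0 \<le> F x - \<kappa> * q * G x" if x: "x \<in> K" for x
  proof -
    have "\<kappa> * (q * G x) \<le> 1 * (q * G x)"
      using \<kappa>_bounds q cone_nonneg[OF G x] by (intro mult_right_mono) auto
    then show ?thesis using le[OF x] by simp
  qed
  have 2: "F x - \<kappa> * q * G x \<le> exp (big * d x y) * (F y - \<kappa> * q * G y)" if x: "x \<in> K" and y: "y \<in> K" for x y
  proof -
    define t where "t = big * d x y"
    have t: "0 \<le> t" using big_pos d_nonneg[OF x y] by (simp add: t_def)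
    have st: "small * d x y = \<tau> * t" by (simp add: t_def small_def)
    have f: "F x \<le> exp (\<tau> * t) * F y" using cone_le[OF F x y] st by simp
    have "G y \<le> exp (\<tau> * t) * G x" using cone_le[OF G y x] st d_sym[OF x y] by simp
    then have g: "exp (- (\<tau> * t)) * G y \<le> G x"
      by (simp add: exp_minus field_simps)
    have cv: "exp (\<tau> * t) \<le> (1 - \<kappa>) * exp t + \<kappa> * exp (- (\<tau> * t))"
    proof -
      have "exp ((1 - \<kappa>) *\<^sub>R t + \<kappa> *\<^sub>R (- (\<tau> * t))) \<le> (1 - \<kappa>) * exp t + \<kappa> * exp (- (\<tau> * t))"
        using \<kappa>_bounds by (intro convex_onD[OF exp_convex]) auto
      moreover have "(1 - \<kappa>) *\<^sub>R t + \<kappa> *\<^sub>R (- (\<tau> * t)) = \<tau> * t"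
      proof -
        have "\<kappa> * (1 + \<tau>) = 1 - \<tau>" using \<tau>_bounds by (simp add: \<kappa>_def)
        then have "(1 - \<kappa>) - \<kappa> * \<tau> = \<tau>" by (simp add: algebra_simps)
        then have "((1 - \<kappa>) - \<kappa> * \<tau>) * t = \<tau> * t" by simp
        then show ?thesis by (simp add: algebra_simps)
      qed
      ultimately show ?thesis by simp
    qed
    have e: "exp t - exp (- (\<tau> * t)) \<ge> 0" using t mult_nonneg_nonneg[OF less_imp_le[OF \<tau>_bounds(1)] t] by simp
    \<comment> \<open>The goal rearranges to this inequality. Since
      \<open>q * G y \<le> F y\<close>, it is enough that
      \<open>\<kappa> * (exp t - exp (- (\<tau> * t)))\<close> is at most
      \<open>exp t - exp (\<tau> * t)\<close>, which is \<open>cv\<close>.\<close>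
    have "\<kappa> * (q * G y) * (exp t - exp (- (\<tau> * t))) \<le> \<kappa> * F y * (exp t - exp (- (\<tau> * t)))"
      using le[OF y] \<kappa>_bounds e by (intro mult_right_mono mult_left_mono) auto
    also have "\<dots> \<le> F y * (exp t - exp (\<tau> * t))"
      using mult_left_mono[OF cv cone_nonneg[OF F y]] by (simp add: algebra_simps)
    finally have *: "\<kappa> * (q * G y) * (exp t - exp (- (\<tau> * t))) \<le> F y * (exp t - exp (\<tau> * t))" .
    have "\<kappa> * q * (exp (- (\<tau> * t)) * G y) \<le> \<kappa> * q * G x"
      using g \<kappa>_bounds q by (intro mult_left_mono) auto
    then have "F x - \<kappa> * q * G x \<le> exp (\<tau> * t) * F y - \<kappa> * q * (exp (- (\<tau> * t)) * G y)"
      using f by linarith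
    also have "\<dots> \<le> exp t * (F y - \<kappa> * q * G y)"
      using * by (simp add: algebra_simps)
    finally show ?thesis by (simp add: t_def)
  qed
  show ?thesis using 1 2 by (auto simp: log_lip_cone_def)
qed

section \<open>Shrinking of order intervals under iteration\<close>

lemma L_funpow_bounded: "bounded (f ` K) \<Longrightarrow> bounded ((L ^^ n) f ` K)"
  for f :: "'a \<Rightarrow> 'b::banach"
proof (induction n)
  case (Suc n)
  then obtain B where B: "\<And>x. x \<in> K \<Longrightarrow> norm ((L ^^ n) f x) \<le> B"
    by (auto simp: bounded_iff)
  have "norm (L ((L ^^ n) f) x) \<le> \<bar>B\<bar> * (exp (c * D) * L (\<lambda>_. 1::real) base)" if x: "x \<in> K" for x
  proof -
    \<comment> \<open>The constant 1 lies in the cone with constant 0, so \<open>L 1\<close> lies in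
      the one with constant \<open>c\<close> and Harnack applies.\<close>
    have "L (\<lambda>_. 1::real) x \<le> exp (c * D) * L (\<lambda>_. 1::real) base"
      using cone_le_D[OF _ L_cone[OF order_refl cone_one[OF order_refl]] x base_in] c_pos by simp
    moreover have "norm (L ((L ^^ n) f) x) \<le> \<bar>B\<bar> * L (\<lambda>_. 1::real) x"
      using B by (intro norm_L_le x) (smt (verit))
    ultimately show ?thesis by (meson abs_ge_zero mult_left_mono order_trans)
  qed
  then show ?case unfolding bounded_iff by auto
qed auto

lemma L_funpow_diff_cmult:
  fixes F G :: "'a \<Rightarrow> real"
  assumes "bounded (F ` K)" "bounded (G ` K)"
  shows "L (\<lambda>x. F x - a * G x) = (\<lambda>x. L F x - a * L G x)" "L (\<lambda>x. b * G x - F x) = (\<lambda>x. b * L G x - L F x)"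
  using L_diff[OF assms(1) bounded_scaleR_image[OF assms(2), of a]]
    L_diff[OF bounded_scaleR_image[OF assms(2), of b] assms(1)] by (simp_all add: L_cmult)

text \<open>A comparison at the base point spreads over \<open>K\<close>. The Harnack inequalities
  for \<open>U\<close> and for \<open>G\<close> cost the factor \<open>exp (small * D)\<close>
  each.\<close>

lemma small_ratio:
  assumes U: "U \<in> log_lip_cone small" and G: "G \<in> log_lip_cone small" and q: "0 \<le> q" "q * G base \<le> U base" and x: "x \<in> K"
  shows "exp (- 2 * small * D) * q * G x \<le> U x"
proof -
  have "exp (small * D) * (exp (- 2 * small * D) * q * G x) = exp (- (small * D)) * (q * G x)"
    by (simp add: exp_minus exp_add[symmetric] field_simps)
  also have "\<dots> \<le> exp (- (small * D)) * (q * (exp (small * D) * G base))"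
    using q cone_le_D[OF _ G x base_in] small_pos by (intro mult_left_mono) auto
  also have "\<dots> = q * G base" by (simp add: exp_minus field_simps)
  also have "\<dots> \<le> exp (small * D) * U x"
    using q cone_le_D[OF _ U base_in x] small_pos by simp
  finally show ?thesis by simp
qed

text \<open>At the base point \<open>L F\<close> lies in the upper or the lower half of the interval
  from \<open>a * L G\<close> to \<open>b * L G\<close>. Hence one of the two differences dominates
  half the gap times \<open>L G\<close> there, by Harnack on all of \<open>K\<close> with a smaller
  factor. \<open>cone_diff\<close> then moves the corresponding endpoint by
  \<open>\<kappa> * r\<close>, the same amount in both cases, and this defines
  \<open>\<rho>\<close>.\<close>

lemma bracket_step:
  assumes F: "bounded (F ` K)" and G: "G \<in> log_lip_cone big" and ab: "a \<le> b"
    and U: "(\<lambda>x. F x - a * G x) \<in> log_lip_cone big" and V: "(\<lambda>x. b * G x - F x) \<in> log_lip_cone big"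
  shows "\<exists>a' b'. a' \<le> b' \<and> (\<lambda>x. L F x - a' * L G x) \<in> log_lip_cone big \<and> (\<lambda>x. b' * L G x - L F x) \<in> log_lip_cone big \<and>
           a \<le> a' \<and> b' \<le> b \<and> b' - a' = \<rho> * (b - a)"
proof -
  have bG: "bounded (G ` K)" using cone_bounded[OF _ G] big_pos by simp
  have LU: "(\<lambda>x. L F x - a * L G x) \<in> log_lip_cone small" and LV: "(\<lambda>x. b * L G x - L F x) \<in> log_lip_cone small"
    using L_cone_small[OF U] L_cone_small[OF V] by (simp_all add: L_funpow_diff_cmult F bG)
  have LG: "L G \<in> log_lip_cone small" by (rule L_cone_small[OF G])
  define q where "q = (b - a) / 2"
  define r where "r = exp (- 2 * small * D) * q"
  have q: "0 \<le> q" using ab by (simp add: q_def)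
  then have r: "0 \<le> r" by (simp add: r_def)
  have \<rho>: "\<rho> * (b - a) = b - a - \<kappa> * r"
    by (simp add: \<rho>_def r_def q_def field_simps)
  have \<rho>0: "0 \<le> \<rho> * (b - a)" using \<rho>_bounds ab by auto
  have \<kappa>r: "0 \<le> \<kappa> * r" using r \<kappa>_bounds by simp
  have "q * L G base \<le> L F base - a * L G base \<or> q * L G base \<le> b * L G base - L F base"
    by (auto simp: q_def field_simps)
  then show ?thesis
  proof
    assume "q * L G base \<le> L F base - a * L G base"
    then have "r * L G x \<le> L F x - a * L G x" if "x \<in> K" for x
      using small_ratio[OF LU LG q _ that] by (simp add: r_def)
    from cone_diff[OF LU LG r this]
    have "(\<lambda>x. L F x - (a + \<kappa> * r) * L G x) \<in> log_lip_cone big" by (simp add: algebra_simps)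
    then show ?thesis using small_in_big[OF LV] \<rho> \<rho>0 \<kappa>r
      by (intro exI[of _ "a + \<kappa> * r"] exI[of _ b]) auto
  next
    assume "q * L G base \<le> b * L G base - L F base"
    then have "r * L G x \<le> b * L G x - L F x" if "x \<in> K" for x
      using small_ratio[OF LV LG q _ that] by (simp add: r_def)
    from cone_diff[OF LV LG r this]
    have "(\<lambda>x. (b - \<kappa> * r) * L G x - L F x) \<in> log_lip_cone big" by (simp add: algebra_simps)
    then show ?thesis using small_in_big[OF LU] \<rho> \<rho>0 \<kappa>r
      by (intro exI[of _ a] exI[of _ "b - \<kappa> * r"]) auto
  qed
qed

text \<open>The passage from the cone to the norm: \<open>1 - exp (- t) \<le> t\<close> turns a
  bound on ratios into a bound on differences.\<close>

lemma cone_lip_le: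
  assumes u: "u \<in> log_lip_cone big" and S: "\<And>x. x \<in> K \<Longrightarrow> u x \<le> S"
  shows "lip_le u ((1 + big) * S)"
proof (rule lip_leI)
  have S0: "0 \<le> S" using S[OF base_in] cone_nonneg[OF u base_in] by linarith
  show "norm (u x) \<le> (1 + big) * S" if "x \<in> K" for x
    using S[OF that] cone_nonneg[OF u that] mult_nonneg_nonneg[OF less_imp_le[OF big_pos] S0]
    by (simp add: algebra_simps)
  have *: "u x - u y \<le> (1 + big) * S * d x y" if "x \<in> K" "y \<in> K" for x y
  proof -
    have "exp (- (big * d x y)) * u x \<le> u y"
      using cone_le[OF u that] by (simp add: exp_minus field_simps)
    then have "u x - u y \<le> u x * (1 - exp (- (big * d x y)))" by (simp add: algebra_simps)
    also have "\<dots> \<le> u x * (big * d x y)"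
      using exp_ge_add_one_self[of "- (big * d x y)"] cone_nonneg[OF u that(1)]
      by (intro mult_left_mono) auto
    also have "\<dots> \<le> S * (big * d x y)"
      using S[OF that(1)] big_pos d_nonneg[OF that] by (intro mult_right_mono) auto
    also have "\<dots> \<le> (1 + big) * S * d x y"
      using S0 d_nonneg[OF that] by (simp add: algebra_simps)
    finally show ?thesis .
  qed
  show "norm (u x - u y) \<le> (1 + big) * S * d x y" if "x \<in> K" "y \<in> K" for x y
    using *[OF that] *[OF that(2,1)] d_sym[OF that] by (simp add: abs_le_iff)
qed

lemma L_funpow_cone: "f \<in> log_lip_cone big \<Longrightarrow> (L ^^ n) f \<in> log_lip_cone big"
  by (induction n) (auto intro: small_in_big L_cone_small)

lemma L_funpow_cone_small: "f \<in> log_lip_cone small \<Longrightarrow> (L ^^ n) f \<in> log_lip_cone small"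
  by (cases n) (auto intro: small_in_big L_cone_small L_funpow_cone)

text \<open>Repeated steps give nested intervals of length \<open>(b0 - a0) * \<rho> ^ n\<close>
  with a common point \<open>l\<close>. The difference in question splits into two cone functions,
  each at most the current gap times \<open>(L ^^ n) G\<close>, which explains the factor 2. The
  bound \<open>S\<close> stays free, since \<open>G\<close> is first the constant 1, whose growth is
  still unknown, and later the eigenfunction.\<close>

lemma bracket:
  assumes F: "F \<in> log_lip_cone big" and G: "G \<in> log_lip_cone big" and ab: "a0 \<le> b0"
    and U: "(\<lambda>x. F x - a0 * G x) \<in> log_lip_cone big" and V: "(\<lambda>x. b0 * G x - F x) \<in> log_lip_cone big"
  shows "\<exists>l. a0 \<le> l \<and> l \<le> b0 \<and> (\<forall>n S. (\<forall>x\<in>K. (L ^^ n) G x \<le> S) \<longrightarrow>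
           lip_le (\<lambda>x. (L ^^ n) F x - l * (L ^^ n) G x) (2 * ((1 + big) * ((b0 - a0) * \<rho> ^ n * S))))"
proof -
  \<comment> \<open>Dependent choice leaves the first pair open; the last clause fixes it to
    \<open>(a0, b0)\<close>.\<close>
  define P where "P n ab \<longleftrightarrow> fst ab \<le> snd ab \<and> (\<lambda>x. (L ^^ n) F x - fst ab * (L ^^ n) G x) \<in> log_lip_cone big \<and>
    (\<lambda>x. snd ab * (L ^^ n) G x - (L ^^ n) F x) \<in> log_lip_cone big \<and> (n = 0 \<longrightarrow> ab = (a0, b0))" for n ab
  define Q where "Q ab ab' \<longleftrightarrow> fst ab \<le> fst ab' \<and> snd ab' \<le> snd ab \<and> snd ab' - fst ab' = \<rho> * (snd ab - fst ab)"
    for ab ab' :: "real \<times> real"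
  have "\<exists>f. \<forall>n. P n (f n) \<and> Q (f n) (f (Suc n))"
  proof (rule dependent_nat_choice)
    show "\<exists>x. P 0 x" using U V ab by (intro exI[of _ "(a0, b0)"]) (simp add: P_def)
    fix x n assume P: "P n x"
    have bF: "bounded ((L ^^ n) F ` K)" using L_funpow_bounded[OF cone_bounded[OF _ F]] big_pos by simp
    show "\<exists>y. P (Suc n) y \<and> Q x y"
      using bracket_step[OF bF L_funpow_cone[OF G], of "fst x" "snd x"] P
      unfolding P_def Q_def by auto
  qed
  then obtain f where f: "\<And>n. P n (f n)" "\<And>n. Q (f n) (f (Suc n))" by blast
  have f0: "f 0 = (a0, b0)" using f(1)[of 0] by (simp add: P_def)
  have gap: "snd (f n) - fst (f n) = \<rho> ^ n * (b0 - a0)" for n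
    using f(2) by (induction n) (auto simp: f0 Q_def)
  have "(\<lambda>n. fst (f n) - snd (f n)) \<longlonglongrightarrow> 0"
  proof -
    have "(\<lambda>n. - (\<rho> ^ n * (b0 - a0))) \<longlonglongrightarrow> - (0 * (b0 - a0))"
      using \<rho>_bounds by (intro tendsto_intros LIMSEQ_power_zero) auto
    moreover have "fst (f n) - snd (f n) = - (\<rho> ^ n * (b0 - a0))" for n using gap[of n] by linarith
    ultimately show ?thesis by simp
  qed
  then obtain l where l: "\<And>n. fst (f n) \<le> l" "\<And>n. l \<le> snd (f n)"
    using nested_sequence_unique[of "\<lambda>n. fst (f n)" "\<lambda>n. snd (f n)"] f unfolding P_def Q_def by blast
  have "lip_le (\<lambda>x. (L ^^ n) F x - l * (L ^^ n) G x) (2 * ((1 + big) * ((b0 - a0) * \<rho> ^ n * S)))"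
    if S: "\<And>x. x \<in> K \<Longrightarrow> (L ^^ n) G x \<le> S" for n S
  proof -
    let ?u = "\<lambda>x. (L ^^ n) F x - fst (f n) * (L ^^ n) G x"
    let ?v = "\<lambda>x. (l - fst (f n)) * (L ^^ n) G x"
    have Gn: "(L ^^ n) G \<in> log_lip_cone big" by (rule L_funpow_cone[OF G])
    have u: "?u \<in> log_lip_cone big" and w: "(\<lambda>x. snd (f n) * (L ^^ n) G x - (L ^^ n) F x) \<in> log_lip_cone big"
      using f(1)[of n] by (auto simp: P_def)
    have v: "?v \<in> log_lip_cone big" using cone_cmult[OF _ Gn] l(1)[of n] by simp
    have gS: "(b0 - a0) * \<rho> ^ n * (L ^^ n) G x \<le> (b0 - a0) * \<rho> ^ n * S" if "x \<in> K" for x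
      using S[OF that] ab \<rho>_bounds by (intro mult_left_mono) auto
    have "?u x \<le> (b0 - a0) * \<rho> ^ n * S" if "x \<in> K" for x
    proof -
      have "?u x \<le> (snd (f n) - fst (f n)) * (L ^^ n) G x"
        using cone_nonneg[OF w that] by (simp add: algebra_simps)
      then show ?thesis using gS[OF that] gap[of n] by (simp add: mult.commute)
    qed
    moreover have "?v x \<le> (b0 - a0) * \<rho> ^ n * S" if "x \<in> K" for x
    proof -
      have "?v x \<le> (snd (f n) - fst (f n)) * (L ^^ n) G x"
        using cone_nonneg[OF Gn that] l(2)[of n] by (simp add: mult_right_mono)
      then show ?thesis using gS[OF that] gap[of n] by (simp add: mult.commute)
    qed
    ultimately have "lip_le (\<lambda>x. ?u x - ?v x) (((1 + big) * ((b0 - a0) * \<rho> ^ n * S)) + ((1 + big) * ((b0 - a0) * \<rho> ^ n * S)))"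
      using lip_le_diff[OF cone_lip_le[OF u] cone_lip_le[OF v]] by blast
    then show ?thesis by (simp add: algebra_simps)
  qed
  moreover have "a0 \<le> l" "l \<le> b0" using l[of 0] f0 by auto
  ultimately show ?thesis by blast
qed

text \<open>\<open>cone_diff\<close> divided by \<open>\<kappa> * q\<close>: a pointwise bound
  becomes a bound in the order of the larger cone at the price of \<open>1 / \<kappa>\<close>. This
  supplies the upper ends from which brackets start.\<close>

lemma dominate:
  assumes "F \<in> log_lip_cone small" "G \<in> log_lip_cone small" "0 < q" "\<And>x. x \<in> K \<Longrightarrow> q * F x \<le> G x"
  shows "(\<lambda>x. 1 / (\<kappa> * q) * G x - F x) \<in> log_lip_cone big"
proof -
  have "(\<lambda>x. 1 / (\<kappa> * q) * (G x - \<kappa> * q * F x)) \<in> log_lip_cone big"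
    using \<kappa>_bounds assms(3) by (intro cone_cmult cone_diff[OF assms(2,1)] assms(4)) auto
  moreover have "1 / (\<kappa> * q) * (G x - \<kappa> * q * F x) = 1 / (\<kappa> * q) * G x - F x" for x
    using \<kappa>_bounds assms(3) by (simp add: field_simps)
  ultimately show ?thesis by simp
qed

text \<open>Completeness of the Lipschitz norm for geometric increments. Keeping the exact
  difference \<open>\<rho> ^ n - \<rho> ^ (n + m)\<close> of geometric tails lets the induction on
  \<open>m\<close> close.\<close>

lemma lip_le_limit:
  fixes u :: "nat \<Rightarrow> 'a \<Rightarrow> 'b::banach"
  assumes C: "0 \<le> C" and u: "\<And>n. lip_le (\<lambda>x. u (Suc n) x - u n x) (C * \<rho> ^ n)"
  shows "\<exists>v. (\<forall>x. x \<notin> K \<longrightarrow> v x = 0) \<and> (\<forall>n. lip_le (\<lambda>x. v x - u n x) (C / (1 - \<rho>) * \<rho> ^ n))"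
proof -
  have r: "0 < 1 - \<rho>" using \<rho>_bounds by simp
  have tele: "lip_le (\<lambda>x. u (n + m) x - u n x) (C / (1 - \<rho>) * (\<rho> ^ n - \<rho> ^ (n + m)))" for n m
  proof (induction m)
    case 0
    show ?case by (simp add: lip_le_def)
  next
    case (Suc m)
    have "C / (1 - \<rho>) * (\<rho> ^ n - \<rho> ^ (n + m)) + C * \<rho> ^ (n + m) = C / (1 - \<rho>) * (\<rho> ^ n - \<rho> ^ (n + Suc m))"
      using r by (simp add: field_simps)
    then show ?case using lip_le_add[OF Suc u[of "n + m"]] by (simp only: add_Suc_right) simp
  qed
  have tele': "lip_le (\<lambda>x. u (n + m) x - u n x) (C / (1 - \<rho>) * \<rho> ^ n)" for n m
    by (rule lip_le_mono[OF tele], rule mult_left_mono) (use C r \<rho>_bounds in auto)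
  have conv: "convergent (\<lambda>n. u n x)" if x: "x \<in> K" for x
  proof -
    have "summable (\<lambda>n. u (Suc n) x - u n x)"
    proof (rule summable_comparison_test')
      show "summable (\<lambda>n. C * \<rho> ^ n)" using \<rho>_bounds by (intro summable_mult summable_geometric) auto
      show "norm (u (Suc n) x - u n x) \<le> C * \<rho> ^ n" if "0 \<le> n" for n using lip_leD(1)[OF u x] .
    qed
    then have "(\<lambda>n. \<Sum>k<n. u (Suc k) x - u k x) \<longlonglongrightarrow> (\<Sum>n. u (Suc n) x - u n x)"
      by (rule summable_LIMSEQ)
    from tendsto_add[OF this tendsto_const[of "u 0 x"]] show ?thesis
      by (auto simp: convergent_def sum_lessThan_telescope[of "\<lambda>k. u k x"])
  qed
  define v where "v x = (if x \<in> K then lim (\<lambda>n. u n x) else 0)" for x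
  have lim: "(\<lambda>m. u (n + m) x) \<longlonglongrightarrow> v x" if "x \<in> K" for x n
    using LIMSEQ_ignore_initial_segment[OF conv[OF that, unfolded convergent_LIMSEQ_iff], of n] that
    by (simp add: v_def add.commute)
  have "lip_le (\<lambda>x. v x - u n x) (C / (1 - \<rho>) * \<rho> ^ n)" for n
  proof (rule lip_leI)
    fix x assume x: "x \<in> K"
    show "norm (v x - u n x) \<le> C / (1 - \<rho>) * \<rho> ^ n"
      by (rule LIMSEQ_le_const2[OF tendsto_norm[OF tendsto_diff[OF lim[OF x] tendsto_const]]])
        (use lip_leD(1)[OF tele' x] in blast)
    fix y assume y: "y \<in> K"
    show "norm (v x - u n x - (v y - u n y)) \<le> C / (1 - \<rho>) * \<rho> ^ n * d x y"
      by (rule LIMSEQ_le_const2[OF tendsto_norm[OF tendsto_diff[OF tendsto_diff[OF lim[OF x] tendsto_const]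
            tendsto_diff[OF lim[OF y] tendsto_const]]]])
        (use lip_leD(2)[OF tele' x y] in blast)
  qed
  then show ?thesis by (intro exI[of _ v]) (auto simp: v_def)
qed

section \<open>Eigenfunction and convergence of normalised iterates\<close>

definition E :: real where "E = exp (small * D)"

lemma E_pos: "0 < E" by (simp add: E_def)

lemma cone_small_le: "f \<in> log_lip_cone small \<Longrightarrow> x \<in> K \<Longrightarrow> y \<in> K \<Longrightarrow> f x \<le> E * f y"
  using cone_le_D small_pos by (simp add: E_def)

lemma L_funpow_cong: "(\<And>x. x \<in> K \<Longrightarrow> f x = g x) \<Longrightarrow> x \<in> K \<Longrightarrow> (L ^^ n) f x = (L ^^ n) g x"
  by (induction n arbitrary: x) (auto cong: L_cong)

lemma L_funpow_add:
  fixes f g :: "'a \<Rightarrow> 'b::banach"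
  assumes "bounded (f ` K)" "bounded (g ` K)"
  shows "(L ^^ n) (\<lambda>x. f x + g x) = (\<lambda>x. (L ^^ n) f x + (L ^^ n) g x)"
  using assms by (induction n) (auto simp: L_add L_funpow_bounded)

lemma L_funpow_scaleR:
  fixes f :: "'a \<Rightarrow> 'b::banach"
  shows "(L ^^ n) (\<lambda>x. a *\<^sub>R f x) = (\<lambda>x. a *\<^sub>R (L ^^ n) f x)"
  by (induction n) (auto simp: L_scaleR)

lemma L_funpow_cmult:
  fixes f :: "'a \<Rightarrow> real"
  shows "(L ^^ n) (\<lambda>x. a * f x) = (\<lambda>x. a * (L ^^ n) f x)"
  using L_funpow_scaleR[of n a f] by simp

lemma L_funpow_bounded_linear:
  fixes f :: "'a \<Rightarrow> 'b::banach" and T :: "'b \<Rightarrow> 'c::banach"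
  assumes "bounded_linear T" "bounded (f ` K)"
  shows "(L ^^ n) (\<lambda>x. T (f x)) = (\<lambda>x. T ((L ^^ n) f x))"
  using assms by (induction n) (auto simp: L_bounded_linear L_funpow_bounded)

lemma L_funpow_mono:
  fixes f g :: "'a \<Rightarrow> real"
  assumes "bounded (f ` K)" "bounded (g ` K)" "\<And>x. x \<in> K \<Longrightarrow> f x \<le> g x" "x \<in> K"
  shows "(L ^^ n) f x \<le> (L ^^ n) g x"
  using assms by (induction n arbitrary: x) (auto intro!: L_mono L_funpow_bounded)

text \<open>Bracketing \<open>L 1\<close> by multiples of 1 makes
  \<open>(L ^^ Suc n) 1 - lam * (L ^^ n) 1\<close> exponentially small relative to
  \<open>(L ^^ n) 1\<close>. So the growth ratios tend to \<open>lam\<close>, and the iterates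
  normalised at the base point converge to \<open>p\<close>. The last clause later gives smoothness:
  on \<open>Delta\<close> these iterates are \<open>C1\<close>, and \<open>p\<close> is their limit
  in the Lipschitz norm.\<close>

lemma eigenfunction_exists:
  "\<exists>lam p. 0 < lam \<and> p \<in> log_lip_cone small \<and> p base = 1 \<and> L p = (\<lambda>x. lam * p x) \<and>
     (\<forall>e>0. \<exists>n a. lip_le (\<lambda>x. p x - a * (L ^^ n) (\<lambda>_. 1::real) x) e)"
proof -
  define g where "g n = (L ^^ n) (\<lambda>_. 1::real)" for n
  have gS: "g (Suc n) = L (g n)" for n by (simp add: g_def)
  have gS': "g (Suc n) = (L ^^ n) (L (\<lambda>_. 1))" for n by (simp add: g_def funpow_swap1)
  have one: "(\<lambda>_. 1) \<in> log_lip_cone small" using cone_one small_pos by simp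
  have g: "g n \<in> log_lip_cone small" for n using L_funpow_cone_small[OF one] by (simp add: g_def)
  have g_bdd: "bounded (g n ` K)" for n using cone_bounded[OF _ g] small_pos by simp
  \<comment> \<open>By Harnack \<open>g n\<close> is at least \<open>g n base / E\<close>
    everywhere, so applying \<open>L\<close> multiplies the value at the base point by at least
    \<open>m\<close>.\<close>
  define m where "m = L (\<lambda>_. 1::real) base / E"
  have m: "0 < m" using L_one_pos[OF base_in] E_pos by (simp add: m_def)
  have step: "m * g n base \<le> g (Suc n) base" for n
  proof -
    have "L (\<lambda>_. g n base / E) base \<le> L (g n) base"
      using cone_small_le[OF g base_in] E_pos
      by (intro L_mono g_bdd) (auto simp: bounded_iff field_simps intro: exI[of _ "\<bar>g n base / E\<bar>"])
    then show ?thesis by (simp add: L_const_real[of "g n base / E"] gS m_def mult.commute)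
  qed
  have gpos: "0 < g n base" for n
  proof (induction n)
    case 0 then show ?case by (simp add: g_def)
  next
    case (Suc n) then show ?case using step[of n] mult_pos_pos[OF m Suc] by linarith
  qed
  \<comment> \<open>Harnack for \<open>g 1 = L 1\<close> gives \<open>q * L 1 \<le> 1\<close> on
    \<open>K\<close>, the hypothesis of \<open>dominate\<close>.\<close>
  define q where "q = 1 / (E * g 1 base)"
  have q: "0 < q" using gpos E_pos by (simp add: q_def)
  have V: "(\<lambda>x. 1 / (\<kappa> * q) * (\<lambda>_. 1) x - L (\<lambda>_. 1) x) \<in> log_lip_cone big"
    by (rule dominate[OF L_cone_small[OF cone_one[OF less_imp_le[OF big_pos]]] one q])
      (use cone_small_le[OF g[of 1] _ base_in] E_pos gpos[of 1] in \<open>simp add: q_def g_def field_simps\<close>)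
  define b0 where "b0 = 1 / (\<kappa> * q)"
  have b0: "0 \<le> b0" using q \<kappa>_bounds by (simp add: b0_def)
  have one_big: "(\<lambda>_. 1) \<in> log_lip_cone big" and L1_big: "L (\<lambda>_. 1) \<in> log_lip_cone big"
    using small_in_big[OF one] small_in_big[OF L_cone_small[OF small_in_big[OF one]]] by auto
  \<comment> \<open>The lower end 0 would only give \<open>0 \<le> lam\<close>; strict positivity
    comes from \<open>m\<close> below.\<close>
  have "(\<lambda>x. L (\<lambda>_. 1) x - 0 * 1) \<in> log_lip_cone big" using L1_big by simp
  from bracket[OF L1_big one_big b0 this V[folded b0_def]]
  obtain lam where "\<forall>n S. (\<forall>x\<in>K. (L ^^ n) (\<lambda>_. 1::real) x \<le> S) \<longrightarrow>
           lip_le (\<lambda>x. (L ^^ n) (L (\<lambda>_. 1)) x - (lam::real) * (L ^^ n) (\<lambda>_. 1) x) (2 * ((1 + big) * ((b0 - 0) * \<rho> ^ n * S)))"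
    by blast
  note lam = this[rule_format]
  define C where "C = 2 * (1 + big) * b0 * E"
  have C: "0 \<le> C" using b0 big_pos E_pos by (simp add: C_def)
  have diff: "lip_le (\<lambda>x. g (Suc n) x - lam * g n x) (C * \<rho> ^ n * g n base)" for n
  proof -
    have "\<forall>x\<in>K. (L ^^ n) (\<lambda>_. 1::real) x \<le> E * g n base"
      using cone_small_le[OF g _ base_in] by (simp add: g_def)
    then have "lip_le (\<lambda>x. (L ^^ n) (L (\<lambda>_. 1)) x - (lam::real) * (L ^^ n) (\<lambda>_. 1) x) (2 * ((1 + big) * ((b0 - 0) * \<rho> ^ n * (E * g n base))))"
      using lam by blast
    moreover have "2 * ((1 + big) * ((b0 - 0) * \<rho> ^ n * (E * g n base))) = C * \<rho> ^ n * g n base"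
      by (simp add: C_def)
    ultimately show ?thesis unfolding gS' by (simp only:) (simp only: g_def)
  qed
  define P where "P n x = g n x / g n base" for n x
  have P: "lip_le (P n) ((1 + big) * E)" for n
  proof (rule cone_lip_le)
    show "P n \<in> log_lip_cone big" using cone_cmult[OF _ small_in_big[OF g[of n]], of "1 / g n base"] gpos[of n]
      by (simp add: P_def[abs_def])
    show "P n x \<le> E" if "x \<in> K" for x
      using cone_small_le[OF g[of n] that base_in] gpos[of n] by (simp add: P_def field_simps)
  qed
  have ratio: "\<bar>g (Suc n) base / g n base - lam\<bar> \<le> C * \<rho> ^ n" for n
  proof -
    have "\<bar>g (Suc n) base - lam * g n base\<bar> \<le> C * \<rho> ^ n * g n base"
      using lip_leD(1)[OF diff base_in] by simp
    moreover have "g (Suc n) base - lam * g n base = (g (Suc n) base / g n base - lam) * g n base"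
      using gpos[of n] by (simp add: field_simps)
    ultimately show ?thesis using gpos[of n] by (simp add: abs_mult)
  qed
  have \<rho>lim: "(\<lambda>n. A * \<rho> ^ n) \<longlonglongrightarrow> 0" for A
    using tendsto_mult[OF tendsto_const LIMSEQ_power_zero[of \<rho>], of A] \<rho>_bounds by simp
  have ratio_lim: "(\<lambda>n. g (Suc n) base / g n base) \<longlonglongrightarrow> lam"
    by (rule Lim_transform_bound[OF _ \<rho>lim[of C], THEN LIM_zero_cancel])
      (use ratio in \<open>auto intro!: eventuallyI order_trans[OF _ abs_ge_self]\<close>)
  have "m \<le> lam"
    by (rule LIMSEQ_le_const[OF ratio_lim]) (use step gpos in \<open>auto simp: field_simps\<close>)
  then have lam_pos: "0 < lam" using m by simp
  define C' where "C' = C / m + (1 + big) * E * (C / m)"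
  have C': "0 \<le> C'" using C m big_pos E_pos by (simp add: C'_def)
  have "lip_le (\<lambda>x. P (Suc n) x - P n x) (C' * \<rho> ^ n)" for n
  proof -
    have gm: "g n base / g (Suc n) base \<le> 1 / m"
      using step[of n] gpos m by (simp add: field_simps)
    have 0: "0 \<le> C * \<rho> ^ n" using C \<rho>_bounds by simp
    \<comment> \<open>Relative error of the growth at the base point. It corrects for dividing by
      \<open>g (Suc n) base\<close> in place of \<open>lam * g n base\<close>.\<close>
    define e where "e = (g (Suc n) base - lam * g n base) / g (Suc n) base"
    have e: "\<bar>e\<bar> \<le> C / m * \<rho> ^ n"
    proof -
      have "\<bar>e\<bar> \<le> C * \<rho> ^ n * g n base / g (Suc n) base"
        using lip_leD(1)[OF diff base_in, of n] gpos[of "Suc n"] by (simp add: e_def field_simps)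
      also have "\<dots> \<le> C / m * \<rho> ^ n" using mult_left_mono[OF gm 0] by (simp add: field_simps)
      finally show ?thesis .
    qed
    have "lip_le (\<lambda>x. (1 / g (Suc n) base) *\<^sub>R (g (Suc n) x - lam * g n x)) (C / m * \<rho> ^ n)"
      by (rule lip_le_mono[OF lip_le_scaleR[OF diff]])
        (use mult_left_mono[OF gm 0] gpos[of "Suc n"] in \<open>simp add: field_simps\<close>)
    moreover have "lip_le (\<lambda>x. e *\<^sub>R P n x) ((1 + big) * E * (C / m) * \<rho> ^ n)"
      by (rule lip_le_mono[OF lip_le_scaleR[OF P]])
        (use mult_left_mono[OF e, of "(1 + big) * E"] big_pos E_pos in \<open>simp add: mult_ac\<close>)
    ultimately have "lip_le (\<lambda>x. (1 / g (Suc n) base) *\<^sub>R (g (Suc n) x - lam * g n x) - e *\<^sub>R P n x) (C' * \<rho> ^ n)"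
      using lip_le_diff by (fastforce simp: C'_def algebra_simps)
    moreover have "(1 / g (Suc n) base) *\<^sub>R (g (Suc n) x - lam * g n x) - e *\<^sub>R P n x = P (Suc n) x - P n x" for x
      using gpos[of n] gpos[of "Suc n"] by (simp add: P_def e_def field_simps)
    ultimately show ?thesis by simp
  qed
  then obtain p where p: "\<And>x. x \<notin> K \<Longrightarrow> p x = 0" "\<And>n. lip_le (\<lambda>x. p x - P n x) (C' / (1 - \<rho>) * \<rho> ^ n)"
    using lip_le_limit[OF C', of P] by blast
  define C'' where "C'' = C' / (1 - \<rho>)"
  have Pn: "\<bar>p x - P n x\<bar> \<le> C'' * \<rho> ^ n" if "x \<in> K" for x n
    using lip_leD(1)[OF p(2) that] by (simp add: C''_def)
  have lim: "(\<lambda>n. P n x) \<longlonglongrightarrow> p x" if "x \<in> K" for x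
    by (rule Lim_transform_bound[OF _ \<rho>lim[of C''], THEN LIM_zero_cancel])
      (use Pn[OF that] in \<open>auto simp: abs_minus_commute intro!: eventuallyI order_trans[OF _ abs_ge_self]\<close>)
  have p_cone: "p \<in> log_lip_cone small"
  proof -
    have "P n \<in> log_lip_cone small" for n using cone_cmult[OF _ g[of n], of "1 / g n base"] gpos[of n] by (simp add: P_def[abs_def])
    then have "0 \<le> P n x" "y \<in> K \<Longrightarrow> P n x \<le> exp (small * d x y) * P n y" if "x \<in> K" for x y n
      using cone_nonneg cone_le that by blast+
    then show ?thesis
      unfolding log_lip_cone_def using lim
      by (auto intro!: LIMSEQ_le_const[OF lim] LIMSEQ_le[OF lim tendsto_mult[OF tendsto_const lim]])
  qed
  have p_base: "p base = 1"
    using LIMSEQ_unique[OF lim[OF base_in]] gpos by (simp add: P_def less_imp_neq[THEN not_sym])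
  have bP: "bounded (P n ` K)" for n using lip_le_bounded[OF P] .
  have bp: "bounded (p ` K)" using cone_bounded[OF _ p_cone] small_pos by simp
  have eigen: "L p x = lam * p x" for x
  proof (cases "x \<in> K")
    case True
    have LP: "L (P n) x = g (Suc n) base / g n base * P (Suc n) x" for n
    proof -
      have "L (P n) x = L (\<lambda>x. 1 / g n base * g n x) x" by (simp add: P_def[abs_def])
      also have "\<dots> = 1 / g n base * g (Suc n) x" by (simp only: L_cmult gS)
      finally show ?thesis using gpos[of "Suc n"] by (simp add: P_def)
    qed
    have "(\<lambda>n. L (P n) x) \<longlonglongrightarrow> lam * p x"
      unfolding LP by (intro tendsto_mult ratio_lim LIMSEQ_Suc[OF lim[OF True]])
    moreover have "(\<lambda>n. L (P n) x) \<longlonglongrightarrow> L p x"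
    proof (rule Lim_transform_bound[OF _ \<rho>lim[of "C'' * L (\<lambda>_. 1) x"], THEN LIM_zero_cancel], intro eventuallyI)
      fix n
      have "norm (L (\<lambda>y. P n y - p y) x) \<le> C'' * \<rho> ^ n * L (\<lambda>_. 1::real) x"
        using Pn by (intro norm_L_le True) (simp add: abs_minus_commute)
      then show "norm (L (P n) x - L p x) \<le> norm (C'' * L (\<lambda>_. 1::real) x * \<rho> ^ n)"
        by (simp only: L_diff[OF bP bp]) (simp add: mult_ac)
    qed
    ultimately show ?thesis using LIMSEQ_unique by blast
  next
    case False
    then show ?thesis by (simp add: L_def p(1))
  qed
  have "\<exists>n a. lip_le (\<lambda>x. p x - a * (L ^^ n) (\<lambda>_. 1::real) x) e" if "0 < e" for e
  proof -
    have "eventually (\<lambda>n. C'' * \<rho> ^ n < e) sequentially"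
      using order_tendstoD(2)[OF \<rho>lim that] .
    then obtain n where "C'' * \<rho> ^ n < e" by (auto simp: eventually_sequentially)
    then have "lip_le (\<lambda>x. p x - P n x) e" using lip_le_mono[OF p(2)[of n]] by (simp add: C''_def)
    then show ?thesis by (intro exI[of _ n] exI[of _ "1 / g n base"]) (simp add: P_def g_def)
  qed
  then show ?thesis using lam_pos p_cone p_base eigen by blast
qed

text \<open>A Lipschitz function enters the cone after a large constant is added. Bracketing the
  shifted function and the constant against the eigenfunction and subtracting gives a limit for the
  function itself, with an error linear in \<open>B\<close>. The lower bound for \<open>lam\<close>
  in the last clause serves to make the gap explicit.\<close>

theorem ruelle_perron_frobenius:
  "\<exists>lam h \<Lambda> C. 0 < lam \<and> 0 \<le> C \<and> (\<forall>x\<in>K. 0 < h x) \<and> (\<forall>x. x \<notin> K \<longrightarrow> h x = 0) \<and> (\<exists>B. lip_le h B) \<and>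
     L h = (\<lambda>x. lam * h x) \<and>
     (\<forall>e>0. \<exists>n a. lip_le (\<lambda>x. h x - a * (L ^^ n) (\<lambda>_. 1::real) x) e) \<and>
     \<Lambda> (\<lambda>_. 1) = 1 \<and>
     (\<forall>f B n. lip_le f B \<longrightarrow> lip_le (\<lambda>x. (L ^^ n) f x / lam ^ n - \<Lambda> f * h x) (C * \<rho> ^ n * B)) \<and>
     (\<forall>m. (\<forall>x\<in>K. m \<le> L (\<lambda>_. 1) x) \<longrightarrow> m \<le> lam)"
proof -
  obtain lam p where lam: "0 < lam" and p: "p \<in> log_lip_cone small" and p1: "p base = 1"
    and Lp: "L p = (\<lambda>x. lam * p x)"
    and p_approx: "\<And>e. e > 0 \<Longrightarrow> \<exists>n a. lip_le (\<lambda>x. p x - a * (L ^^ n) (\<lambda>_. 1::real) x) e"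
    using eigenfunction_exists by blast
  have p_ge: "1 / E \<le> p x" if "x \<in> K" for x
    using cone_small_le[OF p base_in that] p1 E_pos by (simp add: field_simps)
  have p_le: "p x \<le> E" if "x \<in> K" for x
    using cone_small_le[OF p that base_in] p1 by simp
  have Lnp: "(L ^^ n) p = (\<lambda>x. lam ^ n * p x)" for n
    by (induction n) (simp_all add: Lp L_cmult mult.assoc mult.left_commute[of lam])
  \<comment> \<open>The upper end \<open>E * H / \<kappa>\<close> results from
    \<open>dominate\<close>, as \<open>F \<le> H\<close> and \<open>1 / E \<le> p\<close>. The lower
    end stays a parameter: 0 does in general, but showing that the functional is positive at 1 needs
    a positive one.\<close>
  have brk: "\<exists>l\<ge>a0. \<forall>n. lip_le (\<lambda>x. (L ^^ n) F x / lam ^ n - l * p x) (2 * (1 + big) * E * E * H / \<kappa> * \<rho> ^ n)"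
    if F: "F \<in> log_lip_cone small" and H: "0 < H" "\<And>x. x \<in> K \<Longrightarrow> F x \<le> H" and a0: "0 \<le> a0" "a0 \<le> E * H / \<kappa>"
      and lower: "(\<lambda>x. F x - a0 * p x) \<in> log_lip_cone big" for F H a0
  proof -
    define b0 where "b0 = E * H / \<kappa>"
    have "1 / (E * H) * F x \<le> p x" if "x \<in> K" for x
    proof -
      have "F x / H \<le> 1" using H(1) H(2)[OF that] by simp
      then have "F x / H / E \<le> 1 / E" using E_pos by (intro divide_right_mono) auto
      then show ?thesis using p_ge[OF that] by (simp add: mult.commute)
    qed
    then have "(\<lambda>x. b0 * p x - F x) \<in> log_lip_cone big"
      using dominate[OF F p, of "1 / (E * H)"] E_pos H(1) \<kappa>_bounds by (simp add: b0_def field_simps)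
    from bracket[OF small_in_big[OF F] small_in_big[OF p] _ lower this]
    obtain l where l: "a0 \<le> l" and lip: "\<And>n S. (\<forall>x\<in>K. (L ^^ n) p x \<le> S) \<Longrightarrow>
           lip_le (\<lambda>x. (L ^^ n) F x - l * (L ^^ n) p x) (2 * ((1 + big) * ((b0 - a0) * \<rho> ^ n * S)))"
      using a0 by (auto simp: b0_def)
    have "lip_le (\<lambda>x. (L ^^ n) F x / lam ^ n - l * p x) (2 * (1 + big) * E * E * H / \<kappa> * \<rho> ^ n)" for n
    proof -
      have "\<forall>x\<in>K. (L ^^ n) p x \<le> lam ^ n * E" using p_le lam by (simp add: Lnp)
      note * = lip_le_scaleR[OF lip[OF this], of "1 / lam ^ n"]
      have "(1 / lam ^ n) *\<^sub>R ((L ^^ n) F x - l * (L ^^ n) p x) = (L ^^ n) F x / lam ^ n - l * p x" for x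
        using lam by (simp add: Lnp field_simps)
      moreover have "\<bar>1 / lam ^ n\<bar> * (2 * ((1 + big) * ((b0 - a0) * \<rho> ^ n * (lam ^ n * E)))) = 2 * ((1 + big) * ((b0 - a0) * \<rho> ^ n * E))"
        using lam by simp
      ultimately have "lip_le (\<lambda>x. (L ^^ n) F x / lam ^ n - l * p x) (2 * ((1 + big) * ((b0 - a0) * \<rho> ^ n * E)))"
        using * by simp
      then show ?thesis
      proof (rule lip_le_mono)
        have "2 * ((1 + big) * ((b0 - a0) * \<rho> ^ n * E)) \<le> 2 * ((1 + big) * (b0 * \<rho> ^ n * E))"
          using a0 \<rho>_bounds E_pos big_pos by (intro mult_left_mono mult_right_mono) auto
        also have "\<dots> = 2 * (1 + big) * E * E * H / \<kappa> * \<rho> ^ n" by (simp add: b0_def)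
        finally show "2 * ((1 + big) * ((b0 - a0) * \<rho> ^ n * E)) \<le> 2 * (1 + big) * E * E * H / \<kappa> * \<rho> ^ n" .
      qed
    qed
    then show ?thesis using l by blast
  qed
  have one: "(\<lambda>_. 1) \<in> log_lip_cone small" using cone_one small_pos by simp
  \<comment> \<open>\<open>B * c1\<close> bounds the shifted function: \<open>B\<close> for
    \<open>f\<close> plus the shift \<open>B * (1 + 1 / small)\<close>. \<open>C1\<close> is twice
    the constant of \<open>brk\<close> with this bound, one half for each of the two
    brackets.\<close>
  define c1 where "c1 = 2 + 1 / small"
  define C1 where "C1 = 4 * (1 + big) * E * E * c1 / \<kappa>"
  have c1: "0 < c1" using small_pos by (simp add: c1_def add_pos_pos)
  have C1: "0 \<le> C1" using c1 big_pos E_pos \<kappa>_bounds by (simp add: C1_def)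
  have conv: "\<exists>l. \<forall>n. lip_le (\<lambda>x. (L ^^ n) f x / lam ^ n - l * p x) (C1 * \<rho> ^ n * B)"
    if f: "lip_le f B" and B: "0 < B" for f B
  proof -
    \<comment> \<open>With this shift \<open>F\<close> is at least \<open>B / small\<close>, so its
      Lipschitz constant \<open>B\<close> is at most \<open>small * F\<close> and its logarithm is
      \<open>small\<close>-Lipschitz.\<close>
    define A where "A = B * (1 + 1 / small)"
    have A: "0 < A" using B small_pos by (simp add: A_def add_pos_pos)
    define F where "F x = f x + A" for x
    have Flow: "B / small \<le> F x" if "x \<in> K" for x
      using lip_leD(1)[OF f that] by (simp add: F_def A_def field_simps)
    have Fnonneg: "0 \<le> F x" if "x \<in> K" for x
      using Flow[OF that] divide_nonneg_pos[OF less_imp_le[OF B] small_pos] by linarith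
    have F: "F \<in> log_lip_cone small"
    proof -
      have "F x \<le> exp (small * d x y) * F y" if "x \<in> K" "y \<in> K" for x y
      proof -
        have "F x \<le> F y + B * d x y" using lip_leD(2)[OF f that] by (simp add: F_def)
        also have "B * d x y \<le> small * F y * d x y"
          using Flow[OF that(2)] d_nonneg[OF that] small_pos by (intro mult_right_mono) (auto simp: field_simps)
        also have "F y + small * F y * d x y = (1 + small * d x y) * F y" by (simp add: algebra_simps)
        also have "\<dots> \<le> exp (small * d x y) * F y"
          by (intro mult_right_mono exp_ge_add_one_self Fnonneg that)
        finally show ?thesis by simp
      qed
      then show ?thesis using Fnonneg by (auto simp: log_lip_cone_def)
    qed
    have FH: "F x \<le> B * c1" if "x \<in> K" for x
      using lip_leD(1)[OF f that] by (simp add: F_def A_def c1_def algebra_simps)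
    have AH: "A * 1 \<le> B * c1" using B by (simp add: A_def c1_def)
    have H: "0 < B * c1" using B c1 by simp
    have e0: "0 \<le> E * (B * c1) / \<kappa>" using H E_pos \<kappa>_bounds by simp
    have A': "(\<lambda>x. A * 1) \<in> log_lip_cone small" using cone_cmult[OF _ one] A by simp
    obtain l where l: "\<And>n. lip_le (\<lambda>x. (L ^^ n) F x / lam ^ n - l * p x) (2 * (1 + big) * E * E * (B * c1) / \<kappa> * \<rho> ^ n)"
      using brk[OF F H FH order_refl e0] small_in_big[OF F] by auto
    obtain l' where l': "\<And>n. lip_le (\<lambda>x. (L ^^ n) (\<lambda>x. A * 1) x / lam ^ n - l' * p x) (2 * (1 + big) * E * E * (B * c1) / \<kappa> * \<rho> ^ n)"
      using brk[OF A' H AH order_refl e0] small_in_big[OF A'] by auto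
    have "lip_le (\<lambda>x. (L ^^ n) f x / lam ^ n - (l - l') * p x) (C1 * \<rho> ^ n * B)" for n
    proof -
      have "(L ^^ n) F = (\<lambda>x. (L ^^ n) f x + (L ^^ n) (\<lambda>x. A * 1) x)"
        unfolding F_def[abs_def] mult_1_right
        by (rule L_funpow_add[OF lip_le_bounded[OF f]]) (auto simp: bounded_iff)
      then have "(L ^^ n) f x / lam ^ n - (l - l') * p x = (L ^^ n) F x / lam ^ n - l * p x - ((L ^^ n) (\<lambda>x. A * 1) x / lam ^ n - l' * p x)" for x
        by (simp add: algebra_simps add_divide_distrib)
      moreover have "2 * (1 + big) * E * E * (B * c1) / \<kappa> * \<rho> ^ n + 2 * (1 + big) * E * E * (B * c1) / \<kappa> * \<rho> ^ n = C1 * \<rho> ^ n * B"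
        by (simp add: C1_def)
      ultimately show ?thesis using lip_le_diff[OF l[of n] l'[of n]] by (simp del: mult_1_right)
    qed
    then show ?thesis by blast
  qed
  \<comment> \<open>The limit is read off at the base point, where \<open>p\<close> is 1. Hence it
    depends on \<open>f\<close> alone and not on the bound used for the bracket.\<close>
  define M where "M f = lim (\<lambda>n. (L ^^ n) f base / lam ^ n)" for f
  have M: "M f = l" if l: "\<And>n. lip_le (\<lambda>x. (L ^^ n) f x / lam ^ n - l * p x) (A * \<rho> ^ n)" for f l A
  proof -
    have "(\<lambda>n. A * \<rho> ^ n) \<longlonglongrightarrow> 0"
      using tendsto_mult[OF tendsto_const LIMSEQ_power_zero[of \<rho>], of A] \<rho>_bounds by simp
    then have "(\<lambda>n. (L ^^ n) f base / lam ^ n) \<longlonglongrightarrow> l"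
      by (rule Lim_transform_bound[rotated, THEN LIM_zero_cancel])
        (use lip_leD(1)[OF l base_in] p1 in \<open>auto intro!: eventuallyI order_trans[OF _ abs_ge_self]\<close>)
    then show ?thesis by (simp add: M_def limI)
  qed
  have M_conv: "lip_le (\<lambda>x. (L ^^ n) f x / lam ^ n - M f * p x) (C1 * \<rho> ^ n * B)" if f: "lip_le f B" for f B n
  \<comment> \<open>The bracket needs a positive bound; for \<open>B = 0\<close> the function
    vanishes on \<open>K\<close>.\<close>
  proof (cases "B = 0")
    case False
    then have "0 < B" using lip_le_nonneg[OF f] by simp
    then obtain l where l: "\<And>n. lip_le (\<lambda>x. (L ^^ n) f x / lam ^ n - l * p x) (C1 * \<rho> ^ n * B)"
      using conv[OF f] by blast
    then have "M f = l" by (intro M[of _ _ "C1 * B"]) (simp add: mult_ac)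
    then show ?thesis using l by simp
  next
    case True
    then have "f x = 0" if "x \<in> K" for x using lip_leD(1)[OF f that] by simp
    then have 0: "(L ^^ n) f x = 0" if "x \<in> K" for x n
      using L_funpow_cong[of f "\<lambda>x. 0 * f x" x n] L_funpow_cmult[of n 0 f] that by simp
    have "M f = 0" by (rule M[of _ _ 0]) (use 0 in \<open>simp add: lip_le_def\<close>)
    then show ?thesis using 0 True by (simp add: lip_le_def)
  qed
  have M1: "0 < M (\<lambda>_. 1)"
  proof -
    \<comment> \<open>Since \<open>p \<le> E\<close>, the multiple \<open>1 / E\<close> of
      \<open>p\<close> lies below 1, and \<open>cone_diff\<close> allows the positive lower end
      \<open>\<kappa> * (1 / E)\<close>.\<close>
    have low: "(\<lambda>x. 1 - \<kappa> * (1 / E) * p x) \<in> log_lip_cone big"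
      by (rule cone_diff[OF one p]) (use p_le E_pos in \<open>auto simp: field_simps\<close>)
    have k1: "\<kappa> * (1 / E) \<le> 1" 
      using \<kappa>_bounds small_pos D_nonneg E_pos by (simp add: E_def field_simps order_trans[OF less_imp_le, of \<kappa> 1])
    have E1: "1 \<le> E" using small_pos D_nonneg by (simp add: E_def)
    have "1 \<le> E * 1 / \<kappa>" using \<kappa>_bounds E1 by (simp add: field_simps)
    then have "\<kappa> * (1 / E) \<le> E * 1 / \<kappa>" using k1 by linarith
    then obtain l where "\<kappa> * (1 / E) \<le> l"
      and l: "\<And>n. lip_le (\<lambda>x. (L ^^ n) (\<lambda>_. 1) x / lam ^ n - l * p x) (2 * (1 + big) * E * E * 1 / \<kappa> * \<rho> ^ n)"
      using brk[OF one zero_less_one _ _ _ low] \<kappa>_bounds E_pos by auto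
    moreover have "M (\<lambda>_. 1) = l" by (rule M[OF l])
    moreover have "0 < \<kappa> * (1 / E)" using \<kappa>_bounds E_pos by simp
    ultimately show ?thesis by linarith
  qed
  \<comment> \<open>Moving the factor \<open>m1\<close> from the functional to the eigenfunction
    normalises the functional to 1 at the constant 1.\<close>
  define m1 where "m1 = M (\<lambda>_. 1)"
  define h where "h x = m1 * p x" for x
  have "h x = 0" if "x \<notin> K" for x
    using fun_cong[OF Lp, of x] lam that by (simp add: h_def L_def)
  moreover have "0 < h x" if "x \<in> K" for x
    using p_ge[OF that] E_pos M1 by (simp add: h_def m1_def less_le_trans[OF _ p_ge[OF that]])
  moreover have "lip_le h (\<bar>m1\<bar> * ((1 + big) * E))"
    using lip_le_scaleR[OF cone_lip_le[OF small_in_big[OF p] p_le], of m1] by (simp add: h_def[abs_def])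
  moreover have "L h = (\<lambda>x. lam * h x)"
    by (simp add: h_def[abs_def] L_cmult Lp mult_ac)
  moreover have "\<exists>n a. lip_le (\<lambda>x. h x - a * (L ^^ n) (\<lambda>_. 1::real) x) e" if e: "0 < e" for e
  proof -
    obtain n a where "lip_le (\<lambda>x. p x - a * (L ^^ n) (\<lambda>_. 1::real) x) (e / m1)"
      using p_approx[of "e / m1"] e M1 by (auto simp: m1_def)
    from lip_le_scaleR[OF this, of m1] show ?thesis
      using M1 by (intro exI[of _ n] exI[of _ "m1 * a"]) (simp add: h_def m1_def algebra_simps)
  qed
  moreover have "lip_le (\<lambda>x. (L ^^ n) f x / lam ^ n - M f / m1 * h x) (C1 * \<rho> ^ n * B)" if "lip_le f B" for f B n
    using M_conv[OF that, of n] M1 by (simp add: h_def m1_def)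
  moreover have "m \<le> lam" if m: "\<And>x. x \<in> K \<Longrightarrow> m \<le> L (\<lambda>_. 1) x" for m
  proof -
    \<comment> \<open>Compare at the infimum: \<open>lam * p = L p\<close> is at least
      \<open>L i\<close>, hence at least \<open>i * m\<close>; the infimum over \<open>K\<close>
      gives \<open>lam * i \<ge> i * m\<close>.\<close>
    define i where "i = Inf (p ` K)"
    have bb: "bdd_below (p ` K)" using p_ge by (auto simp: bdd_below_def)
    have i_le: "i \<le> p x" if "x \<in> K" for x unfolding i_def using that bb by (simp add: cINF_lower)
    have i0: "0 < i"
      using cINF_greatest[OF K_nonempty, of "1 / E" p] p_ge E_pos by (simp add: i_def less_le_trans[of 0 "1 / E"])
    have "i * m / lam \<le> i"
      unfolding i_def
    proof (rule cINF_greatest[OF K_nonempty], unfold i_def[symmetric])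
      fix x assume x: "x \<in> K"
      have "L (\<lambda>_. i) x \<le> L p x"
        using i_le cone_bounded[OF _ p] small_pos by (intro L_mono) (auto simp: bounded_iff)
      then have "i * L (\<lambda>_. 1) x \<le> lam * p x" by (simp add: L_const_real[of i] Lp)
      moreover have "i * m \<le> i * L (\<lambda>_. 1) x" using m[OF x] i0 by simp
      ultimately show "i * m / lam \<le> p x" using lam by (simp add: field_simps)
    qed
    then show ?thesis using i0 lam by (simp add: field_simps)
  qed
  ultimately show ?thesis
    using lam C1 M1 by (intro exI[of _ lam] exI[of _ h] exI[of _ "\<lambda>f. M f / m1"] exI[of _ C1]) (auto simp: m1_def)
qed

section \<open>Lipschitz bounds and approximation by finite sums\<close>

definition W :: "'i \<Rightarrow> real" where "W i = exp (c * D) * wt i base"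

lemma wt_le_W: "i \<in> I \<Longrightarrow> x \<in> K \<Longrightarrow> wt i x \<le> W i"
proof -
  assume a: "i \<in> I" "x \<in> K"
  have "exp (c * d x base) * wt i base \<le> exp (c * D) * wt i base"
    using wt_pos[OF a(1) base_in] c_pos d_le[OF a(2) base_in] by (intro mult_right_mono) auto
  then show ?thesis using wt_log_lip[OF a base_in] by (simp add: W_def)
qed

lemma W_nonneg: "i \<in> I \<Longrightarrow> 0 \<le> W i"
  using wt_pos[OF _ base_in] by (simp add: W_def less_imp_le)

lemma W_summable: "W summable_on I"
  unfolding W_def[abs_def] by (intro summable_on_cmult_right wt_summable base_in)

lemma wt_lip: 
  assumes i: "i \<in> I" and x: "x \<in> K" and y: "y \<in> K" shows "\<bar>wt i x - wt i y\<bar> \<le> W i * c * d x y"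
proof -
  have "wt i x - wt i y \<le> W i * c * d x y" if x: "x \<in> K" and y: "y \<in> K" for x y
  proof -
    have "exp (- (c * d x y)) * wt i x \<le> wt i y"
      using wt_log_lip[OF i x y] by (simp add: exp_minus field_simps)
    then have "wt i x - wt i y \<le> wt i x * (1 - exp (- (c * d x y)))" by (simp add: algebra_simps)
    also have "\<dots> \<le> wt i x * (c * d x y)"
      using exp_ge_add_one_self[of "- (c * d x y)"] wt_pos[OF i x] by (intro mult_left_mono) auto
    also have "\<dots> \<le> W i * (c * d x y)"
      using wt_le_W[OF i x] c_pos d_nonneg[OF x y] by (intro mult_right_mono) auto
    finally show ?thesis by simp
  qed
  from this[OF x y] this[OF y x] show ?thesis by (simp add: abs_le_iff d_sym[OF x y])
qed

lemma term_lip_le: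
  assumes i: "i \<in> I" and f: "lip_le f B"
  shows "lip_le (\<lambda>x. wt i x *\<^sub>R f (\<phi> i x)) (W i * (1 + c) * B)"
proof (rule lip_leI)
  have B: "0 \<le> B" by (rule lip_le_nonneg[OF f])
  fix x assume x: "x \<in> K"
  have "wt i x * norm (f (\<phi> i x)) \<le> W i * B"
    using wt_le_W[OF i x] lip_leD(1)[OF f \<phi>_in[OF i x]] W_nonneg[OF i] by (intro mult_mono) auto
  also have "\<dots> \<le> W i * (1 + c) * B" using W_nonneg[OF i] B c_pos by (simp add: algebra_simps)
  finally show "norm (wt i x *\<^sub>R f (\<phi> i x)) \<le> W i * (1 + c) * B"
    using wt_pos[OF i x] by simp
  fix y assume y: "y \<in> K"
  have "norm (f (\<phi> i x) - f (\<phi> i y)) \<le> B * (\<theta> * d x y)"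
    using lip_leD(2)[OF f \<phi>_in[OF i x] \<phi>_in[OF i y]] mult_left_mono[OF \<phi>_contract[OF i x y] B] by linarith
  also have "\<dots> \<le> B * d x y"
    using \<theta>_less_1 \<theta>_nonneg d_nonneg[OF x y] B by (intro mult_left_mono mult_left_le_one_le) auto
  finally have 1: "norm (wt i x *\<^sub>R (f (\<phi> i x) - f (\<phi> i y))) \<le> W i * (B * d x y)"
    using wt_le_W[OF i x] wt_pos[OF i x] W_nonneg[OF i] by (auto intro!: mult_mono)
  have 2: "norm ((wt i x - wt i y) *\<^sub>R f (\<phi> i y)) \<le> (W i * c * d x y) * B"
    using wt_lip[OF i x y] lip_leD(1)[OF f \<phi>_in[OF i y]] order_trans[OF abs_ge_zero wt_lip[OF i x y]]
    unfolding norm_scaleR by (intro mult_mono) auto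
  have "wt i x *\<^sub>R f (\<phi> i x) - wt i y *\<^sub>R f (\<phi> i y) =
      wt i x *\<^sub>R (f (\<phi> i x) - f (\<phi> i y)) + (wt i x - wt i y) *\<^sub>R f (\<phi> i y)"
    by (simp add: algebra_simps)
  then show "norm (wt i x *\<^sub>R f (\<phi> i x) - wt i y *\<^sub>R f (\<phi> i y)) \<le> W i * (1 + c) * B * d x y"
    using norm_triangle_mono[OF 1 2] by (simp add: algebra_simps)
qed

text \<open>The summable \<open>W\<close> majorises the weights uniformly on \<open>K\<close>, and
  by \<open>term_lip_le\<close> the Lipschitz norms of the terms too. So \<open>L f\<close> is a
  Lipschitz limit of finite sums, which reduces smoothness of \<open>L f\<close> to single branches;
  \<open>J = {}\<close> gives boundedness of \<open>L\<close>.\<close>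

lemma L_minus_partial_lip_le:
  fixes f :: "'a \<Rightarrow> 'b::banach"
  assumes J: "finite J" "J \<subseteq> I" and f: "lip_le f B"
  shows "lip_le (\<lambda>x. L f x - (\<Sum>i\<in>J. wt i x *\<^sub>R f (\<phi> i x))) ((\<Sum>\<^sub>\<infinity>i\<in>I - J. W i) * (1 + c) * B)"
proof -
  let ?t = "\<lambda>i x. wt i x *\<^sub>R f (\<phi> i x)"
  have sm: "(\<lambda>i. ?t i x) summable_on I" if "x \<in> K" for x
    by (rule summable_terms[OF that lip_le_bounded[OF f]])
  have sm': "(\<lambda>i. ?t i x) summable_on I - J" if "x \<in> K" for x
    using sm[OF that] by (rule summable_on_cofin_subset) (rule J)
  have eq: "L f x - (\<Sum>i\<in>J. ?t i x) = (\<Sum>\<^sub>\<infinity>i\<in>I - J. ?t i x)" if "x \<in> K" for x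
  proof -
    have "infsum (\<lambda>i. ?t i x) ((I - J) \<union> J) = infsum (\<lambda>i. ?t i x) (I - J) + infsum (\<lambda>i. ?t i x) J"
      using J by (intro infsum_Un_disjoint sm'[OF that]) auto
    moreover have "(I - J) \<union> J = I" using J by blast
    ultimately show ?thesis using that J by (simp add: L_def)
  qed
  have W': "W summable_on I - J" using W_summable by (rule summable_on_cofin_subset) (rule J)
  have "lip_le (\<lambda>x. \<Sum>\<^sub>\<infinity>i\<in>I - J. ?t i x) ((\<Sum>\<^sub>\<infinity>i\<in>I - J. W i) * (1 + c) * B)"
  proof (rule lip_leI)
    fix x assume x: "x \<in> K"
    have W1: "((\<lambda>i. W i * (1 + c) * B) has_sum ((\<Sum>\<^sub>\<infinity>i\<in>I - J. W i) * (1 + c) * B)) (I - J)"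
      by (intro has_sum_cmult_left has_sum_infsum W')
    show "norm (\<Sum>\<^sub>\<infinity>i\<in>I - J. ?t i x) \<le> (\<Sum>\<^sub>\<infinity>i\<in>I - J. W i) * (1 + c) * B"
      by (rule norm_infsum_le[OF has_sum_infsum[OF sm'[OF x]] W1]) (use lip_leD(1)[OF term_lip_le[OF _ f] x] in blast)
    fix y assume y: "y \<in> K"
    have "(\<Sum>\<^sub>\<infinity>i\<in>I - J. ?t i x) - (\<Sum>\<^sub>\<infinity>i\<in>I - J. ?t i y) = (\<Sum>\<^sub>\<infinity>i\<in>I - J. ?t i x - ?t i y)"
      using infsum_add[OF sm'[OF x] summable_on_uminus[THEN iffD2, OF sm'[OF y]]] by (simp add: infsum_uminus)
    moreover have "norm (\<Sum>\<^sub>\<infinity>i\<in>I - J. ?t i x - ?t i y) \<le> (\<Sum>\<^sub>\<infinity>i\<in>I - J. W i) * (1 + c) * B * d x y"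
      by (rule norm_infsum_le[OF has_sum_infsum[OF summable_on_add[OF sm'[OF x] summable_on_uminus[THEN iffD2, OF sm'[OF y]], folded diff_conv_add_uminus]] has_sum_cmult_left[OF W1]])
        (use lip_leD(2)[OF term_lip_le[OF _ f] x y] in blast)
    ultimately show "norm ((\<Sum>\<^sub>\<infinity>i\<in>I - J. ?t i x) - (\<Sum>\<^sub>\<infinity>i\<in>I - J. ?t i y)) \<le> (\<Sum>\<^sub>\<infinity>i\<in>I - J. W i) * (1 + c) * B * d x y"
      by simp
  qed
  then show ?thesis using eq lip_le_cong[of "\<lambda>x. L f x - (\<Sum>i\<in>J. ?t i x)"] by simp
qed

lemma L_lip_le:
  fixes f :: "'a \<Rightarrow> 'b::banach"
  shows "lip_le f B \<Longrightarrow> lip_le (L f) ((\<Sum>\<^sub>\<infinity>i\<in>I. W i) * (1 + c) * B)"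
  using L_minus_partial_lip_le[of "{}" f B] by simp

lemma L_approx:
  fixes f :: "'a \<Rightarrow> 'b::banach"
  assumes f: "lip_le f B" and e: "0 < e"
  shows "\<exists>J. finite J \<and> J \<subseteq> I \<and> lip_le (\<lambda>x. L f x - (\<Sum>i\<in>J. wt i x *\<^sub>R f (\<phi> i x))) e"
proof -
  have B: "0 \<le> B" by (rule lip_le_nonneg[OF f])
  define e' where "e' = e / ((1 + c) * (B + 1))"
  have e': "0 < e'" using e c_pos B by (simp add: e'_def)
  obtain J where J: "finite J" "J \<subseteq> I" and le: "dist (sum W J) (infsum W I) \<le> e'"
    using infsum_finite_approximation[OF W_summable e'] by blast
  have "infsum W ((I - J) \<union> J) = infsum W (I - J) + infsum W J"
    using J W_summable by (intro infsum_Un_disjoint summable_on_cofin_subset[OF W_summable]) auto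
  moreover have "(I - J) \<union> J = I" using J by blast
  ultimately have "infsum W (I - J) \<le> e'" using le J by (simp add: dist_real_def)
  then have "infsum W (I - J) * (1 + c) * B \<le> e' * (1 + c) * (B + 1)"
    using c_pos B e' by (intro mult_mono) auto
  also have "\<dots> = e" using c_pos B by (simp add: e'_def)
  finally show ?thesis using lip_le_mono[OF L_minus_partial_lip_le[OF J f]] J by blast
qed

end

section \<open>The Riesz representation theorem on a compact metric space\<close>

locale positive_functional =
  fixes K :: "'a::metric_space set" and \<Lambda> :: "('a \<Rightarrow> real) \<Rightarrow> real"
  assumes K_compact: "compact K"
    and \<Lambda>_add: "\<And>f g. continuous_on K f \<Longrightarrow> continuous_on K g \<Longrightarrow> \<Lambda> (\<lambda>x. f x + g x) = \<Lambda> f + \<Lambda> g"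
    and \<Lambda>_cmult: "\<And>f a. continuous_on K f \<Longrightarrow> \<Lambda> (\<lambda>x. a * f x) = a * \<Lambda> f"
    and \<Lambda>_nonneg: "\<And>f. continuous_on K f \<Longrightarrow> (\<And>x. x \<in> K \<Longrightarrow> 0 \<le> f x) \<Longrightarrow> 0 \<le> \<Lambda> f"
begin

lemma \<Lambda>_diff: "continuous_on K f \<Longrightarrow> continuous_on K g \<Longrightarrow> \<Lambda> (\<lambda>x. f x - g x) = \<Lambda> f - \<Lambda> g"
  using \<Lambda>_add[of f "\<lambda>x. (-1) * g x"] \<Lambda>_cmult[of g "-1"] by (simp add: continuous_on_minus)

lemma \<Lambda>_mono: "continuous_on K f \<Longrightarrow> continuous_on K g \<Longrightarrow> (\<And>x. x \<in> K \<Longrightarrow> f x \<le> g x) \<Longrightarrow> \<Lambda> f \<le> \<Lambda> g"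
  using \<Lambda>_nonneg[of "\<lambda>x. g x - f x"] \<Lambda>_diff[of g f] by (simp add: continuous_on_diff)

lemma \<Lambda>_zero: "\<Lambda> (\<lambda>_. 0) = 0"
  using \<Lambda>_cmult[of "\<lambda>_. 0" 0] by simp

lemma \<Lambda>_const: "\<Lambda> (\<lambda>_. a) = a * \<Lambda> (\<lambda>_. 1)"
  using \<Lambda>_cmult[of "\<lambda>_. 1" a] by simp

lemma \<Lambda>_sum:
  assumes "\<And>i. continuous_on K (f i)"
  shows "\<Lambda> (\<lambda>x. \<Sum>i<n::nat. f i x) = (\<Sum>i<n. \<Lambda> (f i))"
  using assms by (induction n) (auto simp: \<Lambda>_zero \<Lambda>_add continuous_on_sum)

section \<open>The outer measure of a positive functional\<close>

definition covers :: "'a set \<Rightarrow> (nat \<Rightarrow> 'a \<Rightarrow> real) \<Rightarrow> bool" where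
  "covers A f \<longleftrightarrow> (\<forall>i. continuous_on K (f i) \<and> (\<forall>x\<in>K. 0 \<le> f i x)) \<and> (\<forall>x\<in>A. 1 \<le> (\<Sum>i. ennreal (f i x)))"

text \<open>Sets are covered by series of nonnegative continuous functions rather than by open sets,
  so a cover can be cut by multiplying with continuous cut-offs.\<close>

definition om :: "'a set \<Rightarrow> ennreal" where
  "om A = (INF f\<in>Collect (covers A). \<Sum>i. ennreal (\<Lambda> (f i)))"

lemma om_le: "covers A f \<Longrightarrow> om A \<le> (\<Sum>i. ennreal (\<Lambda> (f i)))"
  unfolding om_def by (rule INF_lower) simp

lemma covers_nonneg: "covers A f \<Longrightarrow> 0 \<le> \<Lambda> (f i)"
  by (rule \<Lambda>_nonneg) (auto simp: covers_def)

lemma om_mono: "A \<subseteq> B \<Longrightarrow> om A \<le> om B"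
  unfolding om_def by (rule INF_superset_mono) (auto simp: covers_def subset_iff)

lemma om_empty: "om {} = 0"
  using om_le[of "{}" "\<lambda>_ _. 0"] by (simp add: covers_def \<Lambda>_zero)

lemma om_le_single:
  assumes "continuous_on K f" "\<And>x. x \<in> K \<Longrightarrow> 0 \<le> f x" "\<And>x. x \<in> A \<Longrightarrow> 1 \<le> f x"
  shows "om A \<le> ennreal (\<Lambda> f)"
proof -
  let ?f = "\<lambda>i::nat. if i = 0 then f else (\<lambda>_. 0)"
  have "(\<Sum>i. ennreal (?f i x)) = ennreal (f x)" for x
    by (subst suminf_finite[of "{0}"]) auto
  then have "covers A ?f" using assms by (auto simp: covers_def)
  moreover have "(\<Sum>i. ennreal (\<Lambda> (?f i))) = ennreal (\<Lambda> f)"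
    by (subst suminf_finite[of "{0}"]) (auto simp: \<Lambda>_zero)
  ultimately show ?thesis using om_le by metis
qed

lemma om_close: "om A < e \<Longrightarrow> \<exists>f. covers A f \<and> (\<Sum>i. ennreal (\<Lambda> (f i))) < e"
  unfolding om_def INF_less_iff by auto

lemma suminf_half: "0 < e \<Longrightarrow> (\<Sum>n. ennreal (e * (1 / 2) ^ Suc n)) = ennreal e"
  by (rule suminf_ennreal_eq) (use sums_mult[OF power_half_series, of e] in \<open>simp_all only: mult_1_right, simp\<close>)

lemma om_countably_subadditive: "countably_subadditive (Pow K) om"
proof (simp add: countably_subadditive_def, safe)
  fix A :: "nat \<Rightarrow> _"
  show "om (\<Union>i. A i) \<le> (\<Sum>n. om (A n))"
  proof (rule ennreal_le_epsilon)
    fix e :: real assume e: "0 < e" and "(\<Sum>n. om (A n)) < top"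
    then have "om (A n) < om (A n) + ennreal (e * (1 / 2) ^ Suc n)" for n
      by (auto simp add: less_top dest!: ennreal_suminf_lessD)
    from om_close[OF this] have "\<forall>n. \<exists>f. covers (A n) f \<and> (\<Sum>i. ennreal (\<Lambda> (f i))) < om (A n) + ennreal (e * (1 / 2) ^ Suc n)"
      by blast
    then obtain f where f: "\<And>n. covers (A n) (f n)"
      and fl: "\<And>n. (\<Sum>i. ennreal (\<Lambda> (f n i))) < om (A n) + ennreal (e * (1 / 2) ^ Suc n)"
      by metis
    define C where "C k = case_prod f (prod_decode k)" for k
    have "(\<Sum>k. ennreal (C k x)) = (\<Sum>n. \<Sum>i. ennreal (f n i x))" for x
      using suminf_ennreal_2dimen[of "\<lambda>n. \<Sum>i. ennreal (f n i x)" "\<lambda>p. ennreal (case_prod f p x)"]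
      by (simp add: C_def split_beta)
    moreover have "1 \<le> (\<Sum>n. \<Sum>i. ennreal (f n i x))" if "x \<in> A m" for x m
    proof -
      have "1 \<le> (\<Sum>i. ennreal (f m i x))" using f[of m] that by (auto simp: covers_def)
      also have "\<dots> = (\<Sum>n\<in>{m}. \<Sum>i. ennreal (f n i x))" by simp
      also have "\<dots> \<le> (\<Sum>n. \<Sum>i. ennreal (f n i x))" by (rule sum_le_suminf) auto
      finally show ?thesis .
    qed
    ultimately have "covers (\<Union>i. A i) C"
      using f by (auto simp: covers_def C_def split_beta)
    then have "om (\<Union>i. A i) \<le> (\<Sum>k. ennreal (\<Lambda> (C k)))" by (rule om_le)
    also have "\<dots> = (\<Sum>n. \<Sum>i. ennreal (\<Lambda> (f n i)))"
      using suminf_ennreal_2dimen[of "\<lambda>n. \<Sum>i. ennreal (\<Lambda> (f n i))" "\<lambda>p. ennreal (\<Lambda> (case_prod f p))"]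
      by (simp add: C_def split_beta)
    also have "\<dots> \<le> (\<Sum>n. om (A n) + ennreal (e * (1 / 2) ^ Suc n))"
      using fl by (intro suminf_le less_imp_le) auto
    also have "\<dots> = (\<Sum>n. om (A n)) + ennreal e"
      unfolding suminf_half[OF e, symmetric] by (rule suminf_add[symmetric]) auto
    finally show "om (\<Union>i. A i) \<le> (\<Sum>n. om (A n)) + ennreal e" .
  qed
qed

lemma om_outer_measure: "outer_measure_space (Pow K) om"
  unfolding outer_measure_space_def positive_def increasing_def
  using om_mono om_empty om_countably_subadditive by auto

text \<open>A cover \<open>f\<close> of \<open>A\<close> is split along \<open>\<phi> k\<close> increasing to the indicator of \<open>E\<close>: the double series
  \<open>f i * (\<phi> (k + 1) - \<phi> k)\<close> covers \<open>A \<inter> E\<close>, and each \<open>f i * (1 - \<phi> (k i))\<close> still dominates \<open>f i\<close> off \<open>E\<close>.\<close>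

lemma om_split:
  fixes \<phi> :: "nat \<Rightarrow> 'a \<Rightarrow> real"
  assumes \<phi>: "\<And>k. continuous_on K (\<phi> k)" "\<And>k x. x \<in> K \<Longrightarrow> 0 \<le> \<phi> k x" "\<And>k x. x \<in> K \<Longrightarrow> \<phi> k x \<le> 1"
      "\<And>k x. x \<in> K \<Longrightarrow> \<phi> k x \<le> \<phi> (Suc k) x" "\<And>x. x \<in> K \<Longrightarrow> \<phi> 0 x = 0"
    and E: "\<And>x. x \<in> E \<Longrightarrow> (\<lambda>k. \<phi> k x) \<longlonglongrightarrow> 1" "\<And>x k. x \<in> K - E \<Longrightarrow> \<phi> k x = 0" and A: "A \<subseteq> K"
  shows "om (A \<inter> E) + om (A - E) \<le> om A"
proof (rule ennreal_le_epsilon)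
  fix e :: real assume e: "0 < e" and "om A < top"
  then have "om A < om A + ennreal (e / 2)" by auto
  then obtain f where f: "covers A f" and fl: "(\<Sum>i. ennreal (\<Lambda> (f i))) < om A + ennreal (e / 2)"
    using om_close by blast
  have cf: "continuous_on K (f i)" and f0: "x \<in> K \<Longrightarrow> 0 \<le> f i x" for i x
    using f by (auto simp: covers_def)
  define a where "a i k = \<Lambda> (\<lambda>x. f i x * \<phi> k x)" for i k
  have cfp: "continuous_on K (\<lambda>x. f i x * \<phi> k x)" for i k by (intro continuous_intros cf \<phi>)
  have a_inc: "incseq (a i)" for i
    unfolding a_def by (intro incseq_SucI \<Lambda>_mono cfp mult_left_mono \<phi> f0)
  have a_le: "a i k \<le> \<Lambda> (f i)" for i k
    unfolding a_def using \<phi> f0 by (intro \<Lambda>_mono cfp cf mult_right_le_one_le) auto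
  \<comment> \<open>The limit \<open>l i\<close> is the part of \<open>\<Lambda> (f i)\<close>
    charged to \<open>E\<close>; the rest goes to the complement, up to errors with sum
    \<open>e / 2\<close>.\<close>
  have "\<exists>l. a i \<longlonglongrightarrow> l" for i
    by (rule incseq_convergent[OF a_inc, of i "\<Lambda> (f i)"]) (use a_le in auto)
  then obtain l where l: "\<And>i. a i \<longlonglongrightarrow> l i" by metis
  have a0: "a i 0 = 0" for i
  proof -
    have "a i 0 \<le> \<Lambda> (\<lambda>_. 0)" unfolding a_def by (rule \<Lambda>_mono) (auto simp: cfp \<phi>(5))
    moreover have "0 \<le> a i 0" unfolding a_def by (rule \<Lambda>_nonneg) (auto simp: cfp \<phi>(5))
    ultimately show ?thesis by (simp add: \<Lambda>_zero)
  qed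
  define \<psi> where "\<psi> i k = (\<lambda>x. f i x * \<phi> (Suc k) x - f i x * \<phi> k x)" for i k
  have \<psi>c: "continuous_on K (\<psi> i k)" for i k unfolding \<psi>_def by (intro continuous_on_diff cfp)
  have \<psi>0: "0 \<le> \<psi> i k x" if "x \<in> K" for i k x
    using mult_left_mono[OF \<phi>(4)[OF that] f0[OF that]] by (simp add: \<psi>_def)
  have \<psi>\<Lambda>: "\<Lambda> (\<psi> i k) = a i (Suc k) - a i k" for i k
    unfolding \<psi>_def a_def by (rule \<Lambda>_diff[OF cfp cfp])
  define C where "C n = case_prod \<psi> (prod_decode n)" for n
  have "(\<Sum>k. ennreal (\<psi> i k x)) = ennreal (f i x)" if "x \<in> A \<inter> E" for x i
  proof (rule suminf_ennreal_eq)
    show "0 \<le> \<psi> i k x" for k using \<psi>0 that A by auto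
    have "(\<lambda>k. f i x * \<phi> k x) \<longlonglongrightarrow> f i x * 1" using E(1) that by (intro tendsto_intros) auto
    from telescope_sums[OF this] show "(\<lambda>k. \<psi> i k x) sums f i x"
      using \<phi>(5) that A by (simp add: \<psi>_def subset_iff)
  qed
  moreover have "(\<Sum>n. ennreal (C n x)) = (\<Sum>i. \<Sum>k. ennreal (\<psi> i k x))" for x
    using suminf_ennreal_2dimen[of "\<lambda>i. \<Sum>k. ennreal (\<psi> i k x)" "\<lambda>p. ennreal (case_prod \<psi> p x)"]
    by (simp add: C_def split_beta)
  ultimately have "covers (A \<inter> E) C"
    using f \<psi>c \<psi>0 by (auto simp: covers_def C_def split_beta)
  then have "om (A \<inter> E) \<le> (\<Sum>n. ennreal (\<Lambda> (C n)))" by (rule om_le)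
  also have "\<dots> = (\<Sum>i. \<Sum>k. ennreal (\<Lambda> (\<psi> i k)))"
    using suminf_ennreal_2dimen[of "\<lambda>i. \<Sum>k. ennreal (\<Lambda> (\<psi> i k))" "\<lambda>p. ennreal (\<Lambda> (case_prod \<psi> p))"]
    by (simp add: C_def split_beta)
  also have "\<dots> = (\<Sum>i. ennreal (l i))"
  proof (rule suminf_cong, rule suminf_ennreal_eq)
    show "0 \<le> \<Lambda> (\<psi> i k)" for i k by (rule \<Lambda>_nonneg[OF \<psi>c \<psi>0])
    show "(\<lambda>k. \<Lambda> (\<psi> i k)) sums l i" for i
      using telescope_sums[OF l[of i]] by (simp add: \<psi>\<Lambda> a0)
  qed
  finally have 1: "om (A \<inter> E) \<le> (\<Sum>i. ennreal (l i))" .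
  have "\<exists>k. l i - a i k \<le> (e / 2) * (1 / 2) ^ Suc i" for i
  proof -
    have "0 < (e / 2) * (1 / 2) ^ Suc i" using e by simp
    then have "eventually (\<lambda>k. l i - (e / 2) * (1 / 2) ^ Suc i < a i k) sequentially"
      using order_tendstoD(1)[OF l[of i], of "l i - (e / 2) * (1 / 2) ^ Suc i"] by simp
    then obtain k where "l i - (e / 2) * (1 / 2) ^ Suc i < a i k" by (auto simp: eventually_sequentially)
    then show ?thesis by (intro exI[of _ k]) linarith
  qed
  then obtain k where k: "\<And>i. l i - a i (k i) \<le> (e / 2) * (1 / 2) ^ Suc i" by metis
  define g where "g i = (\<lambda>x. f i x - f i x * \<phi> (k i) x)" for i
  have gc: "continuous_on K (g i)" for i unfolding g_def by (intro continuous_on_diff cf cfp)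
  have g0: "0 \<le> g i x" if "x \<in> K" for i x
    using mult_left_mono[OF \<phi>(3)[OF that] f0[OF that]] by (simp add: g_def)
  have "g i x = f i x" if "x \<in> A - E" for i x
    using E(2) that A by (auto simp: g_def subset_iff)
  then have "covers (A - E) g"
    using f gc g0 by (auto simp: covers_def)
  then have 2: "om (A - E) \<le> (\<Sum>i. ennreal (\<Lambda> (g i)))" by (rule om_le)
  have l0: "0 \<le> l i" for i
  proof (rule LIMSEQ_le_const[OF l])
    have "0 \<le> a i n" for n using incseqD[OF a_inc, of 0 n i] by (simp add: a0)
    then show "\<exists>N. \<forall>n\<ge>N. 0 \<le> a i n" by blast
  qed
  have "om (A \<inter> E) + om (A - E) \<le> (\<Sum>i. ennreal (l i)) + (\<Sum>i. ennreal (\<Lambda> (g i)))"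
    using 1 2 by (rule add_mono)
  also have "\<dots> = (\<Sum>i. ennreal (l i) + ennreal (\<Lambda> (g i)))" by (rule suminf_add) auto
  also have "\<dots> \<le> (\<Sum>i. ennreal (\<Lambda> (f i)) + ennreal ((e / 2) * (1 / 2) ^ Suc i))"
  proof (intro suminf_le allI)
    fix i
    have "\<Lambda> (g i) = \<Lambda> (f i) - a i (k i)" unfolding g_def a_def by (rule \<Lambda>_diff[OF cf cfp])
    then have "l i + \<Lambda> (g i) \<le> \<Lambda> (f i) + (e / 2) * (1 / 2) ^ Suc i" using k[of i] by linarith
    then show "ennreal (l i) + ennreal (\<Lambda> (g i)) \<le> ennreal (\<Lambda> (f i)) + ennreal ((e / 2) * (1 / 2) ^ Suc i)"
      using l0 \<Lambda>_nonneg[OF gc g0] covers_nonneg[OF f] e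
      by (simp del: power_Suc ennreal_plus add: ennreal_plus[symmetric] ennreal_leI)
  qed auto
  also have "\<dots> = (\<Sum>i. ennreal (\<Lambda> (f i))) + ennreal (e / 2)"
    unfolding suminf_half[of "e / 2", OF half_gt_zero[OF e], symmetric] by (rule suminf_add[symmetric]) auto
  also have "\<dots> \<le> om A + ennreal (e / 2) + ennreal (e / 2)"
    using fl by (intro add_right_mono) auto
  also have "\<dots> = om A + ennreal e"
    using e by (simp add: add.assoc ennreal_plus[symmetric] del: ennreal_plus)
  finally show "om (A \<inter> E) + om (A - E) \<le> om A + ennreal e" .
qed

lemma open_in_lambda_system:
  assumes "open U"
  shows "K \<inter> U \<in> lambda_system K (Pow K) om"
proof -
  interpret P: sigma_algebra K "Pow K" by (rule sigma_algebra_Pow)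
  \<comment> \<open>\<open>infdist x {}\<close> is 0 by convention, so the case where
    \<open>U\<close> is the whole space has its own sequence, which still starts with 0.\<close>
  define \<phi> where "\<phi> k x = (if - U = {} then (if k = 0 then 0 else 1) else min 1 (real k * infdist x (- U)))"
    for k :: nat and x
  have split: "om (A \<inter> (K \<inter> U)) + om (A - (K \<inter> U)) \<le> om A" if "A \<subseteq> K" for A
  proof (rule om_split[where \<phi> = \<phi>])
    show "continuous_on K (\<phi> k)" for k
      unfolding \<phi>_def by (cases "- U = {}") (auto intro!: continuous_intros)
    show "0 \<le> \<phi> k x" "\<phi> k x \<le> 1" for k x by (auto simp: \<phi>_def infdist_nonneg)
    show "\<phi> k x \<le> \<phi> (Suc k) x" for k x
    proof -
      have "real k * infdist x (- U) \<le> real (Suc k) * infdist x (- U)"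
        by (intro mult_right_mono) (auto simp: infdist_nonneg)
      then show ?thesis unfolding \<phi>_def by (auto intro: min.mono)
    qed
    show "\<phi> 0 x = 0" for x by (simp add: \<phi>_def)
    show "\<phi> k x = 0" if "x \<in> K - (K \<inter> U)" for x k using that by (auto simp: \<phi>_def)
    show "(\<lambda>k. \<phi> k x) \<longlonglongrightarrow> 1" if "x \<in> K \<inter> U" for x
    proof (cases "- U = {}")
      case True
      then show ?thesis
        by (intro tendsto_eventually eventually_sequentiallyI[of 1]) (auto simp: \<phi>_def)
    next
      case False
      have "infdist x (- U) \<noteq> 0"
        using in_closed_iff_infdist_zero[of "- U" x] False assms that by (auto simp: closed_def)
      then have pos: "0 < infdist x (- U)" using infdist_nonneg[of x "- U"] by linarith
      obtain k0 :: nat where k0: "1 \<le> real k0 * infdist x (- U)"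
        using reals_Archimedean3[OF pos] less_imp_le by blast
      have "\<phi> k x = 1" if "k0 \<le> k" for k
      proof -
        have "real k0 * infdist x (- U) \<le> real k * infdist x (- U)"
          using that pos by (intro mult_right_mono) auto
        then show ?thesis using k0 False by (simp add: \<phi>_def)
      qed
      then show ?thesis
        by (intro tendsto_eventually eventually_sequentiallyI[of k0]) auto
    qed
  qed (use that in auto)
  have sub: "subadditive (Pow K) om"
    by (rule P.countably_subadditive_subadditive[OF _ om_countably_subadditive]) (simp add: positive_def om_empty)
  have "om (A \<inter> (K \<inter> U)) + om (A - (K \<inter> U)) = om A" if A: "A \<in> Pow K" for A
  proof (rule antisym)
    have "om ((A \<inter> (K \<inter> U)) \<union> (A - (K \<inter> U))) \<le> om (A \<inter> (K \<inter> U)) + om (A - (K \<inter> U))"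
      using A by (intro subadditiveD[OF sub]) auto
    moreover have "(A \<inter> (K \<inter> U)) \<union> (A - (K \<inter> U)) = A" by blast
    ultimately show "om A \<le> om (A \<inter> (K \<inter> U)) + om (A - (K \<inter> U))" by simp
  qed (use split A in auto)
  then show ?thesis by (simp add: P.lambda_system_eq)
qed

section \<open>The representing measure\<close>

definition riesz_measure :: "'a measure" where
  "riesz_measure = measure_of K (sets (restrict_space borel K)) om"

lemma restrict_sigma_algebra: "sigma_algebra K (sets (restrict_space borel K))"
  using sets.sigma_algebra_axioms[of "restrict_space borel K"] by (simp add: space_restrict_space)

text \<open>The Caratheodory-measurable sets form a sigma algebra that contains the relatively open
  sets. The induction runs over Borel sets of the whole space, whose traces are the sets of the
  restricted space.\<close>

lemma measure_space_om: "measure_space K (sets (restrict_space borel K)) om"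
proof (rule measure_down)
  show ms: "measure_space K (lambda_system K (Pow K) om) om"
    by (rule sigma_algebra.caratheodory_lemma[OF sigma_algebra_Pow om_outer_measure])
  show "sigma_algebra K (sets (restrict_space borel K))" by (rule restrict_sigma_algebra)
  interpret L: sigma_algebra K "lambda_system K (Pow K) om" using ms by (simp add: measure_space_def)
  have "K \<inter> T \<in> lambda_system K (Pow K) om" if "T \<in> sigma_sets UNIV {S. open S}" for T
    using that
  proof induction
    case (Basic a) then show ?case by (simp add: open_in_lambda_system)
  next
    case Empty then show ?case by simp
  next
    case (Compl a)
    have "K \<inter> (UNIV - a) = K - (K \<inter> a)" by blast
    then show ?case using L.compl_sets[OF Compl.IH] by simp
  next
    case (Union a)
    have "K \<inter> (\<Union>i. a i) = (\<Union>i. K \<inter> a i)" by blast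
    then show ?case using L.countable_UN[of "\<lambda>i. K \<inter> a i"] Union.IH by (simp add: image_subset_iff)
  qed
  then show "sets (restrict_space borel K) \<subseteq> lambda_system K (Pow K) om"
    by (auto simp: sets_restrict_space borel_def)
qed

lemma sets_riesz [simp, measurable_cong]: "sets riesz_measure = sets (restrict_space borel K)"
  unfolding riesz_measure_def using sigma_algebra.sets_measure_of_eq[OF restrict_sigma_algebra] by simp

lemma space_riesz [simp]: "space riesz_measure = K"
  using sets_eq_imp_space_eq[OF sets_riesz] by (simp add: space_restrict_space)

lemma emeasure_riesz: "A \<in> sets (restrict_space borel K) \<Longrightarrow> emeasure riesz_measure A = om A"
  unfolding riesz_measure_def using measure_space_om
  by (intro emeasure_measure_of_sigma restrict_sigma_algebra) (auto simp: measure_space_def)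

text \<open>Dini's argument: some partial sum is at least \<open>1 - e\<close> on all of
  \<open>K\<close>, so \<open>\<Lambda>\<close> meets only a finite sum. Otherwise points
  \<open>x N\<close> with partial sums below \<open>1 - e\<close> accumulate at some
  \<open>y\<close>, where every partial sum would be at most \<open>1 - e\<close>.\<close>

lemma one_le_suminf_imp:
  assumes f: "\<And>i. continuous_on K (f i)" "\<And>i x. x \<in> K \<Longrightarrow> 0 \<le> f i x"
    and one: "\<And>x. x \<in> K \<Longrightarrow> 1 \<le> (\<Sum>i. ennreal (f i x))"
  shows "ennreal (\<Lambda> (\<lambda>_. 1)) \<le> (\<Sum>i. ennreal (\<Lambda> (f i)))"
proof -
  have \<Lambda>0: "0 \<le> \<Lambda> (f i)" for i using f by (intro \<Lambda>_nonneg) auto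
  have "ennreal ((1 - e) * \<Lambda> (\<lambda>_. 1)) \<le> (\<Sum>i. ennreal (\<Lambda> (f i)))" if e: "0 < e" for e
  proof -
    have "\<exists>N. \<forall>x\<in>K. 1 - e \<le> (\<Sum>i<N. f i x)"
    proof (rule ccontr)
      assume "\<not> ?thesis"
      then have "\<forall>N. \<exists>x\<in>K. (\<Sum>i<N. f i x) < 1 - e" by (auto simp: not_le)
      then obtain x where x: "\<And>N. x N \<in> K" "\<And>N. (\<Sum>i<N. f i (x N)) < 1 - e" by metis
      obtain y r where y: "y \<in> K" "strict_mono r" "(x \<circ> r) \<longlonglongrightarrow> y"
        using K_compact x(1) unfolding compact_def by blast
      have "(\<Sum>i<M. f i y) \<le> 1 - e" for M
      proof (rule LIMSEQ_le_const2)
        have "continuous_on K (\<lambda>z. \<Sum>i<M. f i z)" by (intro continuous_intros f)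
        from continuous_on_tendsto_compose[OF this y(3,1)] x(1)
        show "(\<lambda>n. \<Sum>i<M. f i (x (r n))) \<longlonglongrightarrow> (\<Sum>i<M. f i y)" by (simp add: o_def)
        have "(\<Sum>i<M. f i (x (r n))) \<le> 1 - e" if "M \<le> n" for n
        proof -
          have "M \<le> r n" using that seq_suble[OF y(2), of n] by linarith
          then have "(\<Sum>i<M. f i (x (r n))) \<le> (\<Sum>i<r n. f i (x (r n)))"
            using f(2)[OF x(1)] by (intro sum_mono2) auto
          then show ?thesis using x(2)[of "r n"] by linarith
        qed
        then show "\<exists>N. \<forall>n\<ge>N. (\<Sum>i<M. f i (x (r n))) \<le> 1 - e" by blast
      qed
      then have "(\<Sum>i<M. ennreal (f i y)) \<le> ennreal (1 - e)" for M
        using f(2)[OF y(1)] by (simp add: sum_ennreal ennreal_leI)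
      then have "(\<Sum>i. ennreal (f i y)) \<le> ennreal (1 - e)"
        unfolding suminf_eq_SUP by (rule SUP_least)
      then have "ennreal 1 \<le> ennreal (1 - e)" using one[OF y(1)] order_trans by fastforce
      then show False using e by (simp add: ennreal_le_iff2)
    qed
    then obtain N where N: "\<And>x. x \<in> K \<Longrightarrow> 1 - e \<le> (\<Sum>i<N. f i x)" by blast
    have "(1 - e) * \<Lambda> (\<lambda>_. 1) \<le> \<Lambda> (\<lambda>x. \<Sum>i<N. f i x)"
      unfolding \<Lambda>_const[of "1 - e", symmetric] using N by (intro \<Lambda>_mono continuous_intros f)
    also have "\<dots> = (\<Sum>i<N. \<Lambda> (f i))" by (rule \<Lambda>_sum[OF f(1)])
    finally have "ennreal ((1 - e) * \<Lambda> (\<lambda>_. 1)) \<le> (\<Sum>i<N. ennreal (\<Lambda> (f i)))"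
      using \<Lambda>0 by (simp add: sum_ennreal ennreal_leI)
    also have "\<dots> \<le> (\<Sum>i. ennreal (\<Lambda> (f i)))" by (rule sum_le_suminf) auto
    finally show ?thesis .
  qed
  then have *: "ennreal ((1 - inverse (real (Suc n))) * \<Lambda> (\<lambda>_. 1)) \<le> (\<Sum>i. ennreal (\<Lambda> (f i)))" for n by simp
  have "(\<lambda>n. (1 - inverse (real (Suc n))) * \<Lambda> (\<lambda>_. 1)) \<longlonglongrightarrow> (1 - 0) * \<Lambda> (\<lambda>_. 1)"
    by (intro tendsto_intros LIMSEQ_inverse_real_of_nat)
  then have "(\<lambda>n. ennreal ((1 - inverse (real (Suc n))) * \<Lambda> (\<lambda>_. 1))) \<longlonglongrightarrow> ennreal (\<Lambda> (\<lambda>_. 1))"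
    by (intro tendsto_ennrealI) simp
  then show ?thesis by (rule LIMSEQ_le_const2) (use * in blast)
qed

lemma om_K: "om K = ennreal (\<Lambda> (\<lambda>_. 1))"
proof (rule antisym)
  show "om K \<le> ennreal (\<Lambda> (\<lambda>_. 1))" by (rule om_le_single) auto
  show "ennreal (\<Lambda> (\<lambda>_. 1)) \<le> om K"
    unfolding om_def
  proof (rule INF_greatest)
    fix f assume "f \<in> Collect (covers K)"
    then show "ennreal (\<Lambda> (\<lambda>_. 1)) \<le> (\<Sum>i. ennreal (\<Lambda> (f i)))"
      by (intro one_le_suminf_imp) (simp_all add: covers_def)
  qed
qed

lemma finite_measure_riesz: "finite_measure riesz_measure"
  using sets.top[of "restrict_space borel K"]
  by (intro finite_measureI) (simp add: emeasure_riesz om_K space_restrict_space)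

lemma measure_riesz_space: "measure riesz_measure K = \<Lambda> (\<lambda>_. 1)"
  using sets.top[of "restrict_space borel K"] \<Lambda>_nonneg[of "\<lambda>_. 1"]
  by (simp add: measure_def emeasure_riesz om_K space_restrict_space)

section \<open>Integration of continuous functions\<close>

lemma continuous_measurable:
  fixes f :: "'a \<Rightarrow> 'b::topological_space"
  assumes "continuous_on K f" shows "f \<in> borel_measurable riesz_measure"
  unfolding measurable_cong_sets[OF sets_riesz refl] by (rule borel_measurable_continuous_on_restrict[OF assms])

lemma continuous_integrable:
  fixes f :: "'a \<Rightarrow> real"
  assumes "continuous_on K f" shows "integrable riesz_measure f"
proof -
  obtain B where B: "\<And>x. x \<in> K \<Longrightarrow> norm (f x) \<le> B"
    using compact_imp_bounded[OF compact_continuous_image[OF assms K_compact]] by (auto simp: bounded_iff)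
  show ?thesis
    by (rule finite_measure.integrable_const_bound[OF finite_measure_riesz AE_I2 continuous_measurable[OF assms]])
      (use B in simp)
qed

text \<open>\<open>c k\<close> is the slice of \<open>f\<close> between the heights
  \<open>k * \<delta>\<close> and \<open>(k + 1) * \<delta>\<close>. On \<open>S\<close> the slice
  \<open>k\<close> has full height \<open>\<delta>\<close>, so \<open>\<Lambda> (c k)\<close> is at
  least \<open>\<delta>\<close> times the measure of \<open>S\<close>; the next slice vanishes off
  \<open>S\<close> and is at most \<open>\<delta>\<close>. The comparison costs a shift by one
  slice, and the third bound pays for the lowest one.\<close>

lemma integral_layer_le:
  assumes f: "continuous_on K f" "\<And>x. x \<in> K \<Longrightarrow> 0 \<le> f x" and \<delta>: "0 < \<delta>"
  defines "c \<equiv> \<lambda>k::nat. \<lambda>x. min (real (Suc k) * \<delta>) (f x) - min (real k * \<delta>) (f x)"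
  shows "continuous_on K (c k)" "(\<integral>x. c (Suc k) x \<partial>riesz_measure) \<le> \<Lambda> (c k)"
    "(\<integral>x. c k x \<partial>riesz_measure) \<le> \<delta> * \<Lambda> (\<lambda>_. 1)"
proof -
  interpret finite_measure riesz_measure by (rule finite_measure_riesz)
  show cc: "continuous_on K (c k)" for k unfolding c_def by (intro continuous_intros f)
  define S where "S = {x \<in> K. real (Suc k) * \<delta> \<le> f x}"
  have S: "S \<in> sets riesz_measure"
    using borel_measurable_le[OF _ continuous_measurable[OF f(1)], of "\<lambda>_. real (Suc k) * \<delta>"] by (simp add: S_def)
  have c0: "0 \<le> c k x" for k x using \<delta> by (auto simp: c_def min_def algebra_simps)
  have c1: "c k x \<le> \<delta>" for k x using \<delta> by (auto simp: c_def min_def algebra_simps)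
  have "om S \<le> ennreal (\<Lambda> (\<lambda>x. 1 / \<delta> * c k x))"
  proof (rule om_le_single)
    show "continuous_on K (\<lambda>x. 1 / \<delta> * c k x)" by (intro continuous_intros cc)
    show "0 \<le> 1 / \<delta> * c k x" for x using c0[of k x] \<delta> by simp
    show "1 \<le> 1 / \<delta> * c k x" if "x \<in> S" for x
      using that \<delta> by (simp add: S_def c_def min_def algebra_simps)
  qed
  then have "emeasure riesz_measure S \<le> ennreal (1 / \<delta> * \<Lambda> (c k))"
    using S by (simp add: emeasure_riesz \<Lambda>_cmult[OF cc, of "1 / \<delta>", simplified])
  then have mS: "\<delta> * measure riesz_measure S \<le> \<Lambda> (c k)"
    using \<Lambda>_nonneg[OF cc c0, of k] \<delta> by (simp add: emeasure_eq_measure field_simps)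
  have "(\<integral>x. c (Suc k) x \<partial>riesz_measure) \<le> (\<integral>x. \<delta> * indicator S x \<partial>riesz_measure)"
  proof (rule integral_mono)
    show "integrable riesz_measure (c (Suc k))" by (rule continuous_integrable[OF cc])
    show "integrable riesz_measure (\<lambda>x. \<delta> * indicator S x)"
      using S by (intro integrable_mult_right integrable_real_indicator) (auto simp: emeasure_eq_measure)
    show "c (Suc k) x \<le> \<delta> * indicator S x" if "x \<in> space riesz_measure" for x
    proof (cases "x \<in> S")
      case False
      then have "f x < real (Suc k) * \<delta>" using that by (simp add: S_def)
      moreover have "real (Suc k) * \<delta> \<le> real (Suc (Suc k)) * \<delta>" using \<delta> by (intro mult_right_mono) auto
      ultimately show ?thesis using False by (simp add: c_def min_def)
    qed (use c1 in simp)
  qed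
  moreover have "S \<inter> K = S" by (auto simp: S_def)
  ultimately show "(\<integral>x. c (Suc k) x \<partial>riesz_measure) \<le> \<Lambda> (c k)" using mS S by simp
  have "(\<integral>x. c k x \<partial>riesz_measure) \<le> (\<integral>x. \<delta> \<partial>riesz_measure)"
    using c1 by (intro integral_mono continuous_integrable[OF cc]) auto
  then show "(\<integral>x. c k x \<partial>riesz_measure) \<le> \<delta> * \<Lambda> (\<lambda>_. 1)"
    by (simp add: measure_riesz_space mult.commute)
qed

text \<open>All slices but the lowest are compared with \<open>\<Lambda>\<close> of their
  predecessors. The lowest costs \<open>\<delta> * \<Lambda> (\<lambda>_. 1)\<close>, which vanishes
  with \<open>\<delta>\<close>.\<close>

lemma integral_riesz_le:
  assumes f: "continuous_on K f" "\<And>x. x \<in> K \<Longrightarrow> 0 \<le> f x"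
  shows "(\<integral>x. f x \<partial>riesz_measure) \<le> \<Lambda> f"
proof -
  interpret finite_measure riesz_measure by (rule finite_measure_riesz)
  have *: "(\<integral>x. f x \<partial>riesz_measure) \<le> \<delta> * \<Lambda> (\<lambda>_. 1) + \<Lambda> f" if \<delta>: "0 < \<delta>" for \<delta>
  proof -
    obtain B where B: "\<And>x. x \<in> K \<Longrightarrow> norm (f x) \<le> B"
      using compact_imp_bounded[OF compact_continuous_image[OF f(1) K_compact]] by (auto simp: bounded_iff)
    \<comment> \<open>\<open>Suc N\<close> slices exhaust \<open>f\<close>; after the shift only the
      first \<open>N\<close> enter under \<open>\<Lambda>\<close>, and their sum is at most
      \<open>f\<close>.\<close>
    obtain N :: nat where N: "B < real N * \<delta>" using reals_Archimedean3[OF \<delta>] by blast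
    define c where "c k x = min (real (Suc k) * \<delta>) (f x) - min (real k * \<delta>) (f x)" for k x
    note c = integral_layer_le[OF f \<delta>, folded c_def]
    have tele: "(\<Sum>k<M. c k x) = min (real M * \<delta>) (f x)" if "x \<in> K" for x M
      unfolding c_def using f(2)[OF that] sum_lessThan_telescope[of "\<lambda>k. min (real k * \<delta>) (f x)" M] by simp
    have fN: "f x = (\<Sum>k<Suc N. c k x)" if "x \<in> K" for x
      using B[OF that] N f(2)[OF that] \<delta> unfolding tele[OF that] by (simp add: min_def algebra_simps)
    have "(\<integral>x. f x \<partial>riesz_measure) = (\<integral>x. (\<Sum>k<Suc N. c k x) \<partial>riesz_measure)"
      by (rule Bochner_Integration.integral_cong) (use fN in auto)
    also have "\<dots> = (\<Sum>k<Suc N. (\<integral>x. c k x \<partial>riesz_measure))"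
      by (rule Bochner_Integration.integral_sum) (rule continuous_integrable[OF c(1)])
    also have "\<dots> = (\<integral>x. c 0 x \<partial>riesz_measure) + (\<Sum>k<N. (\<integral>x. c (Suc k) x \<partial>riesz_measure))"
      by (rule sum.lessThan_Suc_shift)
    also have "\<dots> \<le> \<delta> * \<Lambda> (\<lambda>_. 1) + (\<Sum>k<N. \<Lambda> (c k))"
      by (intro add_mono c sum_mono)
    also have "(\<Sum>k<N. \<Lambda> (c k)) = \<Lambda> (\<lambda>x. \<Sum>k<N. c k x)" by (rule \<Lambda>_sum[symmetric, OF c(1)])
    also have "\<dots> \<le> \<Lambda> f"
    proof (intro \<Lambda>_mono continuous_on_sum c f)
      fix x assume "x \<in> K"
      from tele[OF this, of N] show "(\<Sum>k<N. c k x) \<le> f x" by linarith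
    qed
    finally show ?thesis by simp
  qed
  have "(\<lambda>n. inverse (real (Suc n)) * \<Lambda> (\<lambda>_. 1) + \<Lambda> f) \<longlonglongrightarrow> 0 * \<Lambda> (\<lambda>_. 1) + \<Lambda> f"
    by (intro tendsto_intros LIMSEQ_inverse_real_of_nat)
  then show ?thesis using * by (intro LIMSEQ_le_const[of _ "\<Lambda> f"]) auto
qed

text \<open>The one-sided bound is applied to the nonnegative functions \<open>f + B\<close> and
  \<open>B - f\<close>. The total mass is exactly \<open>\<Lambda> (\<lambda>_. 1)\<close>, so the
  terms with \<open>B\<close> cancel and both inequalities for \<open>f\<close> remain.\<close>

theorem integral_riesz:
  assumes f: "continuous_on K f"
  shows "(\<integral>x. f x \<partial>riesz_measure) = \<Lambda> f"
proof -
  interpret finite_measure riesz_measure by (rule finite_measure_riesz)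
  obtain B where B: "\<And>x. x \<in> K \<Longrightarrow> \<bar>f x\<bar> \<le> B"
    using compact_imp_bounded[OF compact_continuous_image[OF f K_compact]] by (auto simp: bounded_iff)
  have "(\<integral>x. f x + B \<partial>riesz_measure) \<le> \<Lambda> (\<lambda>x. f x + B)"
    by (rule integral_riesz_le) (use B f in \<open>auto intro!: continuous_intros simp: abs_le_iff\<close>, smt (verit) B)
  moreover have "(\<integral>x. B - f x \<partial>riesz_measure) \<le> \<Lambda> (\<lambda>x. B - f x)"
    by (rule integral_riesz_le) (use B f in \<open>auto intro!: continuous_intros simp: abs_le_iff\<close>)
  ultimately show ?thesis
    using continuous_integrable[OF f] \<Lambda>_const[of B]
    by (simp add: \<Lambda>_add \<Lambda>_diff f measure_riesz_space mult.commute)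
qed

end

section \<open>Uniqueness of measures and density of Lipschitz functions\<close>

lemma integral_scale_measure:
  fixes f :: "'a \<Rightarrow> 'b::{banach, second_countable_topology}"
  assumes "f \<in> borel_measurable M" "0 \<le> r"
  shows "integral\<^sup>L (scale_measure (ennreal r) M) f = r *\<^sub>R integral\<^sup>L M f"
proof -
  have "scale_measure (ennreal r) M = density M (\<lambda>_. ennreal r)"
    by (rule measure_eqI) (auto simp: emeasure_density_const)
  then show ?thesis using assms by (simp add: integral_density)
qed

lemma sets_restrict_closed:
  assumes "closed (K :: 'a::topological_space set)"
  shows "sets (restrict_space borel K) = sigma_sets K ((\<inter>) K ` Collect closed)"
proof -
  have "sets (borel :: 'a measure) = sigma_sets UNIV (Collect closed)"
    by (simp add: borel_eq_closed)
  moreover have "K \<in> sigma_sets UNIV (Collect closed)" using assms by auto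
  ultimately show ?thesis by (simp add: sets_restrict_space sigma_sets_Int)
qed

text \<open>Closed sets form a generator stable under intersection, and the indicator of a closed
  set is a limit of the Lipschitz functions \<open>max 0 (1 - k * infdist x F)\<close>. Lipschitz
  test functions are the ones on which an eigenmeasure can be computed directly.\<close>

lemma measure_eqI_lipschitz:
  fixes K :: "'a::metric_space set"
  assumes K: "closed K" and M: "finite_measure M" "sets M = sets (restrict_space borel K)"
    and N: "finite_measure N" "sets N = sets (restrict_space borel K)"
    and eq: "\<And>f C. C-lipschitz_on UNIV f \<Longrightarrow> (\<And>x. 0 \<le> f x \<and> f x \<le> 1) \<Longrightarrow> integral\<^sup>L M f = (integral\<^sup>L N f :: real)"
  shows "M = N"
proof (rule measure_eqI_generator_eq[where E = "(\<inter>) K ` Collect closed" and \<Omega> = K and A = "\<lambda>_. K"])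
  show "Int_stable ((\<inter>) K ` Collect closed)"
  proof (rule Int_stableI)
    fix a b assume "a \<in> (\<inter>) K ` Collect closed" "b \<in> (\<inter>) K ` Collect closed"
    then obtain F G where "closed F" "closed G" "a \<inter> b = K \<inter> (F \<inter> G)" by blast
    then show "a \<inter> b \<in> (\<inter>) K ` Collect closed" by blast
  qed
  show "sets M = sigma_sets K ((\<inter>) K ` Collect closed)" "sets N = sigma_sets K ((\<inter>) K ` Collect closed)"
    using M(2) N(2) sets_restrict_closed[OF K] by auto
  show "emeasure M (K) \<noteq> \<infinity>" using finite_measure.emeasure_finite[OF M(1)] by simp
  show "range (\<lambda>_. K) \<subseteq> (\<inter>) K ` Collect closed" using K by auto
  fix X assume "X \<in> (\<inter>) K ` Collect closed"
  then obtain F where F: "closed F" "X = K \<inter> F" by blast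
  define f where "f k x = max 0 (1 - real k * infdist x F)" for k x
  show "emeasure M X = emeasure N X"
  proof (cases "F = {}")
    case False
    have lim: "(\<lambda>k. f k x) \<longlonglongrightarrow> indicator F x" for x
    proof (cases "x \<in> F")
      case True then show ?thesis by (simp add: f_def)
    next
      case x: False
      then have "infdist x F \<noteq> 0" using in_closed_iff_infdist_zero[OF F(1) False] by simp
      then have pos: "0 < infdist x F" using infdist_nonneg[of x F] by linarith
      obtain k0 :: nat where k0: "1 < real k0 * infdist x F" using reals_Archimedean3[OF pos] by blast
      have "f k x = 0" if "k0 \<le> k" for k
      proof -
        have "real k0 * infdist x F \<le> real k * infdist x F" using that pos by (intro mult_right_mono) auto
        then show ?thesis using k0 by (simp add: f_def)
      qed
      then show ?thesis using x
        by (intro tendsto_eventually eventually_sequentiallyI[of k0]) auto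
    qed
    have lip: "(real k)-lipschitz_on UNIV (f k)" for k
    proof (rule lipschitz_onI)
      fix x y
      have "\<bar>f k x - f k y\<bar> \<le> \<bar>real k * infdist x F - real k * infdist y F\<bar>" by (auto simp: f_def)
      also have "\<dots> = real k * \<bar>infdist x F - infdist y F\<bar>" by (simp add: abs_mult right_diff_distrib[symmetric])
      also have "\<dots> \<le> real k * dist x y"
        using infdist_triangle[of x F y] infdist_triangle[of y F x] by (intro mult_left_mono) (auto simp: abs_le_iff dist_commute)
      finally show "dist (f k x) (f k y) \<le> real k * dist x y" by (simp add: dist_real_def)
    qed simp
    have conv: "(\<lambda>k. integral\<^sup>L P (f k)) \<longlonglongrightarrow> measure P X"
      if P: "finite_measure P" "sets P = sets (restrict_space borel K)" for P
    proof -
      interpret finite_measure P by fact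
      have sp: "space P = K" using sets_eq_imp_space_eq[OF P(2)] by (simp add: space_restrict_space)
      have "(\<lambda>k. integral\<^sup>L P (f k)) \<longlonglongrightarrow> integral\<^sup>L P (indicator F)"
      proof (rule integral_dominated_convergence[where w = "\<lambda>_. 1"])
        show "f k \<in> borel_measurable P" for k
          unfolding measurable_cong_sets[OF P(2) refl]
          by (intro borel_measurable_continuous_on_restrict lipschitz_on_continuous_on[OF lipschitz_on_subset[OF lip]]) auto
        show "(indicator F :: _ \<Rightarrow> real) \<in> borel_measurable P"
          unfolding measurable_cong_sets[OF P(2) refl] using F(1)
          by (intro measurable_restrict_space1 borel_measurable_indicator) auto
        show "AE x in P. norm (f k x) \<le> 1" for k by (rule AE_I2) (auto simp: f_def infdist_nonneg)
      qed (use lim in auto)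
      also have "integral\<^sup>L P (indicator F) = measure P (F \<inter> space P)" by simp
      finally show ?thesis using F(2) sp by (simp add: Int_commute)
    qed
    have "integral\<^sup>L M (f k) = integral\<^sup>L N (f k)" for k
      by (rule eq[OF lip]) (auto simp: f_def infdist_nonneg)
    then have "measure M X = measure N X"
      using LIMSEQ_unique[OF conv[OF M]] conv[OF N] by simp
    then show ?thesis
      using finite_measure.emeasure_eq_measure[OF M(1)] finite_measure.emeasure_eq_measure[OF N(1)] by simp
  qed (use F in simp)
qed auto

text \<open>Stone-Weierstrass gives polynomials, and these are Lipschitz on bounded sets. Carrying
  one constant for both size and slope makes the induction over sums and products close.\<close>

lemma lipschitz_approximation:
  fixes f :: "'a::euclidean_space \<Rightarrow> real"
  assumes K: "compact K" and f: "continuous_on K f" and e: "0 < e"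
  shows "\<exists>g B. (\<forall>x\<in>K. \<bar>f x - g x\<bar> < e) \<and> (\<forall>x\<in>K. \<bar>g x\<bar> \<le> B) \<and> (\<forall>x\<in>K. \<forall>y\<in>K. \<bar>g x - g y\<bar> \<le> B * norm (x - y))"
proof -
  obtain R where R: "\<And>x. x \<in> K \<Longrightarrow> norm x \<le> R" using compact_imp_bounded[OF K] by (auto simp: bounded_iff)
  obtain g where g: "real_polynomial_function g" "\<And>x. x \<in> K \<Longrightarrow> \<bar>f x - g x\<bar> < e"
    using Stone_Weierstrass_real_polynomial_function[OF K f e] by blast
  have "\<exists>B\<ge>0. (\<forall>x\<in>K. \<bar>g x\<bar> \<le> B) \<and> (\<forall>x\<in>K. \<forall>y\<in>K. \<bar>g x - g y\<bar> \<le> B * norm (x - y))"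
    using g(1)
  proof induction
    case (linear h)
    then interpret bounded_linear h .
    obtain C where C: "0 \<le> C" "\<And>x. norm (h x) \<le> norm x * C" using nonneg_bounded by blast
    have "\<bar>h x\<bar> \<le> C * \<bar>R\<bar> + C" if "x \<in> K" for x
    proof -
      have "\<bar>h x\<bar> \<le> norm x * C" using C(2)[of x] by simp
      also have "\<dots> \<le> \<bar>R\<bar> * C" using R[OF that] C(1) by (intro mult_right_mono) auto
      finally show ?thesis using C(1) by (simp add: mult.commute)
    qed
    moreover have "\<bar>h x - h y\<bar> \<le> (C * \<bar>R\<bar> + C) * norm (x - y)" for x y
    proof -
      have "\<bar>h x - h y\<bar> \<le> C * norm (x - y)" using C(2)[of "x - y"] by (simp add: diff mult.commute)
      also have "\<dots> \<le> (C * \<bar>R\<bar> + C) * norm (x - y)" using C(1) by (intro mult_right_mono) auto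
      finally show ?thesis .
    qed
    ultimately show ?case using C(1) by (intro exI[of _ "C * \<bar>R\<bar> + C"]) auto
  next
    case (const c)
    then show ?case by (intro exI[of _ "\<bar>c\<bar>"]) auto
  next
    case (add p q)
    then obtain B B' where B: "0 \<le> B" "\<And>x. x \<in> K \<Longrightarrow> \<bar>p x\<bar> \<le> B" "\<And>x y. x \<in> K \<Longrightarrow> y \<in> K \<Longrightarrow> \<bar>p x - p y\<bar> \<le> B * norm (x - y)"
      and B': "0 \<le> B'" "\<And>x. x \<in> K \<Longrightarrow> \<bar>q x\<bar> \<le> B'" "\<And>x y. x \<in> K \<Longrightarrow> y \<in> K \<Longrightarrow> \<bar>q x - q y\<bar> \<le> B' * norm (x - y)"
      by blast
    have "\<bar>p x + q x\<bar> \<le> B + B'" if "x \<in> K" for x using B(2)[OF that] B'(2)[OF that] by linarith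
    moreover have "\<bar>p x + q x - (p y + q y)\<bar> \<le> (B + B') * norm (x - y)" if "x \<in> K" "y \<in> K" for x y
      using B(3)[OF that] B'(3)[OF that] by (simp add: distrib_right)
    ultimately show ?case using B(1) B'(1) by (intro exI[of _ "B + B'"]) auto
  next
    case (mult p q)
    then obtain B B' where B: "0 \<le> B" "\<And>x. x \<in> K \<Longrightarrow> \<bar>p x\<bar> \<le> B" "\<And>x y. x \<in> K \<Longrightarrow> y \<in> K \<Longrightarrow> \<bar>p x - p y\<bar> \<le> B * norm (x - y)"
      and B': "0 \<le> B'" "\<And>x. x \<in> K \<Longrightarrow> \<bar>q x\<bar> \<le> B'" "\<And>x y. x \<in> K \<Longrightarrow> y \<in> K \<Longrightarrow> \<bar>q x - q y\<bar> \<le> B' * norm (x - y)"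
      by blast
    have BB: "0 \<le> B * B'" using B(1) B'(1) by simp
    have "\<bar>p x * q x\<bar> \<le> 2 * (B * B')" if "x \<in> K" for x
      using mult_mono[OF B(2)[OF that] B'(2)[OF that] B(1)] BB by (simp add: abs_mult)
    moreover have "\<bar>p x * q x - p y * q y\<bar> \<le> 2 * (B * B') * norm (x - y)" if "x \<in> K" "y \<in> K" for x y
    proof -
      have "p x * q x - p y * q y = p x * (q x - q y) + (p x - p y) * q y" by (simp add: algebra_simps)
      moreover have "\<bar>p x * (q x - q y)\<bar> \<le> B * (B' * norm (x - y))"
        unfolding abs_mult using B(1) B(2)[OF that(1)] B'(3)[OF that] by (intro mult_mono) auto
      moreover have "\<bar>(p x - p y) * q y\<bar> \<le> (B * norm (x - y)) * B'"
        unfolding abs_mult using B(1) B(3)[OF that] B'(2)[OF that(2)] by (intro mult_mono) auto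
      ultimately have "\<bar>p x * q x - p y * q y\<bar> \<le> B * (B' * norm (x - y)) + (B * norm (x - y)) * B'" by linarith
      then show ?thesis by (simp add: algebra_simps)
    qed
    ultimately show ?case using BB by (intro exI[of _ "2 * (B * B')"]) auto
  qed
  then show ?thesis using g(2) by blast
qed

section \<open>Spectral gap from exponential convergence\<close>

lemma vector_space_cscale: "vector_space cscale"
  by unfold_locales (auto simp: cscale_def fun_eq_iff algebra_simps)

text \<open>Completeness is stated for absolutely summable series, the form needed for the Neumann
  series. \<open>norm_le_N\<close> makes norm limits pointwise limits, so operator identities can be
  checked point by point.\<close>

locale spectral_gap =
  fixes X :: "('a \<Rightarrow> complex) set" and N :: "('a \<Rightarrow> complex) \<Rightarrow> real"
    and T :: "('a \<Rightarrow> complex) \<Rightarrow> 'a \<Rightarrow> complex" and h :: "'a \<Rightarrow> complex"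
    and \<Lambda> :: "('a \<Rightarrow> complex) \<Rightarrow> complex" and lam r C A :: real
  assumes X_add: "\<And>f g. f \<in> X \<Longrightarrow> g \<in> X \<Longrightarrow> f + g \<in> X"
    and X_cscale: "\<And>f c. f \<in> X \<Longrightarrow> cscale c f \<in> X"
    and N_triangle: "\<And>f g. f \<in> X \<Longrightarrow> g \<in> X \<Longrightarrow> N (f + g) \<le> N f + N g"
    and N_cscale: "\<And>f c. f \<in> X \<Longrightarrow> N (cscale c f) = cmod c * N f"
    and norm_le_N: "\<And>f x. f \<in> X \<Longrightarrow> cmod (f x) \<le> N f"
    and complete: "\<And>u. (\<And>k. u k \<in> X) \<Longrightarrow> summable (\<lambda>k. N (u k)) \<Longrightarrow>
      \<exists>v\<in>X. (\<lambda>n. N (v - (\<Sum>k<n. u k))) \<longlonglongrightarrow> 0"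
    and T_bounded: "bounded_operator X N T"
    and h_in: "h \<in> X" and T_h: "T h = cscale lam h"
    and \<Lambda>_add: "\<And>f g. f \<in> X \<Longrightarrow> g \<in> X \<Longrightarrow> \<Lambda> (f + g) = \<Lambda> f + \<Lambda> g"
    and \<Lambda>_cscale: "\<And>f c. f \<in> X \<Longrightarrow> \<Lambda> (cscale c f) = c * \<Lambda> f"
    and \<Lambda>_T: "\<And>f. f \<in> X \<Longrightarrow> \<Lambda> (T f) = lam * \<Lambda> f"
    and \<Lambda>_le: "\<And>f. f \<in> X \<Longrightarrow> cmod (\<Lambda> f) \<le> A * N f"
    and \<Lambda>_h: "\<Lambda> h = 1"
    and r_nonneg: "0 \<le> r" and r_less: "r < lam"
    and gap: "\<And>f n. f \<in> X \<Longrightarrow> N ((T ^^ n) f - cscale (lam ^ n * \<Lambda> f) h) \<le> C * r ^ n * N f"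
begin

lemma T_in: "f \<in> X \<Longrightarrow> T f \<in> X"
  and T_add: "f \<in> X \<Longrightarrow> g \<in> X \<Longrightarrow> T (f + g) = T f + T g"
  and T_cscale: "f \<in> X \<Longrightarrow> T (cscale c f) = cscale c (T f)"
  using T_bounded by (auto simp: bounded_operator_def)

lemma X_zero: "0 \<in> X"
  using X_cscale[OF h_in, of 0] by (simp add: cscale_def zero_fun_def)

lemma X_diff: "f \<in> X \<Longrightarrow> g \<in> X \<Longrightarrow> f - g \<in> X"
  using X_add[of f "cscale (-1) g"] X_cscale[of g "-1"] by (simp add: cscale_def fun_diff_def plus_fun_def)

lemma T_zero: "T 0 = 0"
  using T_cscale[OF X_zero, of 0] by (simp add: cscale_def zero_fun_def)

lemma T_diff: "f \<in> X \<Longrightarrow> g \<in> X \<Longrightarrow> T (f - g) = T f - T g"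
  using T_add[of f "cscale (-1) g"] T_cscale[of g "-1"] X_cscale[of g "-1"]
  by (simp add: cscale_def fun_diff_def plus_fun_def)

lemma \<Lambda>_diff: "f \<in> X \<Longrightarrow> g \<in> X \<Longrightarrow> \<Lambda> (f - g) = \<Lambda> f - \<Lambda> g"
  using \<Lambda>_add[of f "cscale (-1) g"] \<Lambda>_cscale[of g "-1"] X_cscale[of g "-1"]
  by (simp add: cscale_def fun_diff_def plus_fun_def)

lemma X_sum: "(\<And>k. u k \<in> X) \<Longrightarrow> (\<Sum>k<n::nat. u k) \<in> X"
  by (induction n) (auto simp: X_zero X_add)

lemma T_sum: "(\<And>k. u k \<in> X) \<Longrightarrow> T (\<Sum>k<n::nat. u k) = (\<Sum>k<n. T (u k))"
  by (induction n) (auto simp: T_zero T_add X_sum)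

lemma N_nonneg: "f \<in> X \<Longrightarrow> 0 \<le> N f"
  using norm_le_N norm_ge_zero order_trans by blast

lemma N_sum: "(\<And>k. u k \<in> X) \<Longrightarrow> N (\<Sum>k<n::nat. u k) \<le> (\<Sum>k<n. N (u k))"
proof (induction n)
  case 0
  have "N (cscale 0 h) = 0" using N_cscale[OF h_in, of 0] by simp
  then show ?case by (simp add: cscale_def zero_fun_def)
next
  case (Suc n)
  then show ?case
    unfolding sum.lessThan_Suc using N_triangle[OF X_sum[of u n, OF Suc.prems] Suc.prems[of n]] Suc.IH[OF Suc.prems]
    by linarith
qed

lemma lam_pos: "0 < lam" using r_nonneg r_less by linarith

text \<open>With the projection \<open>P f = cscale (\<Lambda> f) h\<close> this is
  \<open>T ^^ n\<close> applied to \<open>f - P f\<close>; for \<open>n = 0\<close> it is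
  \<open>f - P f\<close> itself.\<close>

definition Q :: "nat \<Rightarrow> ('a \<Rightarrow> complex) \<Rightarrow> 'a \<Rightarrow> complex" where
  "Q n f = (T ^^ n) f - cscale (lam ^ n * \<Lambda> f) h"

lemma T_funpow_in: "f \<in> X \<Longrightarrow> (T ^^ n) f \<in> X"
  by (induction n) (auto simp: T_in)

lemma Q_in: "f \<in> X \<Longrightarrow> Q n f \<in> X"
  unfolding Q_def by (intro X_diff T_funpow_in X_cscale h_in)

lemma T_Q: "f \<in> X \<Longrightarrow> T (Q n f) = Q (Suc n) f"
  by (simp add: Q_def T_diff T_funpow_in X_cscale h_in T_cscale T_h)
    (simp add: cscale_def mult_ac)

lemma Q_T: "f \<in> X \<Longrightarrow> Q n (T f) = Q (Suc n) f"
  by (simp add: Q_def \<Lambda>_T funpow_swap1 mult_ac)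

section \<open>Simplicity of the leading eigenvalue\<close>

lemma eigenvalue: "op_eigenvalue X T (of_real lam)"
  unfolding op_eigenvalue_def
proof (rule bexI[OF _ h_in], intro conjI)
  show "h \<noteq> 0"
  proof
    assume "h = 0"
    then have "\<Lambda> h = 0" using \<Lambda>_cscale[OF h_in, of 0] by (simp add: cscale_def zero_fun_def)
    then show False using \<Lambda>_h by simp
  qed
qed (rule T_h)

text \<open>On the kernel of \<open>\<Lambda>\<close> the iterates grow at most like
  \<open>r ^ n\<close>, while those of an eigenvector grow like \<open>lam ^ n\<close>.\<close>

lemma eigen_zero:
  assumes q: "q \<in> X" "\<Lambda> q = 0" "T q = cscale lam q"
  shows "q = 0"
proof
  fix x
  have Tn: "(T ^^ n) q = cscale (lam ^ n) q" for n
    by (induction n) (simp_all add: T_cscale q, simp_all add: cscale_def mult_ac)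
  have "N q \<le> C * (r / lam) ^ n * N q" for n
  proof -
    have "(T ^^ n) q - cscale (lam ^ n * \<Lambda> q) h = cscale (lam ^ n) q"
      by (simp add: q Tn) (simp add: cscale_def fun_eq_iff)
    then have "lam ^ n * N q \<le> C * r ^ n * N q"
      using gap[OF q(1), of n] lam_pos by (simp add: N_cscale q(1) norm_power)
    then show ?thesis using lam_pos by (simp add: power_divide field_simps)
  qed
  moreover have "(\<lambda>n. C * (r / lam) ^ n * N q) \<longlonglongrightarrow> C * 0 * N q"
    using r_nonneg r_less lam_pos by (intro tendsto_intros LIMSEQ_power_zero) (simp add: field_simps)
  ultimately have "N q \<le> 0" by (intro LIMSEQ_le_const[of _ 0]) auto
  then have "cmod (q x) \<le> 0" using norm_le_N[OF q(1), of x] by linarith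
  then show "q x = 0 x" by simp
qed

text \<open>\<open>T - lam\<close> preserves the kernel of \<open>\<Lambda>\<close> and is injective
  there by \<open>eigen_zero\<close>; hence so are its powers.\<close>

lemma gen_eigen_zero:
  "q \<in> X \<Longrightarrow> \<Lambda> q = 0 \<Longrightarrow> ((\<lambda>g. T g - cscale lam g) ^^ k) q = 0 \<Longrightarrow> q = 0"
proof (induction k arbitrary: q)
  case (Suc k)
  let ?p = "T q - cscale lam q"
  have "((\<lambda>g. T g - cscale lam g) ^^ k) ?p = 0" using Suc.prems(3) unfolding funpow_Suc_right o_apply .
  moreover have "?p \<in> X" by (intro X_diff T_in X_cscale Suc.prems)
  moreover have "\<Lambda> ?p = 0" by (simp add: \<Lambda>_diff T_in X_cscale Suc.prems \<Lambda>_T \<Lambda>_cscale)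
  ultimately have "?p = 0" using Suc.IH[of ?p] by blast
  then have "T q = cscale lam q" by (simp only: right_minus_eq)
  then show ?case by (rule eigen_zero[OF Suc.prems(1,2)])
qed simp

lemma gen_eigenspace_eq: "gen_eigenspace X T (of_real lam) = {cscale a h |a. True}"
proof (intro equalityI subsetI)
  fix f assume "f \<in> gen_eigenspace X T (of_real lam)"
  then obtain k where f: "f \<in> X" and k: "((\<lambda>g. T g - cscale lam g) ^^ k) f = 0"
    by (auto simp: gen_eigenspace_def)
  let ?D = "\<lambda>g. T g - cscale lam g"
  let ?q = "f - cscale (\<Lambda> f) h"
  have D: "?D g \<in> X" "?D (g - cscale a h) = ?D g" if "g \<in> X" for g a
  proof -
    show "?D g \<in> X" by (intro X_diff T_in X_cscale that)
    show "?D (g - cscale a h) = ?D g"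
      by (simp add: T_diff that X_cscale h_in T_cscale T_h) (simp add: cscale_def fun_eq_iff algebra_simps)
  qed
  have q: "?q \<in> X" by (intro X_diff f X_cscale h_in)
  have "(?D ^^ k) ?q = 0"
  proof (cases k)
    case 0
    then have f0: "f = 0" using k by simp
    then have "cscale 0 f = f" by (simp add: cscale_def fun_eq_iff)
    then have "\<Lambda> f = 0" using \<Lambda>_cscale[OF f, of 0] by simp
    then show ?thesis unfolding 0 f0 by (simp add: cscale_def fun_eq_iff f0)
  next
    case (Suc m)
    have "(?D ^^ k) ?q = (?D ^^ m) (?D ?q)" by (simp only: Suc funpow_Suc_right o_apply)
    also have "\<dots> = (?D ^^ m) (?D f)" by (simp only: D(2)[OF f])
    also have "\<dots> = (?D ^^ k) f" by (simp only: Suc funpow_Suc_right o_apply)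
    finally show ?thesis using k by simp
  qed
  moreover have "\<Lambda> ?q = 0" by (simp add: \<Lambda>_diff f X_cscale h_in \<Lambda>_cscale \<Lambda>_h)
  ultimately have "?q = 0" using gen_eigen_zero[OF q] by blast
  then have "f = cscale (\<Lambda> f) h" by simp
  then show "f \<in> {cscale a h |a. True}" by blast
next
  fix f assume "f \<in> {cscale a h |a. True}"
  then obtain a where f: "f = cscale a h" by blast
  have "T f - cscale lam f = 0"
    by (simp add: f T_cscale h_in T_h) (simp add: cscale_def fun_eq_iff)
  then show "f \<in> gen_eigenspace X T (of_real lam)"
    using X_cscale[OF h_in, of a] by (auto simp: gen_eigenspace_def f intro!: exI[of _ 1])
qed

lemma eigenvector_unique:
  assumes "f \<in> X" "T f = cscale lam f" shows "f = cscale (\<Lambda> f) h"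
proof -
  have "f - cscale (\<Lambda> f) h = 0"
  proof (rule eigen_zero)
    show "T (f - cscale (\<Lambda> f) h) = cscale lam (f - cscale (\<Lambda> f) h)"
      by (simp add: T_diff T_cscale T_h X_cscale h_in assms) (simp add: cscale_def fun_eq_iff algebra_simps)
  qed (simp_all add: X_diff X_cscale h_in assms \<Lambda>_diff \<Lambda>_cscale \<Lambda>_h)
  then show ?thesis by simp
qed

lemma multiplicity: "multiplicity_of X T (of_real lam) = 1"
proof -
  interpret vector_space cscale by (rule vector_space_cscale)
  have h0: "h \<noteq> 0"
  proof
    assume "h = 0"
    then have "\<Lambda> h = 0" using \<Lambda>_cscale[OF h_in, of 0] by (simp add: cscale_def zero_fun_def)
    then show False using \<Lambda>_h by simp
  qed
  have "gen_eigenspace X T (of_real lam) = span {h}"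
    unfolding gen_eigenspace_eq span_singleton by auto
  moreover have "dim (span {h}) = card {h}"
    using h0 by (intro dim_span_eq_card_independent) (simp add: dependent_single)
  ultimately show ?thesis by (simp add: multiplicity_of_def)
qed

text \<open>The resolvent acts on \<open>h\<close> as the scalar \<open>1 / (z - lam)\<close>, and
  on the kernel of \<open>\<Lambda>\<close> as a Neumann series, which converges because
  \<open>r < cmod z\<close>.\<close>

theorem spectrum_subset: "op_spectrum X N T - {of_real lam} \<subseteq> cball 0 r"
proof (rule subsetI, rule ccontr)
  fix z assume zs: "z \<in> op_spectrum X N T - {of_real lam}" and "z \<notin> cball 0 r"
  then have zr: "r < cmod z" and zlam: "z \<noteq> of_real lam" by auto
  have z0: "z \<noteq> 0" using zr r_nonneg by auto
  have cz: "0 < cmod z" using z0 by simp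
  define t where "t = r / cmod z"
  have t: "0 \<le> t" "t < 1" using r_nonneg zr cz by (auto simp: t_def)
  \<comment> \<open>Terms of the Neumann series for the part of \<open>f\<close> in the kernel of
    \<open>\<Lambda>\<close>.\<close>
  define u where "u f n = cscale (1 / z ^ Suc n) (Q n f)" for f n
  have u_in: "u f n \<in> X" if "f \<in> X" for f n
    unfolding u_def by (intro X_cscale Q_in that)
  have Q_le: "N (Q n f) \<le> C * r ^ n * N f" if "f \<in> X" for f n
    using gap[OF that] by (simp add: Q_def)
  have u_le: "N (u f n) \<le> C / cmod z * N f * t ^ n" if "f \<in> X" for f n
  proof -
    have "N (u f n) = N (Q n f) / cmod z ^ Suc n"
      by (simp add: u_def N_cscale Q_in that norm_divide norm_mult norm_power)
    also have "\<dots> \<le> (C * r ^ n * N f) / cmod z ^ Suc n"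
      using cz by (intro divide_right_mono Q_le that) auto
    also have "\<dots> = C / cmod z * N f * t ^ n" by (simp add: t_def power_divide)
    finally show ?thesis .
  qed
  have geo: "summable (\<lambda>n. C / cmod z * N f * t ^ n)" for f
    using t by (intro summable_mult summable_geometric) auto
  have u_summable: "summable (\<lambda>n. N (u f n))" if "f \<in> X" for f
    by (rule summable_comparison_test'[OF geo, of 0]) (use u_le[OF that] N_nonneg[OF u_in[OF that]] in auto)
  have "\<forall>f\<in>X. \<exists>v\<in>X. (\<lambda>n. N (v - (\<Sum>k<n. u f k))) \<longlonglongrightarrow> 0"
    using complete[OF u_in u_summable] by blast
  then obtain R where R_in: "\<And>f. f \<in> X \<Longrightarrow> R f \<in> X"
    and R_lim: "\<And>f. f \<in> X \<Longrightarrow> (\<lambda>n. N (R f - (\<Sum>k<n. u f k))) \<longlonglongrightarrow> 0" by metis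
  have sum_apply: "(\<Sum>k<n. v k) x = (\<Sum>k<n. v k x)" for n x and v :: "nat \<Rightarrow> 'a \<Rightarrow> complex"
    by (induction n) (auto simp: zero_fun_def plus_fun_def)
  have lim_pt: "(\<lambda>n. F n x) \<longlonglongrightarrow> v x"
    if "v \<in> X" "\<And>n. F n \<in> X" "(\<lambda>n. N (v - F n)) \<longlonglongrightarrow> 0" for v F and x :: 'a
  proof -
    have "(\<lambda>n. v x - F n x) \<longlonglongrightarrow> 0"
      by (rule Lim_null_comparison[OF _ that(3)])
        (use norm_le_N[where x = x, OF X_diff[OF that(1,2)]] in \<open>auto simp: fun_diff_def\<close>)
    from tendsto_diff[OF tendsto_const[of "v x"] this] show ?thesis by simp
  qed
  \<comment> \<open>\<open>R\<close> comes from a choice of limits, so its linearity is recovered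
    from uniqueness of the pointwise sums.\<close>
  have R_sums: "(\<lambda>n. u f n x) sums R f x" if "f \<in> X" for f x
    using lim_pt[where x = x, OF R_in[OF that] X_sum[OF u_in[OF that]] R_lim[OF that]]
    by (simp add: sums_def sum_apply)
  have R_N: "N (R f) \<le> C / cmod z / (1 - t) * N f" if f: "f \<in> X" for f
  proof -
    have "N (R f) \<le> N (R f - (\<Sum>k<n. u f k)) + C / cmod z / (1 - t) * N f" for n
    proof -
      have P: "(\<Sum>k<n. u f k) \<in> X" by (rule X_sum[OF u_in[OF f]])
      have "N (\<Sum>k<n. u f k) \<le> (\<Sum>k<n. N (u f k))" by (rule N_sum[OF u_in[OF f]])
      also have "\<dots> \<le> (\<Sum>n. N (u f n))"
        by (rule sum_le_suminf[OF u_summable[OF f]]) (auto simp: N_nonneg u_in f)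
      also have "\<dots> \<le> (\<Sum>n. C / cmod z * N f * t ^ n)"
        by (rule suminf_le[OF u_le[OF f] u_summable[OF f] geo])
      also have "\<dots> = C / cmod z / (1 - t) * N f"
        using t by (subst suminf_mult) (auto simp: suminf_geometric summable_geometric)
      finally have "N (\<Sum>k<n. u f k) \<le> C / cmod z / (1 - t) * N f" .
      then show ?thesis
        using N_triangle[OF X_diff[OF R_in[OF f] P] P] by simp
    qed
    then show ?thesis
      using LIMSEQ_le_const[OF tendsto_add[OF R_lim[OF f] tendsto_const[of "C / cmod z / (1 - t) * N f"]]] by auto
  qed
  define S where "S f = cscale (\<Lambda> f / (z - lam)) h + R f" for f
  have zl: "z - lam \<noteq> 0" using zlam by simp
  have Q_add: "Q n (f + g) = Q n f + Q n g" if "f \<in> X" "g \<in> X" for f g n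
  proof -
    have "(T ^^ n) (f + g) = (T ^^ n) f + (T ^^ n) g"
      by (induction n) (simp_all only: funpow.simps o_apply id_apply T_add T_funpow_in that)
    then show ?thesis by (simp add: Q_def \<Lambda>_add that) (simp add: cscale_def fun_eq_iff algebra_simps)
  qed
  have Q_cscale: "Q n (cscale c f) = cscale c (Q n f)" if "f \<in> X" for f n c
  proof -
    have "(T ^^ n) (cscale c f) = cscale c ((T ^^ n) f)"
      by (induction n) (simp_all only: funpow.simps o_apply id_apply T_cscale T_funpow_in that)
    then show ?thesis by (simp add: Q_def \<Lambda>_cscale that) (simp add: cscale_def fun_eq_iff algebra_simps)
  qed
  have R_add: "R (f + g) = R f + R g" if f: "f \<in> X" and g: "g \<in> X" for f g
  proof
    fix x
    have "(\<lambda>n. u (f + g) n x) sums (R f x + R g x)"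
      using sums_add[OF R_sums[where x = x, OF f] R_sums[where x = x, OF g]]
      by (simp add: u_def Q_add f g) (simp add: cscale_def algebra_simps add_divide_distrib)
    then show "R (f + g) x = (R f + R g) x" using sums_unique2[OF R_sums[OF X_add[OF f g]]] by simp
  qed
  have R_cscale: "R (cscale c f) = cscale c (R f)" if f: "f \<in> X" for f c
  proof
    fix x
    have "(\<lambda>n. u (cscale c f) n x) sums (c * R f x)"
      using sums_mult[OF R_sums[where x = x, OF f], of c]
      by (simp add: u_def Q_cscale f) (simp add: cscale_def algebra_simps)
    then show "R (cscale c f) x = cscale c (R f) x"
      using sums_unique2[OF R_sums[OF X_cscale[OF f]]] by (simp add: cscale_def)
  qed
  have bounded: "bounded_operator X N S"
    unfolding bounded_operator_def
  proof (intro conjI ballI allI)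
    fix f assume f: "f \<in> X"
    show "S f \<in> X" unfolding S_def by (intro X_add X_cscale h_in R_in f)
    show "S (cscale c f) = cscale c (S f)" for c
      by (simp add: S_def R_cscale f \<Lambda>_cscale) (simp add: cscale_def fun_eq_iff algebra_simps)
    fix g assume g: "g \<in> X"
    show "S (f + g) = S f + S g"
      by (simp add: S_def R_add f g \<Lambda>_add) (simp add: cscale_def fun_eq_iff algebra_simps add_divide_distrib)
  next
    have "N (S f) \<le> (A / cmod (z - lam) * N h + C / cmod z / (1 - t)) * N f" if f: "f \<in> X" for f
    proof -
      have "N (S f) \<le> N (cscale (\<Lambda> f / (z - lam)) h) + N (R f)"
        unfolding S_def by (intro N_triangle X_cscale h_in R_in f)
      also have "N (cscale (\<Lambda> f / (z - lam)) h) = cmod (\<Lambda> f) / cmod (z - lam) * N h"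
        by (simp add: N_cscale h_in norm_divide)
      also have "\<dots> \<le> A * N f / cmod (z - lam) * N h"
        using N_nonneg[OF h_in] by (intro mult_right_mono divide_right_mono \<Lambda>_le f) auto
      finally show ?thesis using R_N[OF f] by (simp add: algebra_simps)
    qed
    then show "\<exists>K. \<forall>f\<in>X. N (S f) \<le> K * N f" by blast
  qed
  have S_add: "S (f + g) = S f + S g" if "f \<in> X" "g \<in> X" for f g
    using bounded that unfolding bounded_operator_def by blast
  have S_cscale: "S (cscale c f) = cscale c (S f)" if "f \<in> X" for f c
    using bounded that unfolding bounded_operator_def by blast
  have left: "S (cscale z f - T f) = f" if f: "f \<in> X" for f
  proof
    fix x
    let ?g = "cscale z f - T f"
    have g: "?g \<in> X" by (intro X_diff X_cscale T_in f)
    have lg: "\<Lambda> ?g = (z - lam) * \<Lambda> f"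
      by (simp add: \<Lambda>_diff X_cscale T_in f \<Lambda>_cscale \<Lambda>_T algebra_simps)
    \<comment> \<open>The series for \<open>cscale z f - T f\<close> telescopes to
      \<open>a 0 = f x - \<Lambda> f * h x\<close>; the rank one term of \<open>S\<close> restores
      the missing multiple of \<open>h x\<close>.\<close>
    define a where "a n = Q n f x / z ^ n" for n
    have "u ?g n x = a n - a (Suc n)" for n
    proof -
      have "Q n ?g = cscale z (Q n f) - Q (Suc n) f"
      proof -
        have "Q n ?g = Q n (cscale z f + cscale (-1) (T f))"
          by (rule arg_cong[of _ _ "Q n"]) (simp add: cscale_def fun_eq_iff)
        also have "\<dots> = cscale z (Q n f) + cscale (-1) (Q (Suc n) f)"
          by (simp add: Q_add Q_cscale X_cscale T_in f Q_T)
        finally show ?thesis by (simp add: cscale_def fun_eq_iff)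
      qed
      from fun_cong[OF this, of x] have "Q n ?g x = z * Q n f x - Q (Suc n) f x"
        by (simp add: cscale_def)
      then have "u ?g n x = (z * Q n f x - Q (Suc n) f x) / z ^ Suc n"
        unfolding u_def by (simp add: cscale_def)
      then show ?thesis using z0 by (simp add: a_def diff_divide_distrib)
    qed
    moreover have "a \<longlonglongrightarrow> 0"
    proof (rule Lim_null_comparison)
      show "(\<lambda>n. C * N f * t ^ n) \<longlonglongrightarrow> 0"
        using tendsto_mult[OF tendsto_const LIMSEQ_power_zero[of t], of "C * N f"] t by simp
      have "cmod (a n) \<le> C * N f * t ^ n" for n
      proof -
        have "cmod (a n) \<le> (C * r ^ n * N f) / cmod z ^ n"
          unfolding a_def norm_divide norm_power
          using cz by (intro divide_right_mono order_trans[OF norm_le_N[OF Q_in[OF f]] Q_le[OF f]]) auto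
        then show ?thesis by (simp add: t_def power_divide mult_ac)
      qed
      then show "\<forall>\<^sub>F n in sequentially. norm (a n) \<le> C * N f * t ^ n" by simp
    qed
    ultimately have "(\<lambda>n. u ?g n x) sums (a 0 - 0)"
      using telescope_sums'[of a 0] by simp
    then have "R ?g x = a 0" using sums_unique2[OF R_sums[OF g]] by simp
    then show "S ?g x = f x"
      using zl unfolding S_def lg by (simp add: a_def Q_def cscale_def)
  qed
  have right: "cscale z (S f) - T (S f) = f" if f: "f \<in> X" for f
  proof -
    \<comment> \<open>Boundedness of \<open>T\<close> lets it pass through the series. Then
      \<open>T\<close> commutes with \<open>S\<close>, and the right inverse follows from the left
      one.\<close>
    have TR: "T (R f) = R (T f)"
    proof
      fix x
      obtain K where "\<forall>g\<in>X. N (T g) \<le> K * N g"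
        using T_bounded unfolding bounded_operator_def by blast
      then have K: "g \<in> X \<Longrightarrow> N (T g) \<le> K * N g" for g by blast
      have P: "(\<Sum>k<n. u f k) \<in> X" for n by (rule X_sum[OF u_in[OF f]])
      have "(\<lambda>n. N (T (R f) - T (\<Sum>k<n. u f k))) \<longlonglongrightarrow> 0"
      proof (rule Lim_null_comparison)
        show "(\<lambda>n. K * N (R f - (\<Sum>k<n. u f k))) \<longlonglongrightarrow> 0"
          using tendsto_mult[OF tendsto_const R_lim[OF f], of K] by simp
        show "\<forall>\<^sub>F n in sequentially. norm (N (T (R f) - T (\<Sum>k<n. u f k))) \<le> K * N (R f - (\<Sum>k<n. u f k))"
          using K[OF X_diff[OF R_in[OF f] P]] N_nonneg[OF X_diff[OF T_in[OF R_in[OF f]] T_in[OF P]]]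
          by (auto simp: T_diff R_in f P)
      qed
      then have "(\<lambda>n. T (\<Sum>k<n. u f k) x) \<longlonglongrightarrow> T (R f) x"
        by (intro lim_pt T_in R_in f P)
      moreover have "T (\<Sum>k<n. u f k) x = (\<Sum>k<n. u (T f) k x)" for n
        by (simp add: T_sum u_in f sum_apply) (simp add: u_def T_cscale Q_in f T_Q Q_T)
      ultimately have "(\<lambda>n. u (T f) n x) sums T (R f) x" by (simp add: sums_def)
      then show "T (R f) x = R (T f) x" by (rule sums_unique2[OF _ R_sums[OF T_in[OF f]]])
    qed
    have "T (S f) = S (T f)"
      by (simp add: S_def T_add X_cscale h_in R_in f TR T_cscale T_h \<Lambda>_T) (simp add: cscale_def fun_eq_iff)
    then have "cscale z (S f) - T (S f) = cscale z (S f) + cscale (-1) (S (T f))"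
      by (simp add: cscale_def fun_eq_iff)
    also have "\<dots> = S (cscale z f + cscale (-1) (T f))"
      by (simp only: S_add S_cscale X_cscale T_in f)
    also have "cscale z f + cscale (-1) (T f) = cscale z f - T f"
      by (simp add: cscale_def fun_eq_iff)
    finally show ?thesis unfolding left[OF f] .
  qed
  have "z \<notin> op_spectrum X N T"
    unfolding op_spectrum_def using bounded left right by blast
  then show False using zs by simp
qed

end

section \<open>The projective maps\<close>

lemma le_last_ix: "i \<le> (last_ix :: 'n::{finite,linorder})"
  by (simp add: last_ix_def)

lemma less_last_ix: "i < (last_ix :: 'n::{finite,linorder}) \<longleftrightarrow> i \<noteq> last_ix"
  using le_last_ix[of i] by auto

lemma UNIV_minus_last: "UNIV - {last_ix} = {i. i < (last_ix :: 'n::{finite,linorder})}"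
  by (auto simp: less_last_ix)

lemma next_ix_greater: "k < (last_ix :: 'n::{finite,linorder}) \<Longrightarrow> k < next_ix k"
proof -
  assume "k < last_ix"
  then have "Min {i. k < i} \<in> {i. k < i}" by (intro Min_in) auto
  then show ?thesis by (simp add: next_ix_def)
qed

lemma next_ix_le: "k < i \<Longrightarrow> next_ix k \<le> (i :: 'n::{finite,linorder})"
  unfolding next_ix_def by (rule Min_le) auto

text \<open>The increasing enumeration of the indices other than \<open>j\<close>: position
  \<open>k\<close> of the shortened vector holds the old coordinate \<open>skip j k\<close>.\<close>

definition skip :: "'n::{finite,linorder} \<Rightarrow> 'n \<Rightarrow> 'n" where
  "skip j k = (if k < j then k else next_ix k)"

lemma gamma_nth: "gamma j y $ k = (if k = last_ix then (\<Sum>i\<in>UNIV - {j}. y $ i) else y $ skip j k)"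
  by (simp add: gamma_def skip_def)

lemma skip_mono: "k < l \<Longrightarrow> l < last_ix \<Longrightarrow> skip j k < skip j l"
  using next_ix_greater[of l] next_ix_le[of k l] by (auto simp: skip_def)

lemma skip_bij: "bij_betw (skip j) {i. i < last_ix} (UNIV - {j :: 'n::{finite,linorder}})"
proof -
  have inj: "inj_on (skip j) {i. i < last_ix}"
    by (rule linorder_inj_onI) (metis skip_mono mem_Collect_eq less_irrefl, auto)
  have sub: "skip j ` {i. i < last_ix} \<subseteq> UNIV - {j}"
  proof
    fix i assume "i \<in> skip j ` {i. i < last_ix}"
    then obtain k where "k < last_ix" "i = skip j k" by blast
    then show "i \<in> UNIV - {j}" using next_ix_greater[of k] by (auto simp: skip_def)
  qed
  have "card (skip j ` {i. i < last_ix}) = card (UNIV - {j})"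
    by (subst card_image[OF inj]) (simp add: UNIV_minus_last[symmetric] card_Diff_singleton)
  then have "skip j ` {i. i < last_ix} = UNIV - {j}" using sub by (intro card_subset_eq) auto
  then show ?thesis using inj by (simp add: bij_betw_def)
qed

lemma gamma_linear: "linear (gamma j)"
  by (rule linearI)
    (auto simp: vec_eq_iff gamma_nth sum.distrib sum_distrib_left)

lemma H_cone_nonneg: "y \<in> H_cone \<Longrightarrow> 0 \<le> y $ i"
  and H_cone_mono: "y \<in> H_cone \<Longrightarrow> i \<le> j \<Longrightarrow> y $ i \<le> y $ j"
  and H_cone_sum: "y \<in> H_cone \<Longrightarrow> (\<Sum>i\<in>UNIV - {last_ix}. y $ i) = y $ last_ix"
  by (auto simp: H_cone_def)

text \<open>On the cone the first \<open>n - 1\<close> coordinates add up to the last one, so all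
  coordinates together add up to twice the last one.\<close>

lemma gamma_last:
  assumes "y \<in> H_cone"
  shows "gamma j y $ last_ix = 2 * y $ last_ix - y $ j"
proof -
  have "(\<Sum>i\<in>UNIV. y $ i) = y $ j + (\<Sum>i\<in>UNIV - {j}. y $ i)"
    by (rule sum.remove) auto
  moreover have "(\<Sum>i\<in>UNIV. y $ i) = y $ last_ix + (\<Sum>i\<in>UNIV - {last_ix}. y $ i)"
    by (rule sum.remove) auto
  ultimately show ?thesis using H_cone_sum[OF assms] by (simp add: gamma_nth)
qed

lemma sum_skip: "(\<Sum>k | k < last_ix. F (skip j k)) = (\<Sum>i\<in>UNIV - {j}. F i)"
  using sum.reindex_bij_betw[OF skip_bij] .

text \<open>Below the last index the image lists the remaining coordinates in order, and its last
  entry is their sum, which by nonnegativity dominates each of them.\<close>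

lemma gamma_H_cone:
  assumes y: "y \<in> H_cone" and j: "j < last_ix"
  shows "gamma j y \<in> H_cone"
  unfolding H_cone_def
proof (intro CollectI conjI allI impI)
  show nn: "0 \<le> gamma j y $ i" for i
    by (auto simp: gamma_nth H_cone_nonneg[OF y] intro: sum_nonneg)
  show "gamma j y $ i \<le> gamma j y $ k" if "i \<le> k" for i k
  proof (cases "k = last_ix")
    case True
    show ?thesis
    proof (cases "i = last_ix")
      case False
      then have "skip j i \<in> UNIV - {j}" using skip_bij[of j] by (auto simp: bij_betw_def less_last_ix)
      then have "y $ skip j i \<le> (\<Sum>i\<in>UNIV - {j}. y $ i)"
        by (intro member_le_sum) (auto simp: H_cone_nonneg[OF y])
      then show ?thesis using True False by (simp add: gamma_nth)
    qed (use True in simp)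
  next
    case False
    then have "k < last_ix" "i < last_ix" using that by (auto simp: less_last_ix le_last_ix antisym)
    moreover have "skip j i \<le> skip j k"
      using skip_mono[of i k j] that \<open>k < last_ix\<close> by (cases "i = k") (auto intro: less_imp_le)
    ultimately show ?thesis using H_cone_mono[OF y] by (simp add: gamma_nth less_last_ix)
  qed
  have "(\<Sum>i\<in>UNIV - {last_ix}. gamma j y $ i) = (\<Sum>k | k < last_ix. y $ skip j k)"
    unfolding UNIV_minus_last by (rule sum.cong) (auto simp: gamma_nth)
  then show "(\<Sum>i\<in>UNIV - {last_ix}. gamma j y $ i) = gamma j y $ last_ix"
    using sum_skip[of "\<lambda>i. y $ i" j] by (simp add: gamma_nth)
qed

section \<open>The l1 metric, weights and auxiliary vectors\<close>

definition l1_dist :: "'n::finite rvec \<Rightarrow> 'n rvec \<Rightarrow> real" where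
  "l1_dist x y = (\<Sum>i\<in>UNIV. \<bar>x $ i - y $ i\<bar>)"

lemma l1_dist_sym: "l1_dist x y = l1_dist y x"
  by (simp add: l1_dist_def abs_minus_commute)

lemma l1_dist_nonneg: "0 \<le> l1_dist x y"
  by (simp add: l1_dist_def sum_nonneg)

lemma norm_le_l1_dist: "norm (x - y) \<le> l1_dist x y"
  using norm_le_l1_cart[of "x - y"] by (simp add: l1_dist_def)

lemma l1_dist_le_norm: "l1_dist x y \<le> CARD('n) * norm (x - y)" for x y :: "'n::finite rvec"
proof -
  have "\<bar>x $ i - y $ i\<bar> \<le> norm (x - y)" for i
    using component_le_norm_cart[of "x - y" i] by simp
  then have "l1_dist x y \<le> (\<Sum>i\<in>(UNIV::'n set). norm (x - y))"
    unfolding l1_dist_def by (intro sum_mono) auto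
  then show ?thesis by simp
qed

lemma DeltaD:
  assumes "w \<in> Delta"
  shows "w \<in> H_cone" "w $ last_ix = 1" "(\<Sum>i | i < last_ix. w $ i) = 1"
  using assms H_cone_sum[of w] by (auto simp: Delta_def UNIV_minus_last)

definition weight :: "real \<Rightarrow> ('n::{finite,linorder} rvec \<Rightarrow> 'n rvec) \<Rightarrow> 'n rvec \<Rightarrow> real" where
  "weight s g w = (w $ last_ix / g w $ last_ix) powr s"

text \<open>The extreme points of \<open>Delta\<close>: coordinates 0 before \<open>i\<close> and
  equal from \<open>i\<close> up to the penultimate index.\<close>

definition vertex :: "'n::{finite,linorder} \<Rightarrow> 'n rvec" where
  "vertex i = (\<chi> k. if k = last_ix then 1 else if i \<le> k then 1 / card {k. i \<le> k \<and> k < last_ix} else 0)"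

definition pairing :: "'n::finite cvec \<Rightarrow> 'n rvec \<Rightarrow> complex" where
  "pairing g v = (\<Sum>i\<in>UNIV. g $ i * of_real (v $ i))"

text \<open>Coordinate vector of a linear form, corrected to satisfy the normalisation of gradients:
  the mean over the first \<open>n - 1\<close> entries is subtracted and the last entry set to 0.
  Values on differences of points of \<open>Delta\<close> do not change.\<close>

definition tangential :: "('n::{finite,linorder} rvec \<Rightarrow> complex) \<Rightarrow> 'n cvec" where
  "tangential F = (\<chi> i. if i = last_ix then 0
     else F (axis i 1) - (\<Sum>k | k < last_ix. F (axis k 1)) / of_nat (card {k. k < (last_ix :: 'n)}))"

text \<open>The dimension bound concerns only the index type, hence a type as locale parameter. It
  provides an index below the penultimate one, so that \<open>T_Gamma\<close> is nonempty.\<close>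

locale dim3 =
  fixes dim :: "'n::{finite,linorder} itself"
  assumes card3: "3 \<le> CARD('n)"
begin

lemma penult_less_last: "penult_ix < (last_ix :: 'n)"
proof -
  have "{i. i < (last_ix :: 'n)} \<noteq> {}"
  proof
    assume "{i. i < (last_ix :: 'n)} = {}"
    then have "UNIV - {last_ix :: 'n} = {}" by (simp add: UNIV_minus_last)
    then have "UNIV = {last_ix :: 'n}" by blast
    then have "CARD('n) = 1" by (metis card_1_singleton_iff One_nat_def)
    then show False using card3 by simp
  qed
  then have "Max {i. i < (last_ix :: 'n)} \<in> {i. i < (last_ix :: 'n)}" by (intro Max_in) auto
  then show ?thesis by (simp add: penult_ix_def)
qed

lemma le_penult: "i < (last_ix :: 'n) \<Longrightarrow> i \<le> penult_ix"
  unfolding penult_ix_def by (rule Max_ge) auto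

lemma next_penult: "next_ix penult_ix = (last_ix :: 'n)"
proof (rule ccontr)
  assume "next_ix penult_ix \<noteq> (last_ix :: 'n)"
  then have "next_ix penult_ix \<le> (penult_ix :: 'n)" by (intro le_penult) (simp add: less_last_ix)
  then show False using next_ix_greater[OF penult_less_last] by simp
qed

lemma skip_penult: "j \<le> penult_ix \<Longrightarrow> skip j penult_ix = (last_ix :: 'n)"
  by (simp add: skip_def next_penult leD)

lemma less_last_split: "{i. i < (last_ix :: 'n)} = insert penult_ix {i. i < penult_ix}"
  using le_penult penult_less_last by (auto simp: order.order_iff_strict)

lemma exists_less_penult: "\<exists>j::'n. j < penult_ix"
proof (rule ccontr)
  assume "\<nexists>j::'n. j < penult_ix"
  then have e: "{i. i < (penult_ix :: 'n)} = {}" by simp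
  have "UNIV - {last_ix :: 'n} = {penult_ix}" unfolding UNIV_minus_last less_last_split e by simp
  then have "card (UNIV - {last_ix :: 'n}) = 1" by simp
  then show False using card3 by (simp add: card_Diff_singleton)
qed

lemma sum_UNIV_split: "(\<Sum>i\<in>UNIV. F i) = (\<Sum>i | i < (penult_ix :: 'n). F i) + F penult_ix + (F last_ix :: real)"
proof -
  have "(\<Sum>i\<in>UNIV. F i) = F last_ix + (\<Sum>i\<in>UNIV - {last_ix}. F i)" by (rule sum.remove) auto
  also have "(\<Sum>i\<in>UNIV - {last_ix}. F i) = F penult_ix + (\<Sum>i | i < penult_ix. F i)"
    unfolding UNIV_minus_last less_last_split by (subst sum.insert) auto
  finally show ?thesis by simp
qed

lemma sum_skip_penult:
  assumes "j < (penult_ix :: 'n)"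
  shows "(\<Sum>k | k < penult_ix. F (skip j k)) = (\<Sum>i | i < last_ix \<and> i \<noteq> j. F i :: real)"
proof -
  have "(\<Sum>k | k < last_ix. F (skip j k)) = F last_ix + (\<Sum>k | k < penult_ix. F (skip j k))"
    unfolding less_last_split using assms by (subst sum.insert) (auto simp: skip_penult)
  moreover have "(\<Sum>i\<in>UNIV - {j}. F i) = F last_ix + (\<Sum>i\<in>UNIV - {j} - {last_ix}. F i)"
    using assms penult_less_last by (intro sum.remove) auto
  moreover have "UNIV - {j} - {last_ix} = {i. i < last_ix \<and> i \<noteq> j}" by (auto simp: less_last_ix)
  ultimately show ?thesis using sum_skip[of F j] by simp
qed

text \<open>Removing the penultimate coordinate promotes the last one and appends
  \<open>2 * y_n - y_(n-1)\<close>. So the last two coordinates run through an arithmetic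
  progression with constant step \<open>y_n - y_(n-1)\<close>.\<close>

lemma gamma_penult_iterate:
  assumes y: "y \<in> (H_cone :: 'n rvec set)"
  shows "(gamma penult_ix ^^ A) y \<in> H_cone \<and>
    (\<forall>k<penult_ix. (gamma penult_ix ^^ A) y $ k = y $ k) \<and>
    (gamma penult_ix ^^ A) y $ penult_ix = y $ penult_ix + A * (y $ last_ix - y $ penult_ix) \<and>
    (gamma penult_ix ^^ A) y $ last_ix = y $ last_ix + A * (y $ last_ix - y $ penult_ix)"
proof (induction A)
  case (Suc A)
  let ?z = "(gamma penult_ix ^^ A) y"
  have z: "?z \<in> H_cone" using Suc by blast
  have "gamma penult_ix ?z $ k = ?z $ k" if "k < penult_ix" for k
    using that penult_less_last by (auto simp: gamma_nth skip_def)
  moreover have "gamma penult_ix ?z $ penult_ix = ?z $ last_ix"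
    using penult_less_last by (auto simp: gamma_nth skip_penult)
  ultimately show ?case
    using Suc gamma_H_cone[OF z penult_less_last] gamma_last[OF z, of penult_ix]
    by (auto simp: algebra_simps)
qed (use y in simp)

text \<open>After \<open>gamma j\<close> the last two coordinates are 1 and
  \<open>2 - w $ j\<close>, so each further application of \<open>gamma penult_ix\<close> adds
  \<open>1 - w $ j\<close> to both.\<close>

lemma branch:
  assumes w: "w \<in> (Delta :: 'n rvec set)" and j: "j < penult_ix" and g: "g = (gamma penult_ix ^^ A) \<circ> gamma j"
  shows "g w \<in> H_cone" "g w $ last_ix = 1 + (real A + 1) * (1 - w $ j)"
    "g w $ penult_ix = 1 + real A * (1 - w $ j)" "k < penult_ix \<Longrightarrow> g w $ k = w $ skip j k"
proof -
  have jl: "j < last_ix" using j penult_less_last by simp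
  have y: "gamma j w \<in> H_cone" by (rule gamma_H_cone[OF DeltaD(1)[OF w] jl])
  have l: "gamma j w $ last_ix = 2 - w $ j" using gamma_last[OF DeltaD(1)[OF w]] DeltaD(2)[OF w] by simp
  have p: "gamma j w $ penult_ix = 1"
    using penult_less_last j DeltaD(2)[OF w] by (auto simp: gamma_nth skip_penult)
  note it = gamma_penult_iterate[OF y, of A]
  show "g w \<in> H_cone" using it g by simp
  show "g w $ last_ix = 1 + (real A + 1) * (1 - w $ j)" using it g l p by (simp add: algebra_simps)
  show "g w $ penult_ix = 1 + real A * (1 - w $ j)" using it g l p by (simp add: algebra_simps)
  show "g w $ k = w $ skip j k" if "k < penult_ix"
    using it g that penult_less_last by (auto simp: gamma_nth)
qed

text \<open>Such a coordinate is at most the penultimate one, and the two add up to at most 1. This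
  makes every denominator at least 3/2, hence the contraction factor 2/3.\<close>

lemma Delta_le_half:
  assumes w: "w \<in> (Delta :: 'n rvec set)" and j: "j < penult_ix"
  shows "w $ j \<le> 1 / 2"
proof -
  have "(\<Sum>i\<in>{j, penult_ix}. w $ i) \<le> (\<Sum>i | i < last_ix. w $ i)"
    using j penult_less_last by (intro sum_mono2) (auto simp: H_cone_nonneg[OF DeltaD(1)[OF w]])
  then have "w $ j + w $ penult_ix \<le> 1" using j DeltaD(3)[OF w] by simp
  moreover have "w $ j \<le> w $ penult_ix" using j by (intro H_cone_mono[OF DeltaD(1)[OF w]]) auto
  ultimately show ?thesis by simp
qed

lemma T_GammaE:
  assumes "g \<in> (T_Gamma :: ('n rvec \<Rightarrow> 'n rvec) set)"
  obtains A j where "j < penult_ix" "g = (gamma penult_ix ^^ A) \<circ> gamma j"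
  using assms unfolding T_Gamma_def by blast

lemma proj_act_in:
  assumes w: "w \<in> (Delta :: 'n rvec set)" and g: "g \<in> T_Gamma"
  shows "proj_act g w \<in> Delta" "1 \<le> g w $ last_ix"
proof -
  obtain A j where j: "j < penult_ix" and gA: "g = (gamma penult_ix ^^ A) \<circ> gamma j" using g by (rule T_GammaE)
  note b = branch[OF w j gA]
  show l: "1 \<le> g w $ last_ix" using b(2) Delta_le_half[OF w j] by simp
  have gs: "(\<Sum>i\<in>UNIV - {last_ix}. g w $ i) = g w $ last_ix" by (rule H_cone_sum[OF b(1)])
  have "(\<Sum>i\<in>UNIV - {last_ix}. proj_act g w $ i) = (1 / g w $ last_ix) * (\<Sum>i\<in>UNIV - {last_ix}. g w $ i)"
    by (simp add: proj_act_def sum_divide_distrib)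
  then have "(\<Sum>i\<in>UNIV - {last_ix}. proj_act g w $ i) = 1" using gs l by simp
  then show "proj_act g w \<in> Delta"
    using H_cone_nonneg[OF b(1)] H_cone_mono[OF b(1)] l
    by (auto simp: Delta_def H_cone_def proj_act_def intro!: divide_right_mono)
qed

lemma l1_dist_Delta_le: "x \<in> (Delta :: 'n rvec set) \<Longrightarrow> y \<in> Delta \<Longrightarrow> l1_dist x y \<le> 2"
proof -
  assume x: "x \<in> (Delta :: 'n rvec set)" and y: "y \<in> Delta"
  have "l1_dist x y = (\<Sum>i | i < last_ix. \<bar>x $ i - y $ i\<bar>)"
    unfolding l1_dist_def using DeltaD(2)[OF x] DeltaD(2)[OF y]
    by (intro sum.mono_neutral_right) (auto simp: less_last_ix)
  also have "\<dots> \<le> (\<Sum>i | i < last_ix. x $ i + y $ i)"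
  proof (rule sum_mono)
    fix i show "\<bar>x $ i - y $ i\<bar> \<le> x $ i + y $ i"
      using H_cone_nonneg[OF DeltaD(1)[OF x], of i] H_cone_nonneg[OF DeltaD(1)[OF y], of i] by linarith
  qed
  also have "\<dots> = 2" using DeltaD(3)[OF x] DeltaD(3)[OF y] by (simp add: sum.distrib)
  finally show ?thesis .
qed

text \<open>With \<open>k = A + 1\<close>, the variation of the denominator \<open>1 + k (1 - x j)\<close> and the removal of the
  \<open>j\<close>-th coordinate balance, so that exactly the factor \<open>1 / (1 + k (1 - x j)) \<le> 2 / 3\<close> remains.\<close>

lemma proj_act_contract:
  assumes x: "x \<in> (Delta :: 'n rvec set)" and y: "y \<in> Delta" and g: "g \<in> T_Gamma"
  shows "l1_dist (proj_act g x) (proj_act g y) \<le> 2 / 3 * l1_dist x y"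
proof -
  obtain A j where j: "j < penult_ix" and gA: "g = (gamma penult_ix ^^ A) \<circ> gamma j" using g by (rule T_GammaE)
  define k where "k = real A + 1"
  define s t where "s = 1 - x $ j" and "t = 1 - y $ j"
  define a b where "a = 1 + k * s" and "b = 1 + k * t"
  have k: "1 \<le> k" by (simp add: k_def)
  have s: "1 / 2 \<le> s" and t: "1 / 2 \<le> t"
    using Delta_le_half[OF x j] Delta_le_half[OF y j] by (auto simp: s_def t_def)
  have ks: "1 * (1 / 2) \<le> k * s" and kt: "1 * (1 / 2) \<le> k * t" using k s t by (intro mult_mono; simp)+
  then have a: "3 / 2 \<le> a" and b: "3 / 2 \<le> b" by (auto simp: a_def b_def)
  define e where "e = \<bar>x $ j - y $ j\<bar>"
  define S where "S = {i. i < last_ix \<and> i \<noteq> j}"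
  note brx = branch[OF x j gA] and bry = branch[OF y j gA]
  have lx: "g x $ last_ix = a" and ly: "g y $ last_ix = b"
    using brx(2) bry(2) by (simp_all add: a_def b_def s_def t_def k_def)
  have px: "g x $ penult_ix = a - s" and py: "g y $ penult_ix = b - t"
    using brx(3) bry(3) by (simp_all add: a_def b_def s_def t_def k_def algebra_simps)
  have dist: "l1_dist x y = e + (\<Sum>i\<in>S. \<bar>x $ i - y $ i\<bar>)"
  proof -
    have "l1_dist x y = (\<Sum>i | i < last_ix. \<bar>x $ i - y $ i\<bar>)"
      unfolding l1_dist_def using DeltaD(2)[OF x] DeltaD(2)[OF y]
      by (intro sum.mono_neutral_right) (auto simp: less_last_ix)
    also have "\<dots> = e + (\<Sum>i\<in>{i. i < last_ix} - {j}. \<bar>x $ i - y $ i\<bar>)"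
      unfolding e_def using j penult_less_last by (intro sum.remove) auto
    also have "{i. i < last_ix} - {j} = S" by (auto simp: S_def)
    finally show ?thesis .
  qed
  have sumy: "(\<Sum>i\<in>S. y $ i) = t"
  proof -
    have "(\<Sum>i | i < last_ix. y $ i) = y $ j + (\<Sum>i\<in>{i. i < last_ix} - {j}. y $ i)"
      using j penult_less_last by (intro sum.remove) auto
    also have "{i. i < last_ix} - {j} = S" by (auto simp: S_def)
    finally show ?thesis using DeltaD(3)[OF y] by (simp add: t_def)
  qed
  have ab: "\<bar>1 / a - 1 / b\<bar> = k * e / (a * b)"
  proof -
    have "1 / a - 1 / b = (b - a) / (a * b)" using a b by (simp add: field_simps)
    also have "b - a = k * (x $ j - y $ j)" by (simp add: a_def b_def s_def t_def algebra_simps)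
    finally show ?thesis using a b k by (simp add: abs_mult e_def)
  qed
  have tm: "\<bar>x $ i / a - y $ i / b\<bar> \<le> \<bar>x $ i - y $ i\<bar> / a + y $ i * (k * e / (a * b))" for i
  proof -
    have "x $ i / a - y $ i / b = (x $ i - y $ i) / a + y $ i * (1 / a - 1 / b)"
      by (simp add: diff_divide_distrib right_diff_distrib)
    also have "\<bar>\<dots>\<bar> \<le> \<bar>(x $ i - y $ i) / a\<bar> + \<bar>y $ i * (1 / a - 1 / b)\<bar>" by (rule abs_triangle_ineq)
    also have "\<bar>y $ i * (1 / a - 1 / b)\<bar> = y $ i * (k * e / (a * b))"
      unfolding abs_mult ab using H_cone_nonneg[OF DeltaD(1)[OF y]] by simp
    also have "\<bar>(x $ i - y $ i) / a\<bar> = \<bar>x $ i - y $ i\<bar> / a" using a by simp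
    finally show ?thesis .
  qed
  have st: "\<bar>(1 - s / a) - (1 - t / b)\<bar> = e / (a * b)"
  proof -
    have "(1 - s / a) - (1 - t / b) = (t * a - s * b) / (a * b)" using a b by (simp add: field_simps)
    also have "t * a - s * b = x $ j - y $ j" by (simp add: a_def b_def s_def t_def algebra_simps)
    finally show ?thesis using a b by (simp add: e_def)
  qed
  \<comment> \<open>Both image points have last coordinate 1, and their penultimate coordinates are
    \<open>1 - s / a\<close> and \<open>1 - t / b\<close>.\<close>
  have "l1_dist (proj_act g x) (proj_act g y) =
      (\<Sum>i | i < penult_ix. \<bar>x $ skip j i / a - y $ skip j i / b\<bar>) + \<bar>(1 - s / a) - (1 - t / b)\<bar>"
  proof -
    have "(a - s) / a = 1 - s / a" "(b - t) / b = 1 - t / b" "a / a = 1" "b / b = 1"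
      using a b by (auto simp: field_simps)
    then show ?thesis
      unfolding l1_dist_def sum_UNIV_split
      by (simp add: proj_act_def lx ly px py brx(4) bry(4))
  qed
  also have "(\<Sum>i | i < penult_ix. \<bar>x $ skip j i / a - y $ skip j i / b\<bar>) = (\<Sum>i\<in>S. \<bar>x $ i / a - y $ i / b\<bar>)"
    unfolding S_def by (rule sum_skip_penult[OF j])
  also have "\<dots> \<le> (\<Sum>i\<in>S. \<bar>x $ i - y $ i\<bar> / a + y $ i * (k * e / (a * b)))"
    by (rule sum_mono) (rule tm)
  also have "\<dots> = (l1_dist x y - e) / a + t * (k * e / (a * b))"
    by (simp add: sum.distrib sum_divide_distrib[symmetric] sum_distrib_right[symmetric] sumy dist)
  also have "(l1_dist x y - e) / a + t * (k * e / (a * b)) + \<bar>(1 - s / a) - (1 - t / b)\<bar>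
      = (l1_dist x y - e) / a + (1 + k * t) * e / (a * b)"
    unfolding st by (simp add: add_divide_distrib algebra_simps)
  also have "(1 + k * t) * e / (a * b) = e / a" using b by (simp add: b_def[symmetric])
  also have "(l1_dist x y - e) / a + e / a = l1_dist x y / a" by (simp add: diff_divide_distrib)
  also have "\<dots> \<le> l1_dist x y / (3 / 2)"
    using a l1_dist_nonneg by (intro divide_left_mono) auto
  finally show ?thesis by simp
qed

lemma weight_eq: "w \<in> Delta \<Longrightarrow> weight s g w = (1 / g w $ last_ix) powr s"
  by (simp add: weight_def DeltaD(2))

text \<open>Only coordinate \<open>j\<close> enters the denominator
  \<open>1 + k * (1 - x $ j)\<close>. Its logarithm has slope at most \<open>k\<close> over the
  denominator, which is at most 2 because \<open>1 - x $ j\<close> is at least 1/2; the power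
  \<open>s\<close> gives \<open>2 * s\<close>.\<close>

lemma weight_log_lip:
  assumes s: "0 < s" and x: "x \<in> (Delta :: 'n rvec set)" and y: "y \<in> Delta" and g: "g \<in> T_Gamma"
  shows "weight s g x \<le> exp (2 * s * l1_dist x y) * weight s g y"
proof -
  obtain A j where j: "j < penult_ix" and gA: "g = (gamma penult_ix ^^ A) \<circ> gamma j" using g by (rule T_GammaE)
  define k where "k = real A + 1"
  define e where "e = \<bar>x $ j - y $ j\<bar>"
  let ?a = "g x $ last_ix" and ?b = "g y $ last_ix"
  have a: "?a = 1 + k * (1 - x $ j)" and b: "?b = 1 + k * (1 - y $ j)"
    using branch(2)[OF x j gA] branch(2)[OF y j gA] by (simp_all add: k_def)
  have k: "1 \<le> k" by (simp add: k_def)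
  have a1: "1 \<le> ?a" and b1: "1 \<le> ?b" using proj_act_in(2) x y g by auto
  have e_le: "e \<le> l1_dist x y" unfolding e_def l1_dist_def by (rule member_le_sum) auto
  have "k * (1 / 2) \<le> k * (1 - x $ j)" using Delta_le_half[OF x j] k by (intro mult_left_mono) auto
  then have ka: "k \<le> 2 * ?a" by (simp add: a)
  have "?b = ?a + k * (x $ j - y $ j)" by (simp add: a b algebra_simps)
  also have "\<dots> \<le> ?a + k * e" using k by (simp add: e_def mult_left_mono)
  also have "\<dots> \<le> ?a + 2 * ?a * e" using ka by (intro add_left_mono mult_right_mono) (auto simp: e_def)
  also have "\<dots> = ?a * (1 + 2 * e)" by (simp add: algebra_simps)
  also have "\<dots> \<le> ?a * exp (2 * e)" using a1 by (intro mult_left_mono exp_ge_add_one_self) auto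
  also have "\<dots> \<le> ?a * exp (2 * l1_dist x y)" using a1 e_le by (intro mult_left_mono) auto
  finally have "1 / ?a \<le> exp (2 * l1_dist x y) * (1 / ?b)" using a1 b1 by (simp add: field_simps)
  then have "(1 / ?a) powr s \<le> (exp (2 * l1_dist x y) * (1 / ?b)) powr s"
    using a1 s by (intro powr_mono2) auto
  also have "\<dots> = exp (2 * s * l1_dist x y) * (1 / ?b) powr s"
    using b1 by (simp add: powr_mult exp_powr_real mult_ac powr_divide)
  finally show ?thesis by (simp add: weight_eq x y)
qed

text \<open>The denominator of the branch with exponent \<open>A\<close> is at least
  \<open>(A + 1) / 2\<close>. This dominates the sum by finitely many series
  \<open>\<Sum> 2 powr s * (A + 1) powr (- s)\<close>, convergent for \<open>s > 1\<close>.\<close>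

lemma weight_summable:
  assumes s: "1 < s" and w: "w \<in> (Delta :: 'n rvec set)"
  shows "(\<lambda>g. weight s g w) summable_on T_Gamma"
proof -
  define J where "J = {j. j < (penult_ix :: 'n)}"
  define b where "b p = (gamma penult_ix ^^ fst p) \<circ> gamma (snd p)" for p :: "nat \<times> 'n"
  have T: "T_Gamma = b ` (UNIV \<times> J)" 
  proof -
    have "T_Gamma = {b (A, j) | A j. j \<in> J}" by (simp add: T_Gamma_def b_def J_def)
    then show ?thesis by auto
  qed
  have "(\<lambda>p. 2 powr s * real (Suc (fst p)) powr (- s)) summable_on (\<Union>j\<in>J. (\<lambda>A. (A, j)) ` UNIV)"
  proof (rule summable_on_finite_union_disjoint)
    show "finite J" by simp
    fix j assume "j \<in> J"
    have "summable (\<lambda>A. real (Suc A) powr (- s))"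
      using s by (subst summable_Suc_iff) (simp add: summable_real_powr_iff)
    then have "summable (\<lambda>A. 2 powr s * real (Suc A) powr (- s))" by (rule summable_mult)
    then have "(\<lambda>A. 2 powr s * real (Suc A) powr (- s)) summable_on UNIV"
      by (subst summable_on_UNIV_nonneg_real_iff) auto
    then show "(\<lambda>p. 2 powr s * real (Suc (fst p)) powr (- s)) summable_on (\<lambda>A. (A, j)) ` UNIV"
      by (subst summable_on_reindex) (auto simp: inj_on_def o_def)
  qed auto
  moreover have "(\<Union>j\<in>J. (\<lambda>A. (A, j)) ` UNIV) = (UNIV :: nat set) \<times> J" by auto
  ultimately have sb: "(\<lambda>p. 2 powr s * real (Suc (fst p)) powr (- s)) summable_on (UNIV \<times> J)"
    by (simp only:)
  \<comment> \<open>The sum runs over maps, not over pairs \<open>(A, j)\<close>. A set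
    \<open>J'\<close> of representatives on which \<open>b\<close> is injective allows the
    reindexing.\<close>
  obtain J' where J': "J' \<subseteq> UNIV \<times> J" "b ` (UNIV \<times> J) = b ` J'" "inj_on b J'"
    using subset_image_inj[of "b ` (UNIV \<times> J)" b "UNIV \<times> J"] by blast
  have "(\<lambda>p. weight s (b p) w) summable_on J'"
  proof (rule summable_on_comparison_test[OF summable_on_subset_banach[OF sb J'(1)]])
    fix p assume "p \<in> J'"
    then have j: "snd p < penult_ix" using J'(1) by (auto simp: J_def)
    have "real (Suc (fst p)) * (1 / 2) \<le> (real (fst p) + 1) * (1 - w $ snd p)"
      using Delta_le_half[OF w j] by (intro mult_mono) auto
    then have "real (Suc (fst p)) / 2 \<le> b p w $ last_ix"
      using branch(2)[OF w j b_def] by simp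
    then have "1 / b p w $ last_ix \<le> 2 / real (Suc (fst p))" by (simp add: field_simps)
    moreover have "0 \<le> 1 / b p w $ last_ix"
    proof -
      have "b p \<in> T_Gamma" unfolding T using \<open>p \<in> J'\<close> J'(1) by blast
      then show ?thesis using proj_act_in(2)[OF w] by (simp add: order_trans[OF zero_le_one])
    qed
    ultimately have "(1 / b p w $ last_ix) powr s \<le> (2 / real (Suc (fst p))) powr s"
      using s by (intro powr_mono2) auto
    then show "weight s (b p) w \<le> 2 powr s * real (Suc (fst p)) powr (- s)"
      by (simp add: weight_eq[OF w] powr_divide powr_minus_divide)
  qed (simp add: weight_def)
  then show ?thesis unfolding T J'(2) by (subst summable_on_reindex[OF J'(3)]) (simp add: o_def)
qed

section \<open>The simplex as a contracting system\<close>

lemma vertex_in: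
  assumes "i < last_ix" shows "vertex i \<in> Delta"
proof -
  let ?S = "{k. i \<le> k \<and> k < last_ix}"
  have "i \<in> ?S" using assms by simp
  then have c: "0 < card ?S" by (subst card_gt_0_iff) auto
  have c1: "1 \<le> real (card ?S)" using c by simp
  have nonzero_mult_inverse: "x * (1 / x) = 1" if "x \<noteq> 0" for x :: real using that by simp
  have "(\<Sum>k\<in>UNIV - {last_ix}. vertex i $ k) = (\<Sum>k\<in>?S. 1 / real (card ?S))"
    unfolding UNIV_minus_last by (rule sum.mono_neutral_cong_right) (auto simp: vertex_def)
  also have "\<dots> = real (card ?S) * (1 / real (card ?S))" by (rule sum_constant)
  also have "\<dots> = 1" by (rule nonzero_mult_inverse) (use c1 in linarith)
  finally have "(\<Sum>k\<in>UNIV - {last_ix}. vertex i $ k) = 1" .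
  then show ?thesis
    using c1 by (auto simp: Delta_def H_cone_def vertex_def field_simps le_last_ix less_last_ix antisym)
qed

lemma Delta_nonempty: "(Delta :: 'n rvec set) \<noteq> {}"
  using vertex_in[OF penult_less_last] by blast

lemma T_Gamma_nonempty: "(T_Gamma :: ('n rvec \<Rightarrow> 'n rvec) set) \<noteq> {}"
  using exists_less_penult by (auto simp: T_Gamma_def)

lemma Delta_dissimilarity: "bounded_dissimilarity (Delta :: 'n rvec set) l1_dist 2"
  by unfold_locales (auto simp: Delta_nonempty l1_dist_nonneg l1_dist_Delta_le l1_dist_sym)

lemma Delta_contracting:
  assumes "1 < s"
  shows "contracting_system (Delta :: 'n rvec set) l1_dist 2 T_Gamma proj_act (weight s) (2 / 3) (2 * s)"
proof -
  interpret bounded_dissimilarity "Delta :: 'n rvec set" l1_dist 2 by (rule Delta_dissimilarity)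
  show ?thesis
  proof
    show "0 < weight s g w" if "g \<in> T_Gamma" "w \<in> Delta" for g and w :: "'n rvec"
      using proj_act_in(2)[OF that(2,1)] by (simp add: weight_eq that)
    show "weight s g x \<le> exp (2 * s * l1_dist x y) * weight s g y"
      if "g \<in> T_Gamma" "x \<in> Delta" "y \<in> Delta" for g and x y :: "'n rvec"
      using weight_log_lip[OF _ that(2,3,1), of s] assms by simp
    show "l1_dist (proj_act g x) (proj_act g y) \<le> 2 / 3 * l1_dist x y"
      if "g \<in> T_Gamma" "x \<in> Delta" "y \<in> Delta" for g and x y :: "'n rvec"
      by (rule proj_act_contract[OF that(2,3,1)])
  qed (use assms T_Gamma_nonempty in \<open>auto simp: proj_act_in weight_summable\<close>)
qed

section \<open>Continuously differentiable functions on the simplex\<close>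

lemma Delta_convex: "convex (Delta :: 'n rvec set)"
proof (rule convexI)
  fix x y :: "'n rvec" and u v :: real
  assume x: "x \<in> Delta" and y: "y \<in> Delta" and uv: "0 \<le> u" "0 \<le> v" "u + v = 1"
  note hx = DeltaD[OF x] and hy = DeltaD[OF y]
  have "(\<Sum>i\<in>UNIV - {last_ix}. (u *\<^sub>R x + v *\<^sub>R y) $ i) = u * (\<Sum>i\<in>UNIV - {last_ix}. x $ i) + v * (\<Sum>i\<in>UNIV - {last_ix}. y $ i)"
    by (simp add: sum.distrib sum_distrib_left)
  then show "u *\<^sub>R x + v *\<^sub>R y \<in> Delta"
    using uv H_cone_nonneg[OF hx(1)] H_cone_nonneg[OF hy(1)] H_cone_mono[OF hx(1)] H_cone_mono[OF hy(1)]
      H_cone_sum[OF hx(1)] H_cone_sum[OF hy(1)]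
    by (auto simp: Delta_def H_cone_def hx(2) hy(2) intro!: add_mono mult_left_mono)
qed

lemma Delta_compact: "compact (Delta :: 'n rvec set)"
proof -
  have "closed (Delta :: 'n rvec set)"
  proof -
    have "Delta = {y :: 'n rvec. (\<forall>i. 0 \<le> y $ i) \<and> (\<forall>i j. i \<le> j \<longrightarrow> y $ i \<le> y $ j) \<and>
        (\<Sum>i\<in>UNIV - {last_ix}. y $ i) = y $ last_ix \<and> y $ last_ix = 1}"
      by (auto simp: Delta_def H_cone_def)
    also have "closed \<dots>"
      by (intro closed_Collect_conj closed_Collect_all closed_Collect_imp closed_Collect_le closed_Collect_eq
          open_Collect_const continuous_intros)
    finally show ?thesis .
  qed
  moreover have "bounded (Delta :: 'n rvec set)"
  proof -
    obtain w0 :: "'n rvec" where w0: "w0 \<in> Delta" using Delta_nonempty by blast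
    have "dist w0 w \<le> 2" if "w \<in> Delta" for w
      using norm_le_l1_dist[of w0 w] l1_dist_Delta_le[OF w0 that] by (simp add: dist_norm)
    then show ?thesis unfolding bounded_def by blast
  qed
  ultimately show ?thesis by (simp add: compact_eq_bounded_closed)
qed

interpretation Delta: bounded_dissimilarity "Delta :: 'n rvec set" l1_dist 2
  by (rule Delta_dissimilarity)

lemma segment_in_Delta:
  assumes "w \<in> (Delta :: 'n rvec set)" "v \<in> Delta" "0 \<le> t" "t \<le> 1"
  shows "w + t *\<^sub>R (v - w) \<in> Delta"
  using convexD[OF Delta_convex assms(1,2), of "1 - t" t] assms(3,4) by (simp add: algebra_simps)

text \<open>Testing against the vertices controls the averages of \<open>g\<close> over final
  segments of indices, up to the common unknown \<open>c\<close>. Differences of consecutive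
  segments isolate each \<open>g $ i - c\<close>, and the vanishing coordinate sum determines
  \<open>c\<close>.\<close>

lemma tangential_bound:
  fixes g :: "'n cvec"
  assumes g: "g $ last_ix = 0" "(\<Sum>i\<in>UNIV. g $ i) = 0"
    and le: "\<And>v. v \<in> Delta \<Longrightarrow> cmod (\<Sum>i\<in>UNIV. g $ i * of_real (v $ i - w $ i)) \<le> B"
  shows "norm g \<le> 4 * real CARD('n) ^ 2 * B"
proof -
  define n where "n = real CARD('n)"
  define c where "c = (\<Sum>i\<in>UNIV. g $ i * of_real (w $ i))"
  define S where "S i = {k. i \<le> k \<and> k < (last_ix :: 'n)}" for i
  have B: "0 \<le> B" using le vertex_in[OF penult_less_last] norm_ge_zero order_trans by blast
  have n: "1 \<le> n" using card3 by (simp add: n_def)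
  have cardS: "real (card (S i)) \<le> n" for i unfolding n_def by (simp add: card_mono)
  \<comment> \<open>The value at vertex \<open>i\<close> is the average of \<open>g\<close> over
    \<open>S i\<close>; multiplying by the number of entries, at most \<open>n\<close>, gives the
    sum.\<close>
  have est: "cmod ((\<Sum>k\<in>S i. g $ k) - of_nat (card (S i)) * c) \<le> n * B" if i: "i < last_ix" for i
  proof -
    define m where "m = real (card (S i))"
    have "i \<in> S i" using i by (simp add: S_def)
    then have m: "0 < m" unfolding m_def of_nat_0_less_iff by (subst card_gt_0_iff) auto
    have "(\<Sum>k\<in>UNIV. g $ k * of_real (vertex i $ k)) = (\<Sum>k\<in>S i. g $ k / of_real m)"
      by (rule sum.mono_neutral_cong_right) (auto simp: vertex_def S_def g less_last_ix m_def)
    then have "(\<Sum>k\<in>UNIV. g $ k * of_real (vertex i $ k - w $ k)) = (\<Sum>k\<in>S i. g $ k) / of_real m - c"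
      by (simp add: c_def right_diff_distrib sum_subtractf sum_divide_distrib)
    then have "cmod ((\<Sum>k\<in>S i. g $ k) / of_real m - c) \<le> B" using le[OF vertex_in[OF i]] by simp
    then have "m * cmod ((\<Sum>k\<in>S i. g $ k) / of_real m - c) \<le> n * B"
      using cardS[of i] m B n by (intro mult_mono) (auto simp: m_def)
    moreover have "(\<Sum>k\<in>S i. g $ k) - of_nat (card (S i)) * c = of_real m * ((\<Sum>k\<in>S i. g $ k) / of_real m - c)"
      using m by (simp add: m_def field_simps)
    ultimately show ?thesis using m by (simp only: norm_mult norm_of_real abs_of_pos)
  qed
  \<comment> \<open>\<open>S i\<close> is \<open>i\<close> together with the segment starting at the
    next index; for the penultimate index it is a singleton.\<close>
  have gc: "cmod (g $ i - c) \<le> 2 * n * B" if i: "i < last_ix" for i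
  proof (cases "i = penult_ix")
    case True
    then have "S i = {i}" using i le_penult by (auto simp: S_def intro: antisym)
    then have "cmod (g $ i - c) \<le> n * B" using est[OF i] by simp
    moreover have "0 \<le> n * B" using n B by simp
    ultimately show ?thesis by linarith
  next
    case False
    then have ip: "i < penult_ix" using le_penult[OF i] by simp
    then have ni: "next_ix i < last_ix" using next_ix_le[OF ip] penult_less_last by simp
    have Si: "S i = insert i (S (next_ix i))"
      using i next_ix_greater[OF i] next_ix_le[of i] by (auto simp: S_def order.order_iff_strict)
    have nin: "i \<notin> S (next_ix i)" using next_ix_greater[OF i] by (auto simp: S_def)
    have "g $ i - c = ((\<Sum>k\<in>S i. g $ k) - of_nat (card (S i)) * c)
        - ((\<Sum>k\<in>S (next_ix i). g $ k) - of_nat (card (S (next_ix i))) * c)"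
      unfolding Si using nin by (simp add: algebra_simps)
    then have "cmod (g $ i - c) \<le> n * B + n * B"
      using norm_triangle_ineq4 est[OF i] est[OF ni] by (smt (verit, best))
    then show ?thesis by (simp add: mult_ac)
  qed
  \<comment> \<open>Summing \<open>g $ i - c\<close> over the first \<open>n - 1\<close> indices
    leaves only the multiple of \<open>c\<close>, since the entries of \<open>g\<close>
    cancel.\<close>
  have c: "cmod c \<le> 2 * n * B"
  proof -
    let ?I = "{i. i < (last_ix :: 'n)}"
    have "(\<Sum>i\<in>UNIV. g $ i) = g $ last_ix + (\<Sum>i\<in>UNIV - {last_ix}. g $ i)" by (rule sum.remove) auto
    then have "(\<Sum>i\<in>?I. g $ i) = 0" using g by (simp add: UNIV_minus_last)
    then have "of_nat (card ?I) * c = - (\<Sum>i\<in>?I. g $ i - c)" by (simp add: sum_subtractf)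
    then have "real (card ?I) * cmod c = cmod (\<Sum>i\<in>?I. g $ i - c)"
      by (metis norm_minus_cancel norm_mult norm_of_nat)
    also have "\<dots> \<le> (\<Sum>i\<in>?I. 2 * n * B)" by (rule sum_norm_le) (use gc in auto)
    also have "\<dots> = real (card ?I) * (2 * n * B)" by simp
    finally have "real (card ?I) * cmod c \<le> real (card ?I) * (2 * n * B)" .
    moreover have "0 < real (card ?I)"
      using penult_less_last unfolding of_nat_0_less_iff by (subst card_gt_0_iff) auto
    ultimately show ?thesis by (simp only: mult_le_cancel_left_pos)
  qed
  have gi: "cmod (g $ i) \<le> 4 * n * B" for i
  proof (cases "i = last_ix")
    case True then show ?thesis using g n B by simp
  next
    case False
    then have "cmod (g $ i - c) \<le> 2 * n * B" using gc by (simp add: less_last_ix)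
    then show ?thesis using norm_triangle_sub[of "g $ i" c] c by linarith
  qed
  have "norm g \<le> (\<Sum>i\<in>UNIV. cmod (g $ i))" unfolding norm_vec_def by (rule L2_set_le_sum) auto
  also have "\<dots> \<le> (\<Sum>i\<in>(UNIV :: 'n set). 4 * n * B)" by (rule sum_mono) (rule gi)
  also have "\<dots> = 4 * n ^ 2 * B" by (simp add: n_def power2_eq_square)
  finally show ?thesis by (simp add: n_def)
qed

section \<open>Gradients relative to the simplex\<close>

lemma has_gradient_iff:
  "has_gradient f g w \<longleftrightarrow> (f has_derivative pairing g) (at w within (Delta :: 'n rvec set)) \<and>
     g $ last_ix = 0 \<and> (\<Sum>i\<in>UNIV. g $ i) = 0"
  unfolding has_gradient_def pairing_def[abs_def] ..

lemma pairing_linear: "bounded_linear (pairing g)"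
proof -
  have "linear (pairing g)"
  proof (rule linearI)
    show "pairing g (x + y) = pairing g x + pairing g y" for x y
      by (simp add: pairing_def distrib_left sum.distrib)
    show "pairing g (r *\<^sub>R x) = r *\<^sub>R pairing g x" for r x
      by (simp add: pairing_def scaleR_conv_of_real[of _ "_ :: complex"] sum_distrib_left mult_ac)
  qed
  then show ?thesis by (simp add: linear_conv_bounded_linear)
qed

lemma pairing_diff: "pairing (g - g') v = pairing g v - pairing g' v"
  by (simp add: pairing_def sum_subtractf left_diff_distrib)

lemma pairing_le: "cmod (pairing g v) \<le> norm g * norm v"
proof -
  have "cmod (pairing g v) \<le> (\<Sum>i\<in>UNIV. cmod (g $ i) * norm (v $ i))"
    unfolding pairing_def by (rule sum_norm_le) (simp add: norm_mult)
  also have "\<dots> \<le> norm g * norm v"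
    unfolding norm_vec_def using L2_set_mult_ineq[of "\<lambda>i. cmod (g $ i)" "\<lambda>i. norm (v $ i)" UNIV] by simp
  finally show ?thesis .
qed

text \<open>Convexity provides a segment inside \<open>Delta\<close> from \<open>w\<close> to any
  other point, also when \<open>w\<close> is on the boundary. Difference quotients along it bound
  the pairing by twice \<open>\<bar>B\<bar>\<close>, as the diameter is at most 2, and
  \<open>tangential_bound\<close> does the rest.\<close>

lemma gradient_le:
  assumes f: "has_gradient f g w" and w: "w \<in> (Delta :: 'n rvec set)"
    and lip: "\<And>v. v \<in> Delta \<Longrightarrow> cmod (f v - f w) \<le> B * l1_dist v w"
  shows "norm g \<le> 8 * real CARD('n) ^ 2 * \<bar>B\<bar>"
proof -
  interpret P: bounded_linear "pairing g" by (rule pairing_linear)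
  have "cmod (\<Sum>i\<in>UNIV. g $ i * of_real (v $ i - w $ i)) \<le> 2 * \<bar>B\<bar>" if v: "v \<in> Delta" for v
  proof -
    have "cmod (pairing g (v - w)) \<le> 2 * \<bar>B\<bar> + e * norm (v - w)" if e: "0 < e" for e
    proof -
      obtain d where d: "0 < d" and dd: "\<And>y. y \<in> Delta \<Longrightarrow> norm (y - w) < d \<Longrightarrow> cmod (f y - f w - pairing g (y - w)) \<le> e * norm (y - w)"
        using f e unfolding has_gradient_iff has_derivative_within_alt by blast
      \<comment> \<open>Brings the point on the segment within distance \<open>d\<close> of
        \<open>w\<close>; the added 1 covers \<open>v = w\<close>.\<close>
      define t where "t = min 1 (d / (2 * (norm (v - w) + 1)))"
      have pos: "0 < norm (v - w) + 1" by (simp add: add_nonneg_pos)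
      have t: "0 < t" "t \<le> 1" using d pos by (auto simp: t_def)
      define y where "y = w + t *\<^sub>R (v - w)"
      have y: "y \<in> Delta" unfolding y_def using segment_in_Delta[OF w v] t by simp
      have yw: "y - w = t *\<^sub>R (v - w)" by (simp add: y_def)
      have "t * (norm (v - w) + 1) \<le> d / (2 * (norm (v - w) + 1)) * (norm (v - w) + 1)"
        by (intro mult_right_mono) (auto simp: t_def)
      also have "\<dots> = d / 2"
      proof -
        have *: "d / (2 * N) * N = d / 2" if "N \<noteq> 0" for N :: real using that by simp
        show ?thesis by (rule *) (use pos in simp)
      qed
      finally have "norm (y - w) < d" using t d unfolding yw by (simp add: distrib_left)
      from dd[OF y this] have 1: "cmod (f y - f w - pairing g (y - w)) \<le> e * (t * norm (v - w))"
        using t by (simp add: yw)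
      have "\<bar>y $ i - w $ i\<bar> = t * \<bar>v $ i - w $ i\<bar>" for i
        using arg_cong[OF yw, of "\<lambda>z. \<bar>z $ i\<bar>"] t by (simp add: abs_mult)
      then have "l1_dist y w = t * l1_dist v w"
        by (simp add: l1_dist_def sum_distrib_left)
      then have "cmod (f y - f w) \<le> B * (t * l1_dist v w)" using lip[OF y] by simp
      also have "\<dots> \<le> \<bar>B\<bar> * (t * 2)"
        using l1_dist_Delta_le[OF v w] l1_dist_nonneg[of v w] t by (intro mult_mono) auto
      finally have 2: "cmod (f y - f w) \<le> \<bar>B\<bar> * (t * 2)" .
      have "cmod (pairing g (y - w)) \<le> cmod (f y - f w) + cmod (f y - f w - pairing g (y - w))"
        by (metis norm_minus_commute norm_triangle_sub)
      then have "t * cmod (pairing g (v - w)) \<le> t * (2 * \<bar>B\<bar> + e * norm (v - w))"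
        using 1 2 t unfolding yw P.scaleR by (simp add: algebra_simps)
      then show ?thesis using t by simp
    qed
    note le = this
    have *: "cmod (pairing g (v - w)) \<le> 2 * \<bar>B\<bar> + e" if e: "0 < e" for e
    proof -
      define c where "c = e / (norm (v - w) + 1)"
      have pos: "0 < norm (v - w) + 1" by (simp add: add_nonneg_pos)
      have c: "0 < c" "c * (norm (v - w) + 1) = e" using pos e by (auto simp: c_def)
      have "c * norm (v - w) \<le> e" using c by (simp add: distrib_left)
      then show ?thesis using le[OF c(1)] by linarith
    qed
    have "cmod (pairing g (v - w)) \<le> 2 * \<bar>B\<bar>" by (rule field_le_epsilon) (rule *)
    then show ?thesis by (simp add: pairing_def)
  qed
  from tangential_bound[OF _ _ this] f show ?thesis by (simp add: has_gradient_iff)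
qed

lemma has_gradient_diff:
  "has_gradient f g w \<Longrightarrow> has_gradient f' g' w \<Longrightarrow> has_gradient (\<lambda>x. f x - f' x) (g - g' :: 'n cvec) w"
proof -
  assume a: "has_gradient f g w" "has_gradient f' g' w"
  have "(\<lambda>v. pairing g v - pairing g' v) = pairing (g - g')"
    by (rule ext) (simp add: pairing_diff)
  then show ?thesis
    using a has_derivative_diff[of f "pairing g" "at w within Delta" f' "pairing g'"]
    by (simp add: has_gradient_iff sum_subtractf)
qed

lemma has_gradient_add:
  "has_gradient f g w \<Longrightarrow> has_gradient f' g' w \<Longrightarrow> has_gradient (\<lambda>x. f x + f' x) (g + g' :: 'n cvec) w"
proof -
  assume a: "has_gradient f g w" "has_gradient f' g' w"
  have "(\<lambda>v. pairing g v + pairing g' v) = pairing (g + g')"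
    by (rule ext) (simp add: pairing_def sum.distrib distrib_right)
  then show ?thesis
    using a has_derivative_add[of f "pairing g" "at w within Delta" f' "pairing g'"]
    by (simp add: has_gradient_iff sum.distrib)
qed

lemma has_gradient_cmult:
  "has_gradient f g w \<Longrightarrow> has_gradient (\<lambda>x. c * f x) (c *s g :: 'n cvec) w"
proof -
  assume a: "has_gradient f g w"
  have "(\<lambda>v. c * pairing g v) = pairing (c *s g)"
    by (rule ext) (simp add: pairing_def sum_distrib_left mult.assoc)
  moreover have "(\<Sum>i\<in>UNIV. c * g $ i) = 0" using a by (simp add: has_gradient_iff sum_distrib_left[symmetric])
  ultimately show ?thesis
    using a has_derivative_mult_right[of f "pairing g" "at w within Delta" c] by (simp add: has_gradient_iff)
qed

text \<open>The difference of the candidates is a gradient of the zero function, and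
  \<open>gradient_le\<close> with bound 0 applies. This justifies the definite description in
  \<open>grad\<close>.\<close>

lemma has_gradient_unique:
  assumes "has_gradient f g w" "has_gradient f g' w" "w \<in> (Delta :: 'n rvec set)"
  shows "g = g'"
proof -
  have "norm (g - g') \<le> 8 * real CARD('n) ^ 2 * \<bar>0\<bar>"
    by (rule gradient_le[OF has_gradient_diff[OF assms(1,2)] assms(3)]) simp
  then show ?thesis by simp
qed

lemma grad_eq: "has_gradient f g w \<Longrightarrow> w \<in> (Delta :: 'n rvec set) \<Longrightarrow> grad f w = g"
  unfolding grad_def by (rule the_equality) (auto intro: has_gradient_unique)

text \<open>Increments within \<open>Delta\<close> are tangent vectors, on which a derivative and
  its tangential representative agree.\<close>

lemma has_gradientI:
  assumes F: "(f has_derivative F) (at w within Delta)" and w: "w \<in> (Delta :: 'n rvec set)"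
  shows "has_gradient f (tangential F) w"
proof -
  interpret F: bounded_linear F using F by (rule has_derivative_bounded_linear)
  define a where "a = (\<Sum>k | k < last_ix. F (axis k 1)) / of_nat (card {k. k < (last_ix :: 'n)})"
  have c: "card {k. k < (last_ix :: 'n)} \<noteq> 0" using penult_less_last by auto
  have Fv: "F v = (\<Sum>i\<in>UNIV. F (axis i 1) * of_real (v $ i))" for v
  proof -
    have "F v = F (\<Sum>i\<in>UNIV. v $ i *\<^sub>R axis i 1)"
      using basis_expansion[of v] by (simp add: scalar_mult_eq_scaleR)
    also have "\<dots> = (\<Sum>i\<in>UNIV. F (axis i 1) * of_real (v $ i))"
      unfolding F.sum F.scaleR by (simp add: scaleR_conv_of_real[of _ "_ :: complex"] mult.commute)
    finally show ?thesis .
  qed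
  have remove: "(\<Sum>i\<in>UNIV. h i) = h last_ix + (\<Sum>i | i < last_ix. h i)" for h :: "'n \<Rightarrow> complex"
    unfolding UNIV_minus_last[symmetric] by (rule sum.remove) auto
  have eq: "pairing (tangential F) (v - w) = F (v - w)" if v: "v \<in> Delta" for v
  proof -
    have s: "(\<Sum>i | i < last_ix. complex_of_real ((v - w) $ i)) = 0"
      using DeltaD(3)[OF v] DeltaD(3)[OF w] by (simp add: sum_subtractf of_real_sum[symmetric] del: of_real_sum)
    have "pairing (tangential F) (v - w) = (\<Sum>i | i < last_ix. (F (axis i 1) - a) * of_real ((v - w) $ i))"
      unfolding pairing_def remove by (auto simp: tangential_def a_def intro!: sum.cong)
    also have "\<dots> = (\<Sum>i | i < last_ix. F (axis i 1) * of_real ((v - w) $ i)) - a * (\<Sum>i | i < last_ix. of_real ((v - w) $ i))"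
      by (simp only: left_diff_distrib sum_subtractf sum_distrib_left)
    also have "\<dots> = (\<Sum>i | i < last_ix. F (axis i 1) * of_real ((v - w) $ i))" unfolding s by simp
    also have "\<dots> = F (v - w)" unfolding Fv[of "v - w"] remove using DeltaD(2)[OF v] DeltaD(2)[OF w] by simp
    finally show ?thesis .
  qed
  have "(f has_derivative pairing (tangential F)) (at w within Delta)"
    unfolding has_derivative_within_alt
    using F eq pairing_linear unfolding has_derivative_within_alt by simp
  moreover have "(\<Sum>i\<in>UNIV. tangential F $ i) = 0"
  proof -
    have "(\<Sum>i\<in>UNIV. tangential F $ i) = (\<Sum>i | i < last_ix. F (axis i 1) - a)"
      unfolding remove by (auto simp: tangential_def a_def intro!: sum.cong)
    also have "\<dots> = 0" using c by (simp add: sum_subtractf a_def)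
    finally show ?thesis .
  qed
  ultimately show ?thesis by (simp add: has_gradient_iff tangential_def)
qed

section \<open>The space of C1 functions and its norm\<close>

lemma C1I:
  assumes f: "\<And>w. w \<notin> Delta \<Longrightarrow> f w = 0"
    and F: "\<And>w. w \<in> Delta \<Longrightarrow> (f has_derivative F w) (at w within (Delta :: 'n rvec set))"
    and cont: "\<And>v. continuous_on Delta (\<lambda>w. F w v)"
  shows "f \<in> C1"
proof -
  have "continuous_on Delta (\<lambda>w. tangential (F w))"
    unfolding tangential_def
  proof (intro continuous_on_vec_lambda)
    fix i :: 'n
    show "continuous_on Delta (\<lambda>w. if i = last_ix then 0
        else F w (axis i 1) - (\<Sum>k | k < last_ix. F w (axis k 1)) / of_nat (card {k. k < (last_ix :: 'n)}))"
      using penult_less_last by (cases "i = last_ix") (auto intro!: continuous_intros cont)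
  qed
  then show ?thesis using f has_gradientI[OF F] unfolding C1_def by blast
qed

lemma C1D:
  assumes "f \<in> (C1 :: ('n rvec \<Rightarrow> complex) set)"
  shows "w \<notin> Delta \<Longrightarrow> f w = 0" "w \<in> Delta \<Longrightarrow> has_gradient f (grad f w) w" "continuous_on Delta (grad f)"
proof -
  obtain G where G: "continuous_on Delta G" "\<And>w. w \<in> Delta \<Longrightarrow> has_gradient f (G w) w"
    using assms unfolding C1_def by blast
  have eq: "grad f w = G w" if "w \<in> Delta" for w by (rule grad_eq[OF G(2)[OF that] that])
  show "w \<notin> Delta \<Longrightarrow> f w = 0" using assms unfolding C1_def by blast
  show "w \<in> Delta \<Longrightarrow> has_gradient f (grad f w) w" using G(2) eq by simp
  show "continuous_on Delta (grad f)" using G(1) eq continuous_on_cong by metis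
qed

lemma C1_continuous: "f \<in> (C1 :: ('n rvec \<Rightarrow> complex) set) \<Longrightarrow> continuous_on Delta f"
  unfolding continuous_on_eq_continuous_within
  using C1D(2) has_derivative_continuous unfolding has_gradient_iff by blast

lemma C1_add:
  assumes f: "f \<in> C1" and g: "g \<in> (C1 :: ('n rvec \<Rightarrow> complex) set)" shows "f + g \<in> C1"
    and "w \<in> Delta \<Longrightarrow> grad (f + g) w = grad f w + grad g w"
proof -
  have *: "has_gradient (f + g) (grad f w + grad g w) w" if "w \<in> Delta" for w
    using has_gradient_add[OF C1D(2)[OF f that] C1D(2)[OF g that]] by (simp add: plus_fun_def)
  have "continuous_on Delta (\<lambda>w. grad f w + grad g w)"
    by (intro continuous_intros C1D(3) f g)
  then show "f + g \<in> C1"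
    using * C1D(1)[OF f] C1D(1)[OF g] unfolding C1_def by (auto intro!: exI[of _ "\<lambda>w. grad f w + grad g w"])
  show "w \<in> Delta \<Longrightarrow> grad (f + g) w = grad f w + grad g w" using grad_eq[OF *] by blast
qed

lemma C1_cscale:
  assumes f: "f \<in> (C1 :: ('n rvec \<Rightarrow> complex) set)" shows "cscale c f \<in> C1"
    and "w \<in> Delta \<Longrightarrow> grad (cscale c f) w = c *s grad f w"
proof -
  have *: "has_gradient (cscale c f) (c *s grad f w) w" if "w \<in> Delta" for w
    using has_gradient_cmult[OF C1D(2)[OF f that]] by (simp add: cscale_def)
  have "continuous_on Delta (\<lambda>w. c *s grad f w)"
    unfolding vector_scalar_mult_def by (intro continuous_intros C1D(3) f)
  then show "cscale c f \<in> C1"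
    using * C1D(1)[OF f] unfolding C1_def by (auto simp: cscale_def intro!: exI[of _ "\<lambda>w. c *s grad f w"])
  show "w \<in> Delta \<Longrightarrow> grad (cscale c f) w = c *s grad f w" using grad_eq[OF *] by blast
qed

lemma C1_norm_bounds:
  assumes f: "f \<in> (C1 :: ('n rvec \<Rightarrow> complex) set)" and w: "w \<in> Delta"
  shows "cmod (f w) \<le> (SUP w\<in>Delta. norm (f w))" "norm (grad f w) \<le> (SUP w\<in>Delta. norm (grad f w))"
proof -
  have "compact ((\<lambda>w. norm (f w)) ` Delta)" "compact ((\<lambda>w. norm (grad f w)) ` Delta)"
    using C1_continuous[OF f] C1D(3)[OF f] by (auto intro!: compact_continuous_image continuous_intros Delta_compact)
  then show "cmod (f w) \<le> (SUP w\<in>Delta. norm (f w))" "norm (grad f w) \<le> (SUP w\<in>Delta. norm (grad f w))"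
    using w by (auto intro!: cSUP_upper dest!: compact_imp_bounded bounded_imp_bdd_above)
qed

text \<open>One half of the norm equivalence: the mean value inequality on the convex set
  \<open>Delta\<close>, with the Euclidean norm bounded by the l1 distance.\<close>

lemma C1_lip_le:
  assumes f: "f \<in> (C1 :: ('n rvec \<Rightarrow> complex) set)"
  shows "Delta.lip_le f (C1_norm f)"
proof (rule Delta.lip_leI)
  have 0: "0 \<le> (SUP w\<in>Delta. norm (f w))" "0 \<le> (SUP w\<in>Delta. norm (grad f w))"
    using Delta_nonempty C1_norm_bounds[OF f] norm_ge_zero order_trans by (metis ex_in_conv)+
  show "cmod (f w) \<le> C1_norm f" if "w \<in> Delta" for w
    using C1_norm_bounds(1)[OF f that] 0 by (simp add: C1_norm_def)
  show "cmod (f x - f y) \<le> C1_norm f * l1_dist x y" if x: "x \<in> Delta" and y: "y \<in> Delta" for x y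
  proof -
    have "cmod (f x - f y) \<le> (SUP w\<in>Delta. norm (grad f w)) * norm (x - y)"
    proof (rule differentiable_bound[OF Delta_convex _ _ x y])
      fix w assume w: "w \<in> (Delta :: 'n rvec set)"
      show "(f has_derivative pairing (grad f w)) (at w within Delta)"
        using C1D(2)[OF f w] by (simp add: has_gradient_iff)
      have "onorm (pairing (grad f w)) \<le> norm (grad f w)"
        by (rule onorm_bound) (auto simp: pairing_le)
      then show "onorm (pairing (grad f w)) \<le> (SUP w\<in>Delta. norm (grad f w))"
        using C1_norm_bounds(2)[OF f w] by simp
    qed
    also have "\<dots> \<le> C1_norm f * l1_dist x y"
      using 0 by (intro mult_mono norm_le_l1_dist) (auto simp: C1_norm_def)
    finally show ?thesis .
  qed
qed

text \<open>The other half, from \<open>gradient_le\<close>. It turns the abstract Lipschitz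
  estimates into estimates in the norm of \<open>C1\<close>.\<close>

lemma C1_norm_le:
  assumes f: "f \<in> (C1 :: ('n rvec \<Rightarrow> complex) set)" and B: "Delta.lip_le f B"
  shows "C1_norm f \<le> (1 + 8 * real CARD('n) ^ 2) * B"
proof -
  have "(SUP w\<in>Delta. norm (f w)) \<le> B"
    by (rule cSUP_least[OF Delta_nonempty]) (rule Delta.lip_leD(1)[OF B])
  moreover have "(SUP w\<in>Delta. norm (grad f w)) \<le> 8 * real CARD('n) ^ 2 * B"
  proof (rule cSUP_least[OF Delta_nonempty])
    fix w assume w: "w \<in> (Delta :: 'n rvec set)"
    show "norm (grad f w) \<le> 8 * real CARD('n) ^ 2 * B"
      using gradient_le[OF C1D(2)[OF f w] w] Delta.lip_leD(2)[OF B _ w] Delta.lip_le_nonneg[OF B] by fastforce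
  qed
  ultimately show ?thesis by (simp add: C1_norm_def algebra_simps)
qed

lemma norm_vector_scalar_mult: "norm (c *s g) = cmod c * norm (g :: 'n cvec)"
  by (simp add: norm_vec_def norm_mult L2_set_left_distrib[symmetric] L2_set_right_distrib)

lemma C1_norm_triangle:
  assumes f: "f \<in> C1" and g: "g \<in> (C1 :: ('n rvec \<Rightarrow> complex) set)"
  shows "C1_norm (f + g) \<le> C1_norm f + C1_norm g"
proof -
  have "(SUP w\<in>Delta. norm ((f + g) w)) \<le> (SUP w\<in>Delta. norm (f w)) + (SUP w\<in>Delta. norm (g w))"
    using C1_norm_bounds(1)[OF f] C1_norm_bounds(1)[OF g]
    by (intro cSUP_least[OF Delta_nonempty]) (auto intro: norm_triangle_mono)
  moreover have "(SUP w\<in>Delta. norm (grad (f + g) w)) \<le> (SUP w\<in>Delta. norm (grad f w)) + (SUP w\<in>Delta. norm (grad g w))"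
    using C1_norm_bounds(2)[OF f] C1_norm_bounds(2)[OF g]
    by (intro cSUP_least[OF Delta_nonempty]) (auto simp: C1_add(2)[OF f g] intro: norm_triangle_mono)
  ultimately show ?thesis by (simp add: C1_norm_def)
qed

lemma C1_norm_cscale:
  assumes f: "f \<in> (C1 :: ('n rvec \<Rightarrow> complex) set)"
  shows "C1_norm (cscale c f) = cmod c * C1_norm f"
proof -
  have le: "C1_norm (cscale c f) \<le> cmod c * C1_norm f" if f: "f \<in> (C1 :: ('n rvec \<Rightarrow> complex) set)" for f c
  proof -
    have "(SUP w\<in>Delta. norm (cscale c f w)) \<le> cmod c * (SUP w\<in>Delta. norm (f w))"
      using C1_norm_bounds(1)[OF f]
      by (intro cSUP_least[OF Delta_nonempty]) (auto simp: cscale_def norm_mult intro: mult_left_mono)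
    moreover have "(SUP w\<in>Delta. norm (grad (cscale c f) w)) \<le> cmod c * (SUP w\<in>Delta. norm (grad f w))"
      using C1_norm_bounds(2)[OF f]
      by (intro cSUP_least[OF Delta_nonempty])
        (auto simp: C1_cscale(2)[OF f] norm_vector_scalar_mult intro: mult_left_mono)
    ultimately show ?thesis by (simp add: C1_norm_def distrib_left)
  qed
  show ?thesis
  proof (cases "c = 0")
    case True
    have "Delta.lip_le (cscale 0 f) 0" by (simp add: Delta.lip_le_def cscale_def)
    then have "C1_norm (cscale 0 f) \<le> 0" using C1_norm_le[OF C1_cscale(1)[OF f, of 0]] by fastforce
    moreover have "0 \<le> C1_norm (cscale 0 f)"
      using Delta.lip_le_nonneg[OF C1_lip_le[OF C1_cscale(1)[OF f, of 0]]] .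
    ultimately show ?thesis using True by simp
  next
    case False
    have "cscale (1 / c) (cscale c f) = f" using False by (simp add: cscale_def)
    then have "C1_norm f \<le> cmod (1 / c) * C1_norm (cscale c f)"
      using le[OF C1_cscale(1)[OF f, of c], of "1 / c"] by simp
    then have "cmod c * C1_norm f \<le> C1_norm (cscale c f)"
      using False by (simp add: norm_divide field_simps)
    then show ?thesis using le[OF f, of c] by simp
  qed
qed

text \<open>By \<open>gradient_le\<close> approximants close in the Lipschitz norm have uniformly
  close gradients, so the gradients converge uniformly. Their limit is a gradient of
  \<open>f\<close>, since the Lipschitz bound on \<open>f - g k\<close> also controls the increments
  of the error.\<close>

lemma C1_closed:
  assumes f: "\<And>w. w \<notin> Delta \<Longrightarrow> f w = 0"
    and approx: "\<And>e. 0 < e \<Longrightarrow> \<exists>g\<in>C1. Delta.lip_le (\<lambda>w. f w - g w) e"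
  shows "f \<in> (C1 :: ('n rvec \<Rightarrow> complex) set)"
proof -
  define e where "e k = inverse (real (Suc k))" for k
  have e: "0 < e k" for k by (simp add: e_def)
  have e0: "e \<longlonglongrightarrow> 0" unfolding e_def by (rule LIMSEQ_inverse_real_of_nat)
  obtain g where g: "\<And>k. g k \<in> C1" and fg: "\<And>k. Delta.lip_le (\<lambda>w. f w - g k w) (e k)"
    using approx[OF e] by metis
  define M where "M = 8 * real CARD('n) ^ 2"
  define G where "G k = grad (g k)" for k
  have Gd: "norm (G k w - G l w) \<le> M * (e k + e l)" if w: "w \<in> Delta" for k l w
  proof -
    have hg: "has_gradient (\<lambda>x. g k x - g l x) (G k w - G l w) w"
      unfolding G_def by (intro has_gradient_diff C1D(2) g w)
    have "Delta.lip_le (\<lambda>x. (f x - g l x) - (f x - g k x)) (e l + e k)"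
      by (intro Delta.lip_le_diff fg)
    then have "Delta.lip_le (\<lambda>x. g k x - g l x) (e k + e l)" by (simp add: add.commute)
    from gradient_le[OF hg w Delta.lip_leD(2)[OF this _ w]] show ?thesis
      using e[of k] e[of l] by (simp add: M_def)
  qed
  have "convergent (\<lambda>k. G k w)" if w: "w \<in> Delta" for w
  proof (rule Cauchy_convergent, rule metric_CauchyI)
    fix r :: real assume r: "0 < r"
    have "(\<lambda>k. M * (e k + e k)) \<longlonglongrightarrow> M * (0 + 0)" by (intro tendsto_intros e0)
    then have "eventually (\<lambda>k. M * (e k + e k) < r) sequentially"
      using r by (intro order_tendstoD) auto
    then obtain N where N: "M * (e N + e N) < r" by (auto simp: eventually_sequentially)
    have "dist (G k w) (G l w) < r" if "N \<le> k" "N \<le> l" for k l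
    proof -
      have "e k \<le> e N" "e l \<le> e N" using that by (auto simp: e_def field_simps)
      then have "M * (e k + e l) \<le> M * (e N + e N)" by (intro mult_left_mono add_mono) (auto simp: M_def)
      then show ?thesis using Gd[OF w, of k l] N by (simp add: dist_norm)
    qed
    then show "\<exists>N. \<forall>m\<ge>N. \<forall>n\<ge>N. dist (G m w) (G n w) < r" by blast
  qed
  then obtain H where H: "\<And>w. w \<in> Delta \<Longrightarrow> (\<lambda>k. G k w) \<longlonglongrightarrow> H w"
    unfolding convergent_def by metis
  have HG: "norm (H w - G k w) \<le> M * e k" if w: "w \<in> Delta" for w k
  proof (rule LIMSEQ_le)
    show "(\<lambda>l. norm (G l w - G k w)) \<longlonglongrightarrow> norm (H w - G k w)" by (intro tendsto_intros H w)
    have "(\<lambda>l. M * (e l + e k)) \<longlonglongrightarrow> M * (0 + e k)" by (intro tendsto_intros e0)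
    then show "(\<lambda>l. M * (e l + e k)) \<longlonglongrightarrow> M * e k" by simp
  qed (use Gd[OF w] in auto)
  have Me0: "(\<lambda>k. M * e k) \<longlonglongrightarrow> 0" using tendsto_mult[OF tendsto_const e0, of M] by simp
  have "uniform_limit Delta G H sequentially"
  proof (rule uniform_limitI)
    fix r :: real assume "0 < r"
    then have "eventually (\<lambda>k. M * e k < r) sequentially" using Me0 by (intro order_tendstoD) auto
    then show "\<forall>\<^sub>F k in sequentially. \<forall>w\<in>Delta. dist (G k w) (H w) < r"
    proof (rule eventually_mono)
      fix k assume "M * e k < r"
      then show "\<forall>w\<in>Delta. dist (G k w) (H w) < r"
        using le_less_trans[OF HG] by (simp add: dist_norm norm_minus_commute)
    qed
  qed
  then have Hc: "continuous_on Delta H"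
    by (intro uniform_limit_theorem[where f = G and F = sequentially]) (simp_all add: G_def C1D(3) g)
  have "has_gradient f (H w) w" if w: "w \<in> Delta" for w
    unfolding has_gradient_iff has_derivative_within_alt
  proof (intro conjI allI impI)
    show "bounded_linear (pairing (H w))" by (rule pairing_linear)
    have Gk: "G k w $ last_ix = 0" "(\<Sum>i\<in>UNIV. G k w $ i) = 0" for k
      using C1D(2)[OF g w] by (auto simp: has_gradient_iff G_def)
    show "H w $ last_ix = 0"
      using LIMSEQ_unique[OF tendsto_vec_nth[OF H[OF w], of last_ix]] by (simp add: Gk)
    have "(\<lambda>k. \<Sum>i\<in>UNIV. G k w $ i) \<longlonglongrightarrow> (\<Sum>i\<in>UNIV. H w $ i)"
      by (intro tendsto_intros H w)
    then show "(\<Sum>i\<in>UNIV. H w $ i) = 0" using LIMSEQ_unique by (auto simp: Gk)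
    fix r :: real assume r: "0 < r"
    \<comment> \<open>Two errors share \<open>r / 2\<close>: the increment of
      \<open>f - g k\<close>, with the factor \<open>CARD('n)\<close> for passing from l1 to
      Euclidean distance, and the gradient error \<open>M * e k\<close>. The derivative of
      \<open>g k\<close> uses the other half.\<close>
    have "(\<lambda>k. (real CARD('n) + M) * e k) \<longlonglongrightarrow> (real CARD('n) + M) * 0" by (intro tendsto_intros e0)
    then have "eventually (\<lambda>k. (real CARD('n) + M) * e k < r / 2) sequentially"
      using r by (intro order_tendstoD) auto
    then obtain k where k: "(real CARD('n) + M) * e k < r / 2" by (auto simp: eventually_sequentially)
    obtain \<delta> where \<delta>: "0 < \<delta>" and d: "\<And>y. y \<in> Delta \<Longrightarrow> norm (y - w) < \<delta> \<Longrightarrow>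
        norm (g k y - g k w - pairing (G k w) (y - w)) \<le> r / 2 * norm (y - w)"
      using C1D(2)[OF g w, of k] r unfolding has_gradient_iff has_derivative_within_alt G_def
      by (metis half_gt_zero)
    have "norm (f y - f w - pairing (H w) (y - w)) \<le> r * norm (y - w)" if y: "y \<in> Delta" "norm (y - w) < \<delta>" for y
    proof -
      have "f y - f w - pairing (H w) (y - w) = ((f y - g k y) - (f w - g k w)) + (g k y - g k w - pairing (G k w) (y - w))
          - pairing (H w - G k w) (y - w)"
        by (simp add: pairing_diff)
      moreover have "norm ((f y - g k y) - (f w - g k w)) \<le> e k * (real CARD('n) * norm (y - w))"
        using Delta.lip_leD(2)[OF fg y(1) w, of k] mult_left_mono[OF l1_dist_le_norm[of y w] less_imp_le[OF e[of k]]] by linarith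
      moreover have "norm (pairing (H w - G k w) (y - w)) \<le> M * e k * norm (y - w)"
        using pairing_le[of "H w - G k w" "y - w"] mult_right_mono[OF HG[OF w, of k] norm_ge_zero[of "y - w"]] by linarith
      ultimately have "norm (f y - f w - pairing (H w) (y - w)) \<le> e k * (real CARD('n) * norm (y - w)) + r / 2 * norm (y - w) + M * e k * norm (y - w)"
        using d[OF y] by (smt (verit) norm_triangle_ineq norm_triangle_ineq4)
      also have "\<dots> = ((real CARD('n) + M) * e k + r / 2) * norm (y - w)" by (simp add: algebra_simps)
      also have "\<dots> \<le> r * norm (y - w)" using k by (intro mult_right_mono) auto
      finally show ?thesis .
    qed
    then show "\<exists>\<delta>>0. \<forall>y\<in>Delta. norm (y - w) < \<delta> \<longrightarrow> norm (f y - f w - pairing (H w) (y - w)) \<le> r * norm (y - w)"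
      using \<delta> by blast
  qed
  then show ?thesis using f Hc unfolding C1_def by blast
qed

section \<open>The transfer operator\<close>

lemma C1_diff: "f \<in> C1 \<Longrightarrow> g \<in> (C1 :: ('n rvec \<Rightarrow> complex) set) \<Longrightarrow> f - g \<in> C1"
  using C1_add(1)[of f "cscale (-1) g"] C1_cscale(1)[of g "-1"]
  by (simp add: cscale_def fun_diff_def plus_fun_def)

lemma C1_zero: "0 \<in> (C1 :: ('n rvec \<Rightarrow> complex) set)"
  by (rule C1I[where F = "\<lambda>_ _. 0"]) (simp_all add: zero_fun_def)

lemma C1_sum: "(\<And>i. i \<in> J \<Longrightarrow> F i \<in> (C1 :: ('n rvec \<Rightarrow> complex) set)) \<Longrightarrow> sum F J \<in> C1"
  by (induction J rule: infinite_finite_induct) (simp_all add: C1_zero C1_add(1))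

lemma sum_fun_apply: "(\<Sum>i\<in>J. F i) x = (\<Sum>i\<in>J. F i x :: complex)"
  by (induction J rule: infinite_finite_induct) simp_all

text \<open>The series converges pointwise, with remainders bounded in the Lipschitz norm by the
  tails of the norm series. \<open>C1_closed\<close> then applies to the partial sums, and
  \<open>C1_norm_le\<close> returns to the original norm.\<close>

lemma C1_complete:
  assumes u: "\<And>k. u k \<in> (C1 :: ('n rvec \<Rightarrow> complex) set)" and sm: "summable (\<lambda>k. C1_norm (u k))"
  shows "\<exists>v\<in>C1. (\<lambda>n. C1_norm (v - (\<Sum>k<n. u k))) \<longlonglongrightarrow> 0"
proof -
  define t where "t n = (\<Sum>k. C1_norm (u (k + n)))" for n
  have lip: "Delta.lip_le (u k) (C1_norm (u k))" for k by (rule C1_lip_le[OF u])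
  have smn: "summable (\<lambda>k. C1_norm (u (k + n)))" for n using sm by (rule summable_ignore_initial_segment)
  have t0: "t \<longlonglongrightarrow> 0" unfolding t_def using suminf_exist_split2[OF sm] .
  have su: "summable (\<lambda>k. u (k + n) w)" if "w \<in> Delta" for w n
    by (rule summable_comparison_test'[OF smn, of 0]) (use Delta.lip_leD(1)[OF lip that] in auto)
  define v where "v w = (\<Sum>k. u k w)" for w
  have v0: "v w = 0" if "w \<notin> Delta" for w using C1D(1)[OF u that] by (simp add: v_def)
  have vP: "v w - (\<Sum>k<n. u k w) = (\<Sum>k. u (k + n) w)" if "w \<in> Delta" for w n
    using suminf_split_initial_segment[OF su[OF that, of 0, simplified], of n] by (simp add: v_def)
  have rest: "Delta.lip_le (\<lambda>w. \<Sum>k. u (k + n) w) (t n)" for n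
  proof (rule Delta.lip_leI)
    fix x assume x: "x \<in> (Delta :: 'n rvec set)"
    have sn: "summable (\<lambda>k. norm (u (k + n) x))"
      by (rule summable_comparison_test'[OF smn, of 0]) (use Delta.lip_leD(1)[OF lip x] in auto)
    then have "norm (\<Sum>k. u (k + n) x) \<le> (\<Sum>k. norm (u (k + n) x))" by (rule summable_norm)
    also have "\<dots> \<le> t n" unfolding t_def by (rule suminf_le[OF _ sn smn]) (rule Delta.lip_leD(1)[OF lip x])
    finally show "norm (\<Sum>k. u (k + n) x) \<le> t n" .
    fix y assume y: "y \<in> (Delta :: 'n rvec set)"
    have b: "norm (u (k + n) x - u (k + n) y) \<le> C1_norm (u (k + n)) * l1_dist x y" for k
      by (rule Delta.lip_leD(2)[OF lip x y])
    have sd: "summable (\<lambda>k. C1_norm (u (k + n)) * l1_dist x y)" using smn by (rule summable_mult2)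
    have sn: "summable (\<lambda>k. norm (u (k + n) x - u (k + n) y))"
      by (rule summable_comparison_test'[OF sd, of 0]) (use b in auto)
    have "(\<Sum>k. u (k + n) x) - (\<Sum>k. u (k + n) y) = (\<Sum>k. u (k + n) x - u (k + n) y)"
      by (rule suminf_diff[OF su[OF x] su[OF y]])
    also have "norm \<dots> \<le> (\<Sum>k. norm (u (k + n) x - u (k + n) y))" by (rule summable_norm[OF sn])
    also have "\<dots> \<le> (\<Sum>k. C1_norm (u (k + n)) * l1_dist x y)" by (rule suminf_le[OF b sn sd])
    also have "\<dots> = t n * l1_dist x y" unfolding t_def by (rule suminf_mult2[OF smn, symmetric])
    finally show "norm ((\<Sum>k. u (k + n) x) - (\<Sum>k. u (k + n) y)) \<le> t n * l1_dist x y" .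
  qed
  have P: "(\<Sum>k<n. u k) \<in> C1" for n by (rule C1_sum) (rule u)
  have lipP: "Delta.lip_le (\<lambda>w. v w - (\<Sum>k<n. u k) w) (t n)" for n
    using rest[of n] vP[of _ n] by (simp add: sum_fun_apply Delta.lip_le_def)
  have v: "v \<in> C1"
  proof (rule C1_closed[OF v0])
    fix e :: real assume "0 < e"
    then have "eventually (\<lambda>n. t n < e) sequentially" using t0 by (intro order_tendstoD)
    then obtain n where "t n < e" by (auto simp: eventually_sequentially)
    then have "Delta.lip_le (\<lambda>w. v w - (\<Sum>k<n. u k) w) e" using Delta.lip_le_mono[OF lipP[of n]] by simp
    then show "\<exists>g\<in>C1. Delta.lip_le (\<lambda>w. v w - g w) e" using P by blast
  qed
  have "(\<lambda>n. C1_norm (v - (\<Sum>k<n. u k))) \<longlonglongrightarrow> 0"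
  proof (rule Lim_null_comparison)
    show "(\<lambda>n. (1 + 8 * real CARD('n) ^ 2) * t n) \<longlonglongrightarrow> 0"
      using tendsto_mult[OF tendsto_const t0] by simp
    have "norm (C1_norm (v - (\<Sum>k<n. u k))) \<le> (1 + 8 * real CARD('n) ^ 2) * t n" for n
    proof -
      have d: "v - (\<Sum>k<n. u k) \<in> C1" by (rule C1_diff[OF v P])
      have "Delta.lip_le (v - (\<Sum>k<n. u k)) (t n)" using lipP[of n] by (simp add: fun_diff_def)
      then show ?thesis using C1_norm_le[OF d] Delta.lip_le_nonneg[OF C1_lip_le[OF d]] by simp
    qed
    then show "\<forall>\<^sub>F n in sequentially. norm (C1_norm (v - (\<Sum>k<n. u k))) \<le> (1 + 8 * real CARD('n) ^ 2) * t n" by simp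
  qed
  then show ?thesis using v by blast
qed

lemma T_Gamma_linear:
  assumes "g \<in> (T_Gamma :: ('n rvec \<Rightarrow> 'n rvec) set)" shows "bounded_linear g"
proof -
  obtain A j where g: "g = (gamma penult_ix ^^ A) \<circ> gamma j" using assms by (rule T_GammaE)
  have "linear (gamma penult_ix ^^ A :: 'n rvec \<Rightarrow> 'n rvec)"
  proof (induction A)
    case (Suc A)
    then show ?case using linear_compose[OF Suc gamma_linear] by (simp add: o_def)
  qed (simp add: linear_id[unfolded id_def] id_def)
  from linear_compose[OF gamma_linear this] show ?thesis unfolding g linear_conv_bounded_linear .
qed

text \<open>A branch is a linear map divided by its last coordinate, which is at least 1 on
  \<open>Delta\<close>. So the quotient, chain and power rules yield the derivative
  \<open>F\<close>, continuous in the base point for each fixed direction.\<close>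

lemma weighted_C1:
  assumes g: "g \<in> T_Gamma" and f: "f \<in> (C1 :: ('n rvec \<Rightarrow> complex) set)"
  shows "(\<lambda>w. if w \<in> Delta then weight s g w *\<^sub>R f (proj_act g w) else 0) \<in> C1"
proof -
  interpret g: bounded_linear g by (rule T_Gamma_linear[OF g])
  define l where "l w = g w $ last_ix" for w
  have bl: "bounded_linear l"
    unfolding l_def[abs_def] using bounded_linear_compose[OF bounded_linear_vec_nth g.bounded_linear_axioms] .
  have l1: "1 \<le> l w" if "w \<in> Delta" for w using proj_act_in(2)[OF that g] by (simp add: l_def)
  define \<phi> where "\<phi> w = inverse (l w) *\<^sub>R g w" for w
  have \<phi>: "proj_act g w = \<phi> w" for w by (simp add: \<phi>_def proj_act_def l_def inverse_eq_divide)
  define D\<phi> where "D\<phi> w v = inverse (l w) *\<^sub>R g v + (- (inverse (l w) * l v * inverse (l w))) *\<^sub>R g w" for w v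
  define Dw where "Dw w v = l w powr (- s) * (0 * ln (l w) + l v * (- s) / l w)" for w v
  define F where "F w v = (l w powr (- s)) *\<^sub>R pairing (grad f (\<phi> w)) (D\<phi> w v) + Dw w v *\<^sub>R f (\<phi> w)" for w v
  have dl: "(l has_derivative l) (at w within Delta)" for w by (rule bounded_linear_imp_has_derivative[OF bl])
  have dg: "(g has_derivative g) (at w within Delta)" for w by (rule bounded_linear_imp_has_derivative[OF g.bounded_linear_axioms])
  have cl: "continuous_on Delta l" by (rule bounded_linear.continuous_on[OF bl continuous_on_id])
  have cg: "continuous_on Delta g" by (rule g.continuous_on[OF continuous_on_id])
  have c\<phi>: "continuous_on Delta \<phi>"
    unfolding \<phi>_def[abs_def] using l1 by (intro continuous_intros cl cg) fastforce
  have \<phi>D: "\<phi> ` Delta \<subseteq> Delta" using proj_act_in(1)[OF _ g] by (auto simp: \<phi>)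
  have D: "((\<lambda>w. (l w powr (- s)) *\<^sub>R f (\<phi> w)) has_derivative F w) (at w within Delta)" if w: "w \<in> Delta" for w
  proof -
    have lw: "0 < l w" using l1[OF w] by simp
    have d\<phi>: "(\<phi> has_derivative D\<phi> w) (at w within Delta)"
      unfolding \<phi>_def[abs_def] D\<phi>_def[abs_def]
      by (rule has_derivative_scaleR[OF Deriv.has_derivative_inverse[OF _ dl] dg]) (use lw in simp)
    have df: "((\<lambda>w. f (\<phi> w)) has_derivative (\<lambda>v. pairing (grad f (\<phi> w)) (D\<phi> w v))) (at w within Delta)"
      by (rule has_derivative_in_compose2[where t = Delta and g' = "\<lambda>w. pairing (grad f w)", OF _ \<phi>D w d\<phi>])
        (use C1D(2)[OF f] in \<open>simp add: has_gradient_iff\<close>)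
    have dw: "((\<lambda>w. l w powr (- s)) has_derivative Dw w) (at w within Delta)"
      unfolding Dw_def[abs_def] by (rule has_derivative_powr[OF dl has_derivative_const lw w])
    show ?thesis unfolding F_def[abs_def] by (rule has_derivative_scaleR[OF dw df])
  qed
  have cF: "continuous_on Delta (\<lambda>w. F w v)" for v
  proof -
    have cG: "continuous_on Delta (\<lambda>w. grad f (\<phi> w))"
      by (rule continuous_on_compose2[OF C1D(3)[OF f] c\<phi> \<phi>D])
    have cf: "continuous_on Delta (\<lambda>w. f (\<phi> w))"
      by (rule continuous_on_compose2[OF C1_continuous[OF f] c\<phi> \<phi>D])
    have l0: "\<forall>w\<in>Delta. l w \<noteq> 0" using l1 by fastforce
    have cD: "continuous_on Delta (\<lambda>w. D\<phi> w v)"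
      unfolding D\<phi>_def by (intro continuous_intros cl cg l0)
    have cp: "continuous_on Delta (\<lambda>w. l w powr (- s))"
      by (intro continuous_intros cl l0)
    have "continuous_on Delta (\<lambda>w. Dw w v)"
      unfolding Dw_def mult_zero_left add_0_left by (intro continuous_intros cl cp l0)
    then show ?thesis
      unfolding F_def pairing_def by (intro continuous_intros cp cG cD cf)
  qed
  show ?thesis
  proof (rule C1I[OF _ _ cF])
    fix w assume w: "w \<in> (Delta :: 'n rvec set)"
    show "((\<lambda>w. if w \<in> Delta then weight s g w *\<^sub>R f (proj_act g w) else 0) has_derivative F w) (at w within Delta)"
    proof (rule has_derivative_transform[OF w _ D[OF w]])
      fix x assume x: "x \<in> (Delta :: 'n rvec set)"
      have "weight s g x = l x powr (- s)"
        using l1[OF x] by (simp add: weight_eq[OF x] l_def powr_divide powr_minus_divide)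
      then show "(if x \<in> Delta then weight s g x *\<^sub>R f (proj_act g x) else 0) = l x powr (- s) *\<^sub>R f (\<phi> x)"
        using x by (simp add: \<phi>)
    qed
  qed simp
qed

definition unit_fun :: "'n rvec \<Rightarrow> complex" where
  "unit_fun w = (if w \<in> Delta then 1 else 0)"

lemma unit_fun_C1: "unit_fun \<in> C1"
proof (rule C1I[where F = "\<lambda>_ _. 0"])
  show "(unit_fun has_derivative (\<lambda>_. 0)) (at w within Delta)" if "w \<in> Delta" for w
    by (rule has_derivative_transform[OF that _ has_derivative_const[of 1]]) (simp add: unit_fun_def)
qed (simp_all add: unit_fun_def)

section \<open>Continuous functions and measures on the simplex\<close>

lemma lip_le_continuous:
  fixes f :: "'n rvec \<Rightarrow> 'b::real_normed_vector"
  assumes "Delta.lip_le f B" shows "continuous_on Delta f"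
proof -
  have "(B * real CARD('n))-lipschitz_on Delta f"
  proof (rule lipschitz_onI)
    show "0 \<le> B * real CARD('n)" using Delta.lip_le_nonneg[OF assms] by simp
    fix x y :: "'n rvec" assume "x \<in> Delta" "y \<in> Delta"
    then have "norm (f x - f y) \<le> B * l1_dist x y" by (rule Delta.lip_leD(2)[OF assms])
    also have "\<dots> \<le> B * (real CARD('n) * norm (x - y))"
      by (intro mult_left_mono l1_dist_le_norm Delta.lip_le_nonneg[OF assms])
    finally show "dist (f x) (f y) \<le> B * real CARD('n) * dist x y" by (simp add: dist_norm mult.assoc)
  qed
  then show ?thesis by (rule lipschitz_on_continuous_on)
qed

lemma continuous_approx:
  fixes f :: "'n rvec \<Rightarrow> real"
  assumes "continuous_on Delta f" "0 < e"
  shows "\<exists>g B. (\<forall>x\<in>Delta. \<bar>f x - g x\<bar> < e) \<and> Delta.lip_le g B"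
proof -
  obtain g B where g: "\<And>x. x \<in> Delta \<Longrightarrow> \<bar>f x - g x\<bar> < e" "\<And>x. x \<in> Delta \<Longrightarrow> \<bar>g x\<bar> \<le> B"
      "\<And>x y. x \<in> Delta \<Longrightarrow> y \<in> Delta \<Longrightarrow> \<bar>g x - g y\<bar> \<le> B * norm (x - y)"
    using lipschitz_approximation[OF Delta_compact assms] by blast
  have "0 \<le> B" using g(2) Delta_nonempty by force
  then have "\<bar>g x - g y\<bar> \<le> B * l1_dist x y" if "x \<in> Delta" "y \<in> Delta" for x y
    using g(3)[OF that] mult_left_mono[OF norm_le_l1_dist[of x y]] by fastforce
  then have "Delta.lip_le g B" using g(2) by (simp add: Delta.lip_le_def)
  then show ?thesis using g(1) by blast
qed

lemma continuous_on_uniform_approx: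
  fixes f :: "'n rvec \<Rightarrow> real"
  assumes "\<And>e. 0 < e \<Longrightarrow> \<exists>g. continuous_on S g \<and> (\<forall>x\<in>S. \<bar>f x - g x\<bar> < e)"
  shows "continuous_on S f"
proof -
  have "\<exists>g. continuous_on S g \<and> (\<forall>x\<in>S. \<bar>f x - g x\<bar> < inverse (real (Suc n)))" for n
    by (rule assms) simp
  then obtain g where g: "\<And>n. continuous_on S (g n)" "\<And>n x. x \<in> S \<Longrightarrow> \<bar>f x - g n x\<bar> < inverse (real (Suc n))"
    by metis
  have "uniform_limit S g f sequentially"
  proof (rule uniform_limitI)
    fix e :: real assume "0 < e"
    then have "eventually (\<lambda>n. inverse (real (Suc n)) < e) sequentially"
      using LIMSEQ_inverse_real_of_nat by (rule order_tendstoD[rotated])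
    then show "\<forall>\<^sub>F n in sequentially. \<forall>x\<in>S. dist (g n x) (f x) < e"
    proof (rule eventually_mono)
      fix n assume n: "inverse (real (Suc n)) < e"
      show "\<forall>x\<in>S. dist (g n x) (f x) < e"
        using less_trans[OF g(2) n] by (simp add: dist_real_def abs_minus_commute)
    qed
  qed
  then show ?thesis
    by (intro uniform_limit_theorem[where f = g and F = sequentially]) (simp_all add: g(1))
qed

lemma measure_on_Delta_integrable:
  fixes f :: "'n rvec \<Rightarrow> 'b::{banach, second_countable_topology}"
  assumes \<mu>: "measure_on_Delta \<mu>" and f: "continuous_on Delta f"
  shows "integrable \<mu> f"
proof -
  have fin: "finite_measure \<mu>" and sets: "sets \<mu> = sets (restrict_space borel Delta)"
    using \<mu> by (auto simp: measure_on_Delta_def)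
  have sp: "space \<mu> = Delta" using sets_eq_imp_space_eq[OF sets] by (simp add: space_restrict_space)
  obtain B where B: "\<And>x. x \<in> Delta \<Longrightarrow> norm (f x) \<le> B"
    using compact_imp_bounded[OF compact_continuous_image[OF f Delta_compact]] by (auto simp: bounded_iff)
  have "f \<in> borel_measurable \<mu>"
    unfolding measurable_cong_sets[OF sets refl] by (rule borel_measurable_continuous_on_restrict[OF f])
  then show ?thesis
    by (rule finite_measure.integrable_const_bound[OF fin AE_I2, rotated]) (use B sp in auto)
qed

lemma norm_integral_le:
  fixes f :: "'n rvec \<Rightarrow> 'b::{banach, second_countable_topology}"
  assumes "prob_space \<mu>" and \<mu>: "measure_on_Delta \<mu>" and f: "continuous_on Delta f"
    and B: "\<And>x. x \<in> Delta \<Longrightarrow> norm (f x) \<le> B"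
  shows "norm (integral\<^sup>L \<mu> f) \<le> B"
proof -
  interpret prob_space \<mu> by fact
  have sp: "space \<mu> = Delta"
    using \<mu> sets_eq_imp_space_eq[of \<mu> "restrict_space borel Delta"] by (simp add: measure_on_Delta_def space_restrict_space)
  have "norm (integral\<^sup>L \<mu> f) \<le> (\<integral>x. norm (f x) \<partial>\<mu>)" by (rule integral_norm_bound)
  also have "\<dots> \<le> (\<integral>x. B \<partial>\<mu>)"
    using B sp by (intro integral_mono integrable_norm measure_on_Delta_integrable \<mu> f) auto
  finally show ?thesis by (simp add: prob_space)
qed

section \<open>The spectral gap for a fixed exponent\<close>

context
  fixes s :: real
  assumes s: "1 < s"
begin

interpretation S: contracting_system "Delta :: 'n rvec set" l1_dist 2 T_Gamma proj_act "weight s" "2 / 3" "2 * s"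
  by (rule Delta_contracting[OF s])

lemma transfer_eq: "transfer s f = S.L f"
  by (rule ext) (simp add: transfer_def S.L_def weight_def scaleR_conv_of_real)

text \<open>Finite partial sums are in \<open>C1\<close> by \<open>weighted_C1\<close> and
  approximate the full sum in the Lipschitz norm, so \<open>C1_closed\<close> applies.\<close>

lemma transfer_in:
  assumes f: "f \<in> C1" shows "S.L f \<in> C1"
proof (rule C1_closed)
  show "S.L f w = 0" if "w \<notin> Delta" for w using that by (simp add: S.L_def)
  fix e :: real assume e: "0 < e"
  obtain J where J: "finite J" "J \<subseteq> T_Gamma"
    and lip: "Delta.lip_le (\<lambda>w. S.L f w - (\<Sum>g\<in>J. weight s g w *\<^sub>R f (proj_act g w))) e"
    using S.L_approx[OF C1_lip_le[OF f] e] by blast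
  let ?F = "\<lambda>g w. if w \<in> Delta then weight s g w *\<^sub>R f (proj_act g w) else 0"
  have "sum ?F J \<in> C1" using J weighted_C1[OF _ f] by (intro C1_sum) blast
  moreover have "Delta.lip_le (\<lambda>w. S.L f w - sum ?F J w) e"
    using lip by (simp add: Delta.lip_le_def sum_fun_apply)
  ultimately show "\<exists>g\<in>C1. Delta.lip_le (\<lambda>w. S.L f w - g w) e" by blast
qed

lemma C1_bounded: "f \<in> (C1 :: ('n rvec \<Rightarrow> complex) set) \<Longrightarrow> bounded (f ` Delta)"
  by (rule Delta.lip_le_bounded[OF C1_lip_le])

lemma transfer_bounded: "bounded_operator (C1 :: ('n rvec \<Rightarrow> complex) set) C1_norm (transfer s)"
  unfolding bounded_operator_def transfer_eq
proof (intro conjI ballI allI)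
  fix f assume f: "f \<in> (C1 :: ('n rvec \<Rightarrow> complex) set)"
  show "S.L f \<in> C1" by (rule transfer_in[OF f])
  show "S.L (cscale c f) = cscale c (S.L f)" for c
    unfolding cscale_def by (rule S.L_bounded_linear[OF bounded_linear_mult_right C1_bounded[OF f]])
  fix g assume g: "g \<in> (C1 :: ('n rvec \<Rightarrow> complex) set)"
  show "S.L (f + g) = S.L f + S.L g"
    using S.L_add[OF C1_bounded[OF f] C1_bounded[OF g]] by (simp add: plus_fun_def)
next
  have "C1_norm (S.L f) \<le> (1 + 8 * real CARD('n) ^ 2) * ((\<Sum>\<^sub>\<infinity>i\<in>T_Gamma. S.W i) * (1 + 2 * s)) * C1_norm f"
    if f: "f \<in> (C1 :: ('n rvec \<Rightarrow> complex) set)" for f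
    using C1_norm_le[OF transfer_in[OF f] S.L_lip_le[OF C1_lip_le[OF f]]] by (simp add: mult_ac)
  then show "\<exists>K. \<forall>f\<in>C1. C1_norm (S.L f :: 'n rvec \<Rightarrow> complex) \<le> K * C1_norm f" by blast
qed

text \<open>One branch with \<open>A = 0\<close> is enough, as its denominator
  \<open>2 - w $ j\<close> is at most 2.\<close>

lemma transfer_one_ge: "w \<in> Delta \<Longrightarrow> (1 / 2) powr s \<le> S.L (\<lambda>_. 1) w"
proof -
  assume w: "w \<in> Delta"
  obtain j :: 'n where j: "j < penult_ix" using exists_less_penult by blast
  have g: "gamma j = (gamma penult_ix ^^ 0) \<circ> gamma j" by simp
  have gT: "gamma j \<in> T_Gamma" unfolding T_Gamma_def using j g by blast
  have "gamma j w $ last_ix \<le> 2"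
    using branch(2)[OF w j g] H_cone_nonneg[OF DeltaD(1)[OF w], of j] by simp
  then have "1 / 2 \<le> 1 / gamma j w $ last_ix"
    using proj_act_in(2)[OF w gT] by (intro divide_left_mono) auto
  then have "(1 / 2) powr s \<le> weight s (gamma j) w"
    unfolding weight_eq[OF w] using s by (intro powr_mono2) auto
  also have "\<dots> = infsum (\<lambda>g. weight s g w) {gamma j}" by simp
  also have "\<dots> \<le> infsum (\<lambda>g. weight s g w) T_Gamma"
    by (rule infsum_mono2) (use gT w S.wt_pos in \<open>auto intro: S.wt_summable less_imp_le\<close>)
  finally show ?thesis using w by (simp add: S.L_def)
qed

text \<open>Here \<open>big\<close> is \<open>12 * s\<close>, \<open>small\<close> is
  \<open>10 * s\<close>, \<open>\<kappa>\<close> is 1/11 and the diameter bound is 2.\<close>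

lemma S_rho: "S.\<rho> = 1 - exp (- 40 * s) / 22"
  unfolding S.\<rho>_def S.\<kappa>_def S.small_def S.big_def S.\<tau>_def using s by simp

lemma transfer_dual_self:
  fixes f :: "'n rvec \<Rightarrow> complex"
  assumes prob: "prob_space \<mu>" and dual: "transfer_dual s \<mu> (scale_measure (ennreal lam) \<mu>)" and lam: "0 < lam"
    and f: "continuous_on Delta f"
  shows "integral\<^sup>L \<mu> (S.L f) = of_real lam * integral\<^sup>L \<mu> f"
proof -
  have \<mu>: "measure_on_Delta \<mu>" and eq: "integral\<^sup>L (scale_measure (ennreal lam) \<mu>) f = integral\<^sup>L \<mu> (S.L f)"
    using dual f unfolding transfer_dual_def transfer_eq by auto
  have "f \<in> borel_measurable \<mu>" using measure_on_Delta_integrable[OF \<mu> f] by simp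
  then show ?thesis using eq lam by (simp add: integral_scale_measure scaleR_conv_of_real)
qed

text \<open>The abstract theorem gives a functional on Lipschitz functions only. It is extended to
  continuous functions, represented by a measure, and put into the abstract spectral argument; the
  explicit lower bound for the gap is kept for uniformity in \<open>s\<close>.\<close>

theorem transfer_spectral_gap:
  "\<exists>lam r \<nu>. (bounded_operator (C1 :: ('n rvec \<Rightarrow> complex) set) C1_norm (transfer s) \<and> lam > 0 \<and>
      op_eigenvalue (C1 :: ('n rvec \<Rightarrow> complex) set) (transfer s) (of_real lam) \<and>
      multiplicity_of (C1 :: ('n rvec \<Rightarrow> complex) set) (transfer s) (of_real lam) = 1 \<and>
      0 \<le> r \<and> r < lam \<and>
      op_spectrum (C1 :: ('n rvec \<Rightarrow> complex) set) C1_norm (transfer s) - {of_real lam} \<subseteq> cball 0 r \<and>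
      (\<forall>\<mu>. prob_space \<mu> \<and> transfer_dual s \<mu> (scale_measure (ennreal lam) \<mu>) \<longleftrightarrow> \<mu> = (\<nu> :: 'n rvec measure)) \<and>
      (\<exists>!h. h \<in> C1 \<and> transfer s h = cscale (of_real lam) h \<and> integral\<^sup>L \<nu> h = 1) \<and>
      (\<forall>h. h \<in> C1 \<and> transfer s h = cscale (of_real lam) h \<and> integral\<^sup>L \<nu> h = 1 \<longrightarrow>
        (\<forall>w\<in>Delta. h w \<in> \<real> \<and> 0 < Re (h w)))) \<and>
      (1 / 2) powr s * exp (- 40 * s) / 22 \<le> lam - r"
proof -
  obtain lam h \<Lambda> C where lam: "0 < lam" and C: "0 \<le> C" and h_pos: "\<And>x. x \<in> Delta \<Longrightarrow> 0 < h x"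
    and h_off: "\<And>x. x \<notin> Delta \<Longrightarrow> h x = 0" and h_lip: "\<exists>B. Delta.lip_le h B"
    and Lh: "S.L h = (\<lambda>x. lam * h x)"
    and h_approx: "\<And>e. 0 < e \<Longrightarrow> \<exists>n a. Delta.lip_le (\<lambda>x. h x - a * (S.L ^^ n) (\<lambda>_. 1::real) x) e"
    and \<Lambda>1: "\<Lambda> (\<lambda>_. 1) = 1"
    and gap: "\<And>f B n. Delta.lip_le f B \<Longrightarrow> Delta.lip_le (\<lambda>x. (S.L ^^ n) f x / lam ^ n - \<Lambda> f * h x) (C * S.\<rho> ^ n * B)"
    and lam_ge: "\<And>m. (\<forall>x\<in>Delta. m \<le> S.L (\<lambda>_. 1) x) \<Longrightarrow> m \<le> lam"
    using S.ruelle_perron_frobenius by (elim exE conjE) blast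
  obtain hB where hB: "Delta.lip_le h hB" using h_lip by blast
  define b where "b = Delta.base"
  have b: "b \<in> Delta" unfolding b_def by (rule Delta.base_in)
  have hb: "0 < h b" by (rule h_pos[OF b])
  have \<rho>0: "(\<lambda>n. A * S.\<rho> ^ n) \<longlonglongrightarrow> 0" for A
    using tendsto_mult[OF tendsto_const LIMSEQ_power_zero[of S.\<rho>], of A] S.\<rho>_bounds by simp
  have one_lip: "Delta.lip_le (\<lambda>_. 1 :: real) 1" by (simp add: Delta.lip_le_def l1_dist_nonneg)
  have bdd: "bounded (f ` Delta)" if "continuous_on Delta f" for f :: "'n rvec \<Rightarrow> 'x::real_normed_vector"
    by (rule compact_imp_bounded[OF compact_continuous_image[OF that Delta_compact]])
  have bdd_const: "bounded ((\<lambda>_. c) ` (Delta :: 'n rvec set))" for c :: real by (auto simp: bounded_iff)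

  \<comment> \<open>Positive functionals that make sense for every bounded function and converge to
    \<open>\<Lambda>\<close> on Lipschitz ones.\<close>
  define A where "A n f = (S.L ^^ n) f b / lam ^ n / h b" for n and f :: "'n rvec \<Rightarrow> real"
  have A_lip: "(\<lambda>n. A n f) \<longlonglongrightarrow> \<Lambda> f" if f: "Delta.lip_le f B" for f B
  proof -
    have "\<bar>(S.L ^^ n) f b / lam ^ n - \<Lambda> f * h b\<bar> \<le> (C * B) * S.\<rho> ^ n" for n
      using Delta.lip_leD(1)[OF gap[OF f] b, of n] by (simp add: mult_ac)
    then have "(\<lambda>n. (S.L ^^ n) f b / lam ^ n) \<longlonglongrightarrow> \<Lambda> f * h b"
      by (intro Lim_transform_bound[OF _ \<rho>0[of "C * B"], THEN LIM_zero_cancel] eventuallyI)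
        (auto intro: order_trans[OF _ abs_ge_self])
    from tendsto_divide[OF this tendsto_const[of "h b"]] show ?thesis using hb by (simp add: A_def)
  qed
  have A_add: "A n (\<lambda>x. f x + g x) = A n f + A n g" if "bounded (f ` Delta)" "bounded (g ` Delta)" for n f g
    using S.L_funpow_add[OF that, of n] by (simp add: A_def add_divide_distrib)
  have A_cmult: "A n (\<lambda>x. c * f x) = c * A n f" for n c f
    using S.L_funpow_cmult[of n c f] by (simp add: A_def)
  have A_mono: "A n f \<le> A n g" if "bounded (f ` Delta)" "bounded (g ` Delta)" "\<And>x. x \<in> Delta \<Longrightarrow> f x \<le> g x" for n f g
    using S.L_funpow_mono[OF that b, of n] lam hb by (simp add: A_def divide_right_mono)
  have A1: "(\<lambda>n. A n (\<lambda>_. 1)) \<longlonglongrightarrow> 1" using A_lip[OF one_lip] \<Lambda>1 by simp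
  \<comment> \<open>By positivity the norms of the functionals \<open>A n\<close> are governed by
    their values at 1. This uniform bound carries convergence from the dense Lipschitz functions to
    all continuous ones.\<close>
  obtain M where M: "0 < M" "\<And>n. \<bar>A n (\<lambda>_. 1)\<bar> \<le> M"
    using convergent_imp_Bseq[OF convergentI[OF A1]] unfolding Bseq_def by auto
  have A_close: "\<bar>A n f - A n g\<bar> \<le> e * M" if f: "bounded (f ` Delta)" and g: "bounded (g ` Delta)"
    and e: "0 \<le> e" "\<And>x. x \<in> Delta \<Longrightarrow> \<bar>f x - g x\<bar> \<le> e" for n f g e
  proof -
    have step: "A n f \<le> A n g + e * M" if f: "bounded (f ` Delta)" and g: "bounded (g ` Delta)"
      and le: "\<And>x. x \<in> Delta \<Longrightarrow> f x \<le> g x + e * 1" for f g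
    proof -
      have bg: "bounded ((\<lambda>x. g x + e * 1) ` Delta)" using bounded_plus_comp[OF g bdd_const] .
      have "A n f \<le> A n (\<lambda>x. g x + e * 1)" by (rule A_mono[OF f bg le])
      also have "\<dots> = A n g + e * A n (\<lambda>_. 1)" using A_add[OF g bdd_const] A_cmult[of n e "\<lambda>_. 1"] by simp
      also have "e * A n (\<lambda>_. 1) \<le> e * M" using M(2)[of n] e(1) by (intro mult_left_mono) auto
      finally show ?thesis by simp
    qed
    have "f x \<le> g x + e * 1" "g x \<le> f x + e * 1" if "x \<in> Delta" for x using e(2)[OF that] by auto
    then show ?thesis using step[OF f g] step[OF g f] by (simp add: abs_le_iff)
  qed
  have A_conv: "convergent (\<lambda>n. A n f)" if f: "continuous_on Delta f" for f
  proof (rule Cauchy_convergent, rule metric_CauchyI)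
    fix e :: real assume e: "0 < e"
    have e3: "0 < e / (3 * M)" using e M by simp
    obtain g B where g: "\<And>x. x \<in> Delta \<Longrightarrow> \<bar>f x - g x\<bar> < e / (3 * M)" "Delta.lip_le g B"
      using continuous_approx[OF f e3] by blast
    have close: "\<bar>A n f - A n g\<bar> \<le> e / 3" for n
    proof -
      have "\<bar>A n f - A n g\<bar> \<le> e / (3 * M) * M"
        by (rule A_close[OF bdd[OF f] Delta.lip_le_bounded[OF g(2)]]) (use e3 g(1) in \<open>auto intro: less_imp_le\<close>)
      then show ?thesis using M by simp
    qed
    have "Cauchy (\<lambda>n. A n g)" using A_lip[OF g(2)] by (rule LIMSEQ_imp_Cauchy)
    then obtain N where N: "\<And>m n. N \<le> m \<Longrightarrow> N \<le> n \<Longrightarrow> dist (A m g) (A n g) < e / 3"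
      using e unfolding Cauchy_def by (meson divide_pos_pos zero_less_numeral)
    have "dist (A m f) (A n f) < e" if "N \<le> m" "N \<le> n" for m n
      using N[OF that] close[of m] close[of n] unfolding dist_real_def by linarith
    then show "\<exists>N. \<forall>m\<ge>N. \<forall>n\<ge>N. dist (A m f) (A n f) < e" by blast
  qed
  define \<Phi> where "\<Phi> f = lim (\<lambda>n. A n f)" for f
  have \<Phi>: "(\<lambda>n. A n f) \<longlonglongrightarrow> \<Phi> f" if "continuous_on Delta f" for f
    using A_conv[OF that] by (simp add: \<Phi>_def convergent_LIMSEQ_iff)
  have \<Phi>_lip: "\<Phi> f = \<Lambda> f" if "Delta.lip_le f B" for f B
    using LIMSEQ_unique[OF \<Phi>[OF lip_le_continuous[OF that]] A_lip[OF that]] .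
  interpret R: positive_functional "Delta :: 'n rvec set" \<Phi>
  proof
    show "\<Phi> (\<lambda>x. f x + g x) = \<Phi> f + \<Phi> g" if f: "continuous_on Delta f" and g: "continuous_on Delta g" for f g
    proof -
      have "(\<lambda>n. A n (\<lambda>x. f x + g x)) \<longlonglongrightarrow> \<Phi> f + \<Phi> g"
        unfolding A_add[OF bdd[OF f] bdd[OF g]] by (intro tendsto_add \<Phi> f g)
      then show ?thesis using LIMSEQ_unique[OF \<Phi>[OF continuous_on_add[OF f g]]] by blast
    qed
    show "\<Phi> (\<lambda>x. a * f x) = a * \<Phi> f" if f: "continuous_on Delta f" for f a
    proof -
      have "(\<lambda>n. A n (\<lambda>x. a * f x)) \<longlonglongrightarrow> a * \<Phi> f"
        unfolding A_cmult by (intro tendsto_mult_left \<Phi> f)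
      then show ?thesis using LIMSEQ_unique[OF \<Phi>[OF continuous_on_mult_left[OF f]]] by blast
    qed
    show "0 \<le> \<Phi> f" if f: "continuous_on Delta f" "\<And>x. x \<in> Delta \<Longrightarrow> 0 \<le> f x" for f
    proof (rule LIMSEQ_le_const[OF \<Phi>[OF f(1)]])
      have "0 \<le> A n f" for n
        using A_mono[OF bdd_const[of 0] bdd[OF f(1)], of n] f(2) A_cmult[of n 0 "\<lambda>_. 0"] by simp
      then show "\<exists>N. \<forall>n\<ge>N. 0 \<le> A n f" by blast
    qed
  qed (rule Delta_compact)
  define \<nu> where "\<nu> = R.riesz_measure"
  have \<nu>_on: "measure_on_Delta \<nu>"
    unfolding measure_on_Delta_def \<nu>_def using R.finite_measure_riesz R.sets_riesz by blast
  have \<nu>_int: "integral\<^sup>L \<nu> f = \<Phi> f" if "continuous_on Delta f" for f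
    unfolding \<nu>_def using R.integral_riesz[OF that] .
  have \<Phi>1: "\<Phi> (\<lambda>_. 1) = 1" using \<Phi>_lip[OF one_lip] \<Lambda>1 by simp
  have \<nu>_prob: "prob_space \<nu>"
  proof
    have "measure \<nu> (space \<nu>) = 1" using R.measure_riesz_space \<Phi>1 by (simp add: \<nu>_def)
    then show "emeasure \<nu> (space \<nu>) = 1"
      using finite_measure.emeasure_eq_measure[OF R.finite_measure_riesz] by (simp add: \<nu>_def)
  qed

  obtain M1 where M1: "0 < M1" "\<And>x. x \<in> Delta \<Longrightarrow> S.L (\<lambda>_. 1 :: real) x \<le> M1"
  proof
    let ?M = "(\<Sum>\<^sub>\<infinity>i\<in>T_Gamma. S.W i) * (1 + 2 * s) * 1"
    show "S.L (\<lambda>_. 1 :: real) x \<le> \<bar>?M\<bar> + 1" if "x \<in> Delta" for x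
      using Delta.lip_leD(1)[OF S.L_lip_le[OF one_lip] that] by simp
  qed simp
  have L_cont: "continuous_on Delta (S.L f)" if f: "continuous_on Delta f" for f :: "'n rvec \<Rightarrow> real"
  proof (rule continuous_on_uniform_approx)
    fix e :: real assume e: "0 < e"
    have e2: "0 < e / (2 * M1)" using e M1 by simp
    obtain g B where g: "\<And>x. x \<in> Delta \<Longrightarrow> \<bar>f x - g x\<bar> < e / (2 * M1)" "Delta.lip_le g B"
      using continuous_approx[OF f e2] by blast
    have "\<bar>S.L f x - S.L g x\<bar> < e" if x: "x \<in> Delta" for x
    proof -
      have "norm (S.L (\<lambda>x. f x - g x) x) \<le> e / (2 * M1) * S.L (\<lambda>_. 1::real) x"
        by (rule S.norm_L_le) (use g(1) x in \<open>auto intro: less_imp_le\<close>)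
      also have "\<dots> \<le> e / (2 * M1) * M1" using M1(2)[OF x] e2 by (intro mult_left_mono) auto
      also have "\<dots> < e" using M1 e by simp
      finally show ?thesis using S.L_diff[OF bdd[OF f] Delta.lip_le_bounded[OF g(2)]] by simp
    qed
    then show "\<exists>g. continuous_on Delta g \<and> (\<forall>x\<in>Delta. \<bar>S.L f x - g x\<bar> < e)"
      using lip_le_continuous[OF S.L_lip_le[OF g(2)]] by blast
  qed
  \<comment> \<open>Applying \<open>L\<close> shifts the index of the normalised iterates by one,
    which produces the factor \<open>lam\<close>.\<close>
  have \<Phi>_L: "\<Phi> (S.L f) = lam * \<Phi> f" if f: "continuous_on Delta f" for f
  proof -
    have "A n (S.L f) = lam * A (Suc n) f" for n
      using lam by (simp add: A_def funpow_swap1)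
    moreover have "(\<lambda>n. lam * A (Suc n) f) \<longlonglongrightarrow> lam * \<Phi> f"
      by (intro tendsto_mult_left LIMSEQ_Suc \<Phi> f)
    ultimately show ?thesis using LIMSEQ_unique[OF \<Phi>[OF L_cont[OF f]]] by simp
  qed
  have LRe: "S.L (\<lambda>x. Re (f x)) = (\<lambda>x. Re (S.L f x))" "S.L (\<lambda>x. Im (f x)) = (\<lambda>x. Im (S.L f x))"
    if "bounded (f ` Delta)" for f
    using S.L_bounded_linear[OF bounded_linear_Re that] S.L_bounded_linear[OF bounded_linear_Im that] by auto
  have L_cont_c: "continuous_on Delta (S.L f)" if f: "continuous_on Delta f" for f :: "'n rvec \<Rightarrow> complex"
    using continuous_on_Complex[OF L_cont[OF continuous_on_Re[OF f]] L_cont[OF continuous_on_Im[OF f]]]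
    unfolding LRe[OF bdd[OF f]] by simp
  have \<nu>_dual: "integral\<^sup>L \<nu> (S.L f) = of_real lam * integral\<^sup>L \<nu> f"
    if f: "continuous_on Delta f" for f :: "'n rvec \<Rightarrow> complex"
  proof (rule complex_eqI)
    note i = measure_on_Delta_integrable[OF \<nu>_on f] measure_on_Delta_integrable[OF \<nu>_on L_cont_c[OF f]]
    have "Re (integral\<^sup>L \<nu> (S.L f)) = \<Phi> (S.L (\<lambda>x. Re (f x)))"
      using \<nu>_int[OF L_cont[OF continuous_on_Re[OF f]]] LRe(1)[OF bdd[OF f]] i by simp
    also have "\<dots> = lam * Re (integral\<^sup>L \<nu> f)"
      using \<Phi>_L[OF continuous_on_Re[OF f]] \<nu>_int[OF continuous_on_Re[OF f]] i by simp
    finally show "Re (integral\<^sup>L \<nu> (S.L f)) = Re (of_real lam * integral\<^sup>L \<nu> f)" by simp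
    have "Im (integral\<^sup>L \<nu> (S.L f)) = \<Phi> (S.L (\<lambda>x. Im (f x)))"
      using \<nu>_int[OF L_cont[OF continuous_on_Im[OF f]]] LRe(2)[OF bdd[OF f]] i by simp
    also have "\<dots> = lam * Im (integral\<^sup>L \<nu> f)"
      using \<Phi>_L[OF continuous_on_Im[OF f]] \<nu>_int[OF continuous_on_Im[OF f]] i by simp
    finally show "Im (integral\<^sup>L \<nu> (S.L f)) = Im (of_real lam * integral\<^sup>L \<nu> f)" by simp
  qed
  have scale_on: "measure_on_Delta (scale_measure (ennreal lam) \<nu>)"
  proof -
    have "emeasure \<nu> (space \<nu>) < top"
      using \<nu>_prob prob_space.emeasure_space_1 by fastforce
    then have "finite_measure (scale_measure (ennreal lam) \<nu>)"
      by (intro finite_measureI) (simp add: space_scale_measure ennreal_mult_eq_top_iff)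
    then show ?thesis using \<nu>_on by (simp add: measure_on_Delta_def)
  qed
  have dual: "transfer_dual s \<nu> (scale_measure (ennreal lam) \<nu>)"
    unfolding transfer_dual_def transfer_eq
  proof (intro conjI allI impI \<nu>_on scale_on)
    fix f :: "'n rvec \<Rightarrow> complex" assume f: "continuous_on Delta f"
    show "integral\<^sup>L (scale_measure (ennreal lam) \<nu>) f = integral\<^sup>L \<nu> (S.L f)"
      unfolding \<nu>_dual[OF f] using measure_on_Delta_integrable[OF \<nu>_on f] lam
      by (simp add: integral_scale_measure scaleR_conv_of_real)
  qed

  \<comment> \<open>Integrating the gap estimate against any eigenmeasure, whose integrals scale
    exactly by \<open>lam ^ n\<close>, gives \<open>\<Lambda> g\<close> times the integral of
    \<open>h\<close>; \<open>g = 1\<close> shows that this integral is 1. So all eigenmeasures agree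
    on Lipschitz functions, which proves uniqueness.\<close>
  have integral_lip: "integral\<^sup>L \<mu> f = \<Lambda> f"
    if prob: "prob_space \<mu>" and dual: "transfer_dual s \<mu> (scale_measure (ennreal lam) \<mu>)" and f: "Delta.lip_le f B"
    for \<mu> f B
  proof -
    interpret prob_space \<mu> by fact
    have \<mu>: "measure_on_Delta \<mu>" using dual by (simp add: transfer_dual_def)
    have lip_n: "\<exists>B. Delta.lip_le ((S.L ^^ n) g) B" if "Delta.lip_le g B" for g :: "'n rvec \<Rightarrow> real" and B n
      using that by (induction n) (auto intro: S.L_lip_le)
    have real_dual: "integral\<^sup>L \<mu> (S.L g) = lam * integral\<^sup>L \<mu> g" if g: "Delta.lip_le g B" for g :: "'n rvec \<Rightarrow> real" and B
    proof -
      have "continuous_on Delta (\<lambda>x. complex_of_real (g x))"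
        by (intro continuous_intros lip_le_continuous[OF g])
      from transfer_dual_self[OF prob dual lam this]
      have "complex_of_real (integral\<^sup>L \<mu> (S.L g)) = of_real (lam * integral\<^sup>L \<mu> g)"
        unfolding S.L_bounded_linear[OF bounded_linear_of_real Delta.lip_le_bounded[OF g]] by simp
      then show ?thesis unfolding of_real_eq_iff .
    qed
    have iter: "integral\<^sup>L \<mu> ((S.L ^^ n) g) = lam ^ n * integral\<^sup>L \<mu> g" if g: "Delta.lip_le g B" for g :: "'n rvec \<Rightarrow> real" and B n
    proof (induction n)
      case (Suc n)
      obtain B' where "Delta.lip_le ((S.L ^^ n) g) B'" using lip_n[OF g] by blast
      from real_dual[OF this] show ?case using Suc by simp
    qed simp
    have ih: "integrable \<mu> h" by (rule measure_on_Delta_integrable[OF \<mu> lip_le_continuous[OF hB]])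
    have main: "integral\<^sup>L \<mu> g = \<Lambda> g * integral\<^sup>L \<mu> h" if g: "Delta.lip_le g B" for g B
    proof -
      have "\<bar>integral\<^sup>L \<mu> g - \<Lambda> g * integral\<^sup>L \<mu> h\<bar> \<le> (C * B) * S.\<rho> ^ n" for n
      proof -
        obtain B' where B': "Delta.lip_le ((S.L ^^ n) g) B'" using lip_n[OF g] by blast
        have i: "integrable \<mu> ((S.L ^^ n) g)" by (rule measure_on_Delta_integrable[OF \<mu> lip_le_continuous[OF B']])
        have "integral\<^sup>L \<mu> (\<lambda>x. (S.L ^^ n) g x / lam ^ n - \<Lambda> g * h x) = integral\<^sup>L \<mu> g - \<Lambda> g * integral\<^sup>L \<mu> h"
          using i ih iter[OF g, of n] lam by simp
        moreover have "norm (integral\<^sup>L \<mu> (\<lambda>x. (S.L ^^ n) g x / lam ^ n - \<Lambda> g * h x)) \<le> C * S.\<rho> ^ n * B"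
          by (rule norm_integral_le[OF prob \<mu> lip_le_continuous[OF gap[OF g]] Delta.lip_leD(1)[OF gap[OF g]]])
        ultimately show ?thesis by (simp add: mult_ac)
      qed
      then have "\<bar>integral\<^sup>L \<mu> g - \<Lambda> g * integral\<^sup>L \<mu> h\<bar> \<le> 0"
        by (intro LIMSEQ_le_const[OF \<rho>0[of "C * B"]]) auto
      then show ?thesis by simp
    qed
    have "integral\<^sup>L \<mu> h = 1" using main[OF one_lip] \<Lambda>1 by (simp add: prob_space)
    then show ?thesis using main[OF f] by simp
  qed
  have unique: "\<mu> = \<nu>" if prob: "prob_space \<mu>" and dual': "transfer_dual s \<mu> (scale_measure (ennreal lam) \<mu>)" for \<mu>
  proof (rule measure_eqI_lipschitz[OF compact_imp_closed[OF Delta_compact]])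
    show "finite_measure \<mu>" "sets \<mu> = sets (restrict_space borel Delta)"
      using dual' by (auto simp: transfer_dual_def measure_on_Delta_def)
    show "finite_measure \<nu>" "sets \<nu> = sets (restrict_space borel Delta)"
      using \<nu>_on by (auto simp: measure_on_Delta_def)
    fix f :: "'n rvec \<Rightarrow> real" and c assume f: "c-lipschitz_on UNIV f" "\<And>x. 0 \<le> f x \<and> f x \<le> 1"
    have "Delta.lip_le f (max 1 c)"
    proof (rule Delta.lip_leI)
      show "norm (f x) \<le> max 1 c" for x
        using f(2)[of x] by (simp add: le_max_iff_disj)
      fix x y :: "'n rvec"
      have "norm (f x - f y) \<le> c * norm (x - y)" using lipschitz_onD[OF f(1), of x y] by (simp add: dist_norm)
      also have "\<dots> \<le> max 1 c * l1_dist x y" by (intro mult_mono norm_le_l1_dist) auto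
      finally show "norm (f x - f y) \<le> max 1 c * l1_dist x y" .
    qed
    then show "integral\<^sup>L \<mu> f = integral\<^sup>L \<nu> f"
      using integral_lip[OF prob dual'] integral_lip[OF \<nu>_prob dual] by simp
  qed

  define hc where "hc w = complex_of_real (h w)" for w
  have unit_eq: "(S.L ^^ n) unit_fun x = of_real ((S.L ^^ n) (\<lambda>_. 1) x)" if "x \<in> Delta" for n x
  proof -
    have "(S.L ^^ n) unit_fun x = (S.L ^^ n) (\<lambda>_. of_real 1) x"
      by (rule S.L_funpow_cong[OF _ that]) (simp add: unit_fun_def)
    then show ?thesis
      using S.L_funpow_bounded_linear[of complex_of_real "\<lambda>_. 1" n, OF bounded_linear_of_real bdd_const] by simp
  qed
  have unit_n: "(S.L ^^ n) unit_fun \<in> C1" for n by (induction n) (simp_all add: unit_fun_C1 transfer_in)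
  \<comment> \<open>\<open>hc\<close> is a Lipschitz limit of multiples of iterates of the constant
    1, represented in \<open>C1\<close> by \<open>unit_fun\<close>.\<close>
  have hc: "hc \<in> C1"
  proof (rule C1_closed)
    show "hc w = 0" if "w \<notin> Delta" for w using h_off[OF that] by (simp add: hc_def)
    fix e :: real assume "0 < e"
    then obtain n a where na: "Delta.lip_le (\<lambda>x. h x - a * (S.L ^^ n) (\<lambda>_. 1::real) x) e" using h_approx by blast
    have "Delta.lip_le (\<lambda>x. complex_of_real (h x - a * (S.L ^^ n) (\<lambda>_. 1::real) x)) e"
      by (rule Delta.lip_le_bounded_linear[OF bounded_linear_of_real _ na]) simp
    then have "Delta.lip_le (\<lambda>x. hc x - cscale (of_real a) ((S.L ^^ n) unit_fun) x) e"
      by (simp add: Delta.lip_le_def hc_def cscale_def unit_eq)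
    then show "\<exists>g\<in>C1. Delta.lip_le (\<lambda>w. hc w - g w) e" using C1_cscale(1)[OF unit_n] by blast
  qed
  have bounded_h: "bounded (h ` Delta)" by (rule Delta.lip_le_bounded[OF hB])
  have Thc: "S.L hc = cscale (of_real lam) hc"
    unfolding hc_def[abs_def] S.L_bounded_linear[OF bounded_linear_of_real bounded_h] Lh by (simp add: cscale_def)
  have int_c: "integrable \<nu> f" if "f \<in> C1" for f :: "'n rvec \<Rightarrow> complex"
    by (rule measure_on_Delta_integrable[OF \<nu>_on C1_continuous[OF that]])
  have "\<Lambda> h = 1"
  proof -
    have "(S.L ^^ n) h = (\<lambda>x. lam ^ n * h x)" for n
      by (induction n) (simp_all add: S.L_cmult Lh mult.assoc mult.left_commute[of lam])
    then have "A n h = 1" for n using lam hb by (simp add: A_def)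
    then show ?thesis using LIMSEQ_unique[OF A_lip[OF hB]] by simp
  qed
  then have \<nu>_hc: "integral\<^sup>L \<nu> hc = 1"
    using integral_lip[OF \<nu>_prob dual hB] by (simp add: hc_def[abs_def])
  \<comment> \<open>Real and imaginary parts are estimated separately, hence the factor 2;
    \<open>1 + 8 * real CARD('n) ^ 2\<close> is the price of the norm equivalence.\<close>
  have gap_c: "C1_norm ((S.L ^^ n) f - cscale (of_real lam ^ n * integral\<^sup>L \<nu> f) hc)
      \<le> (1 + 8 * real CARD('n) ^ 2) * (2 * C) * (lam * S.\<rho>) ^ n * C1_norm f"
    if f: "f \<in> C1" for f :: "'n rvec \<Rightarrow> complex" and n
  proof -
    let ?B = "C * S.\<rho> ^ n * C1_norm f"
    have fl: "Delta.lip_le f (C1_norm f)" by (rule C1_lip_le[OF f])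
    have re: "Delta.lip_le (\<lambda>x. Re (f x)) (C1_norm f)"
      by (rule Delta.lip_le_bounded_linear[OF bounded_linear_Re _ fl]) (simp add: abs_Re_le_cmod)
    have im: "Delta.lip_le (\<lambda>x. Im (f x)) (C1_norm f)"
      by (rule Delta.lip_le_bounded_linear[OF bounded_linear_Im _ fl]) (simp add: abs_Im_le_cmod)
    have Lre: "(S.L ^^ n) (\<lambda>x. Re (f x)) = (\<lambda>x. Re ((S.L ^^ n) f x))"
      by (rule S.L_funpow_bounded_linear[OF bounded_linear_Re C1_bounded[OF f]])
    have Lim: "(S.L ^^ n) (\<lambda>x. Im (f x)) = (\<lambda>x. Im ((S.L ^^ n) f x))"
      by (rule S.L_funpow_bounded_linear[OF bounded_linear_Im C1_bounded[OF f]])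
    have \<Lambda>re: "\<Lambda> (\<lambda>x. Re (f x)) = Re (integral\<^sup>L \<nu> f)" and \<Lambda>im: "\<Lambda> (\<lambda>x. Im (f x)) = Im (integral\<^sup>L \<nu> f)"
      using integral_lip[OF \<nu>_prob dual re] integral_lip[OF \<nu>_prob dual im] int_c[OF f] by simp_all
    have 1: "Delta.lip_le (\<lambda>x. of_real ((S.L ^^ n) (\<lambda>x. Re (f x)) x / lam ^ n - \<Lambda> (\<lambda>x. Re (f x)) * h x) :: complex) ?B"
      by (rule Delta.lip_le_bounded_linear[OF bounded_linear_of_real _ gap[OF re]]) simp
    have 2: "Delta.lip_le (\<lambda>x. \<i> * of_real ((S.L ^^ n) (\<lambda>x. Im (f x)) x / lam ^ n - \<Lambda> (\<lambda>x. Im (f x)) * h x)) ?B"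
      by (rule Delta.lip_le_bounded_linear[OF bounded_linear_compose[OF bounded_linear_mult_right bounded_linear_of_real] _ gap[OF im]])
        (simp add: norm_mult)
    have eq: "(lam ^ n) *\<^sub>R (of_real ((S.L ^^ n) (\<lambda>x. Re (f x)) x / lam ^ n - \<Lambda> (\<lambda>x. Re (f x)) * h x)
        + \<i> * of_real ((S.L ^^ n) (\<lambda>x. Im (f x)) x / lam ^ n - \<Lambda> (\<lambda>x. Im (f x)) * h x))
        = ((S.L ^^ n) f - cscale (of_real lam ^ n * integral\<^sup>L \<nu> f) hc) x" for x
      unfolding Lre Lim \<Lambda>re \<Lambda>im using lam
      by (simp add: complex_eq_iff cscale_def hc_def right_diff_distrib of_real_power[symmetric] del: of_real_power)
    have "Delta.lip_le ((S.L ^^ n) f - cscale (of_real lam ^ n * integral\<^sup>L \<nu> f) hc) (\<bar>lam ^ n\<bar> * (?B + ?B))"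
      using Delta.lip_le_scaleR[OF Delta.lip_le_add[OF 1 2], of "lam ^ n"] unfolding eq .
    moreover have "(S.L ^^ n) f \<in> C1" by (induction n) (simp_all add: f transfer_in)
    ultimately have "C1_norm ((S.L ^^ n) f - cscale (of_real lam ^ n * integral\<^sup>L \<nu> f) hc)
        \<le> (1 + 8 * real CARD('n) ^ 2) * (\<bar>lam ^ n\<bar> * (?B + ?B))"
      by (intro C1_norm_le C1_diff C1_cscale(1) hc)
    also have "(1 + 8 * real CARD('n) ^ 2) * (\<bar>lam ^ n\<bar> * (?B + ?B))
        = (1 + 8 * real CARD('n) ^ 2) * (2 * C) * (lam * S.\<rho>) ^ n * C1_norm f"
      using lam by (simp add: power_mult_distrib)
    finally show ?thesis .
  qed
  interpret G: spectral_gap "C1 :: ('n rvec \<Rightarrow> complex) set" C1_norm "transfer s" hc "\<lambda>f. integral\<^sup>L \<nu> f"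
    lam "lam * S.\<rho>" "(1 + 8 * real CARD('n) ^ 2) * (2 * C)" 1
  proof
    show "integral\<^sup>L \<nu> (f + g) = integral\<^sup>L \<nu> f + integral\<^sup>L \<nu> g" if "f \<in> C1" "g \<in> C1" for f g :: "'n rvec \<Rightarrow> complex"
      using int_c that by (simp add: plus_fun_def)
    show "integral\<^sup>L \<nu> (cscale c f) = c * integral\<^sup>L \<nu> f" for f c by (simp add: cscale_def)
    show "integral\<^sup>L \<nu> (transfer s f) = of_real lam * integral\<^sup>L \<nu> f" if "f \<in> C1" for f
      unfolding transfer_eq by (rule \<nu>_dual[OF C1_continuous[OF that]])
    show "cmod (integral\<^sup>L \<nu> f) \<le> 1 * C1_norm f" if "f \<in> C1" for f
      using norm_integral_le[OF \<nu>_prob \<nu>_on C1_continuous[OF that] Delta.lip_leD(1)[OF C1_lip_le[OF that]]] by simp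
    show "cmod (f x) \<le> C1_norm f" if f: "f \<in> C1" for f and x :: "'n rvec"
      using Delta.lip_leD(1)[OF C1_lip_le[OF f]] Delta.lip_le_nonneg[OF C1_lip_le[OF f]] C1D(1)[OF f]
      by (cases "x \<in> Delta") auto
    show "C1_norm ((transfer s ^^ n) f - cscale (of_real (lam ^ n) * integral\<^sup>L \<nu> f) hc)
      \<le> (1 + 8 * real CARD('n) ^ 2) * (2 * C) * (lam * S.\<rho>) ^ n * C1_norm f"
      if "f \<in> C1" for f :: "'n rvec \<Rightarrow> complex" and n
      unfolding transfer_eq of_real_power by (rule gap_c[OF that])
  qed (use lam S.\<rho>_bounds hc Thc \<nu>_hc in \<open>simp_all add: C1_add(1) C1_cscale(1) C1_norm_triangle C1_norm_cscale
      C1_complete transfer_bounded transfer_eq[symmetric]\<close>)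

  have bound: "(1 / 2) powr s * exp (- 40 * s) / 22 \<le> lam - lam * S.\<rho>"
  proof -
    have "(1 / 2) powr s \<le> lam" by (rule lam_ge) (use transfer_one_ge in blast)
    then have "(1 / 2) powr s * (exp (- 40 * s) / 22) \<le> lam * (exp (- 40 * s) / 22)" by (intro mult_right_mono) auto
    also have "\<dots> = lam - lam * S.\<rho>" unfolding S_rho by (simp add: algebra_simps)
    finally show ?thesis by simp
  qed
  have measure_unique: "\<forall>\<mu>. prob_space \<mu> \<and> transfer_dual s \<mu> (scale_measure (ennreal lam) \<mu>) \<longleftrightarrow> \<mu> = \<nu>"
    using unique \<nu>_prob dual by blast
  have eig: "g = hc" if "g \<in> C1 \<and> transfer s g = cscale (of_real lam) g \<and> integral\<^sup>L \<nu> g = 1" for g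
  proof -
    have i: "integral\<^sup>L \<nu> g = 1" using that by blast
    have "g = cscale (integral\<^sup>L \<nu> g) hc" using G.eigenvector_unique[of g] that by blast
    also have "\<dots> = hc" unfolding i by (simp add: cscale_def)
    finally show ?thesis .
  qed
  have eigenfunction_unique: "\<exists>!g. g \<in> C1 \<and> transfer s g = cscale (of_real lam) g \<and> integral\<^sup>L \<nu> g = 1"
    using eig hc Thc[folded transfer_eq] \<nu>_hc by (intro ex1I[of _ hc]) blast+
  have "hc w \<in> \<real> \<and> 0 < Re (hc w)" if "w \<in> Delta" for w
    using h_pos[OF that] by (simp add: hc_def)
  then have positive: "\<forall>g. g \<in> C1 \<and> transfer s g = cscale (of_real lam) g \<and> integral\<^sup>L \<nu> g = 1 \<longrightarrow>
      (\<forall>w\<in>Delta. g w \<in> \<real> \<and> 0 < Re (g w))"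
    using eig by blast
  note all = conjI[OF conjI[OF transfer_bounded conjI[OF lam conjI[OF G.eigenvalue conjI[OF G.multiplicity
    conjI[OF G.r_nonneg conjI[OF G.r_less conjI[OF G.spectrum_subset conjI[OF measure_unique
    conjI[OF eigenfunction_unique positive]]]]]]]]] bound]
  show ?thesis
    by (rule exI[of _ lam], rule exI[of _ "lam * S.\<rho>"], rule exI[of _ \<nu>], rule all)
qed

end

end

section \<open>Uniformity over compact intervals of exponents\<close>

theorem theorem4p7:
  assumes "3 \<le> CARD('n::{finite,linorder})"
  shows "\<exists>(lam :: real \<Rightarrow> real) (R :: real \<Rightarrow> real) (\<nu> :: real \<Rightarrow> ('n rvec) measure).
    (\<forall>s>1.
      bounded_operator (C1 :: ('n rvec \<Rightarrow> complex) set) C1_norm (transfer s) \<and>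
      lam s > 0 \<and>
      op_eigenvalue (C1 :: ('n rvec \<Rightarrow> complex) set) (transfer s) (of_real (lam s)) \<and>
      multiplicity_of (C1 :: ('n rvec \<Rightarrow> complex) set) (transfer s) (of_real (lam s)) = 1 \<and>
      0 \<le> R s \<and> R s < lam s \<and>
      op_spectrum (C1 :: ('n rvec \<Rightarrow> complex) set) C1_norm (transfer s) - {of_real (lam s)}
        \<subseteq> cball 0 (R s) \<and>
      (\<forall>\<mu>. prob_space \<mu> \<and> transfer_dual s \<mu> (scale_measure (ennreal (lam s)) \<mu>) \<longleftrightarrow> \<mu> = \<nu> s) \<and>
      (\<exists>!h. h \<in> C1 \<and> transfer s h = cscale (of_real (lam s)) h \<and> integral\<^sup>L (\<nu> s) h = 1) \<and>
      (\<forall>h. h \<in> C1 \<and> transfer s h = cscale (of_real (lam s)) h \<and> integral\<^sup>L (\<nu> s) h = 1 \<longrightarrow>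
        (\<forall>w\<in>Delta. h w \<in> \<real> \<and> 0 < Re (h w)))) \<and>
    (\<forall>a b. 1 < a \<and> a \<le> b \<longrightarrow> (\<exists>\<epsilon>>0. \<forall>s\<in>{a..b}. lam s - R s \<ge> \<epsilon>))"
proof -
  interpret dim3 "TYPE('n)" by unfold_locales (rule assms)
  define P where "P s lam r \<nu> \<longleftrightarrow>
      bounded_operator (C1 :: ('n rvec \<Rightarrow> complex) set) C1_norm (transfer s) \<and> lam > 0 \<and>
      op_eigenvalue (C1 :: ('n rvec \<Rightarrow> complex) set) (transfer s) (of_real lam) \<and>
      multiplicity_of (C1 :: ('n rvec \<Rightarrow> complex) set) (transfer s) (of_real lam) = 1 \<and>
      0 \<le> r \<and> r < lam \<and>
      op_spectrum (C1 :: ('n rvec \<Rightarrow> complex) set) C1_norm (transfer s) - {of_real lam} \<subseteq> cball 0 r \<and>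
      (\<forall>\<mu>. prob_space \<mu> \<and> transfer_dual s \<mu> (scale_measure (ennreal lam) \<mu>) \<longleftrightarrow> \<mu> = (\<nu> :: 'n rvec measure)) \<and>
      (\<exists>!h. h \<in> C1 \<and> transfer s h = cscale (of_real lam) h \<and> integral\<^sup>L \<nu> h = 1) \<and>
      (\<forall>h. h \<in> C1 \<and> transfer s h = cscale (of_real lam) h \<and> integral\<^sup>L \<nu> h = 1 \<longrightarrow>
        (\<forall>w\<in>Delta. h w \<in> \<real> \<and> 0 < Re (h w)))" for s lam r \<nu>
  have "\<exists>lam r \<nu>. P s lam r \<nu> \<and> (1 / 2) powr s * exp (- 40 * s) / 22 \<le> lam - r" if "1 < s" for s
    unfolding P_def by (rule transfer_spectral_gap[OF that])
  then obtain lam R \<nu> where P: "\<And>s. 1 < s \<Longrightarrow> P s (lam s) (R s) (\<nu> s)"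
    and gap: "\<And>s. 1 < s \<Longrightarrow> (1 / 2) powr s * exp (- 40 * s) / 22 \<le> lam s - R s" by metis
  have "\<exists>\<epsilon>>0. \<forall>s\<in>{a..b}. \<epsilon> \<le> lam s - R s" if ab: "1 < a" "a \<le> b" for a b :: real
  proof (intro exI conjI ballI)
    \<comment> \<open>The bound for the gap decreases in \<open>s\<close>, so its value at the right
      endpoint serves the whole interval.\<close>
    show "0 < (1 / 2) powr b * exp (- 40 * b) / 22" by simp
    fix s assume s: "s \<in> {a..b}"
    have "(1 / 2) powr b * exp (- 40 * b) \<le> (1 / 2) powr s * exp (- 40 * s)"
      using s ab by (intro mult_mono powr_mono') auto
    then show "(1 / 2) powr b * exp (- 40 * b) / 22 \<le> lam s - R s"
      using gap[of s] s ab by fastforce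
  qed
  then have "(\<forall>s>1. P s (lam s) (R s) (\<nu> s)) \<and> (\<forall>a b. 1 < a \<and> a \<le> b \<longrightarrow> (\<exists>\<epsilon>>0. \<forall>s\<in>{a..b}. lam s - R s \<ge> \<epsilon>))"
    using P by blast
  then show ?thesis
    unfolding P_def by (intro exI[of _ lam] exI[of _ R] exI[of _ \<nu>])
qed

end
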